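(* Let $\mathcal M$ be a finite-dimensional von Neumann algebra with faithful trace $\tau$, $\mathcal N\subset\mathcal M$ a von Neumann subalgebra, and $\rho,\sigma$ faithful states. Let $\alpha\in(1/2,1)\cup(1,\infty)$, $\alpha'=\frac{\alpha}{\alpha-1}$, and $\varepsilon\in\left(0,\frac{1-1/|\alpha'|}{2}\right)$. Let $\widetilde Q_\alpha(\rho\|\sigma)=\|\rho^{1/2}\sigma^{-1/\alpha'}\rho^{1/2}\|_\alpha$ and $\widetilde Q_\infty(\rho\|\sigma)=\|\rho^{1/2}\sigma^{-1}\rho^{1/2}\|_\infty$. Then for all $t\in\mathbb R$, with $\gamma:=\frac{1}{\frac{1-1/|\alpha'|}{2}-\varepsilon}$, \begin{align*} |\widetilde Q_\alpha(\rho\|\sigma)-\widetilde Q_\alpha(\rho_{\mathcal N}\|\sigma_{\mathcal N})|&\ge\left(K\,\frac{\pi}{2}\|\rho-R_\sigma(\rho_{\mathcal N})\|_1\right)^{\gamma},\\ |\widetilde Q_\alpha(\rho\|\sigma)-\widetilde Q_\alpha(\rho_{\mathcal N}\|\sigma_{\mathcal N})|&\ge\left(K\,\frac{\pi}{2\cosh(\pi t)}\|\rho-R^t_\sigma(\rho_{\mathcal N})\|_1\right)^{\gamma},\\ |\widetilde Q_\alpha(\rho\|\sigma)-\widetilde Q_\alpha(\rho_{\mathcal N}\|\sigma_{\mathcal N})|&\ge\left(K\,\frac12\|\rho-R^u_\sigma(\rho_{\mathcal N})\|_1\right)^{\gamma}, \end{align*} where $K=\left(4\widetilde Q_\infty(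\rho\|\sigma)^{1/2}+\left(\frac{\pi}{e\varepsilon\sin(\pi/|\alpha'|)}\right)^{1/2}+4\right)^{-1}$.
   Context: $\mathcal M$ is a finite-dimensional von Neumann algebra with faithful trace $\tau$; $\mathcal N\subset\mathcal M$ is a von Neumann subalgebra containing the identity with trace-preserving conditional expectation $E:\mathcal M\to\mathcal N$. States are density operators $\rho\ge0$, $\tau(\rho)=1$; faithful means invertible. $\rho_{\mathcal N}=E(\rho)$, $\sigma_{\mathcal N}=E(\sigma)$. $\|x\|_p=\tau(|x|^p)^{1/p}$ for $p\in(0,\infty)$ (a quasi-norm for $p<1$) and $\|x\|_\infty$ is the operator norm. For faithful $\sigma$ and $t\in\mathbb R$, $R^t_\sigma(x)=\sigma^{\frac12-it}\sigma_{\mathcal N}^{-\frac12+it}\,x\,\sigma_{\mathcal N}^{-\frac12-it}\sigma^{\frac12+it}$ for $x\in\mathcal N$; $R_\sigma:=R^0_\sigma$; $R^u_\sigma(x)=\int_{\mathbb R}R_\sigma^{t/2}(x)\,d\beta(t)$ with $d\beta(t)=\frac{\pi}{2}(\cosh(\pi t)+1)^{-1}dt$. *)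

theory Defs
  imports "HOL-Analysis.Analysis"
begin

text \<open>A finite-dimensional von Neumann algebra is modelled (up to *-isomorphism) as a
unital *-subalgebra of the complex matrices indexed by a finite type 'n.\<close>

definition madj :: "complex^'n^'n \<Rightarrow> complex^'n^'n" where
  "madj A = (\<chi> i j. cnj (A $ j $ i))"

definition cscale :: "complex \<Rightarrow> complex^'n^'n \<Rightarrow> complex^'n^'n" where
  "cscale c A = (\<chi> i j. c * A $ i $ j)"

definition hermitian :: "complex^'n^'n \<Rightarrow> bool" where
  "hermitian A \<longleftrightarrow> madj A = A"

definition psd :: "complex^'n^'n \<Rightarrow> bool" where
  "psd A \<longleftrightarrow> hermitian A \<and> (\<forall>v. 0 \<le> Re (\<Sum>i\<in>UNIV. cnj (v $ i) * (A *v v) $ i))"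

text \<open>Functional calculus for diagonalizable (here: self-adjoint) matrices:
f(A) acts as multiplication by f(c) on the c-eigenspace of A.\<close>
definition mat_fun :: "(complex \<Rightarrow> complex) \<Rightarrow> complex^'n^'n \<Rightarrow> complex^'n^'n" where
  "mat_fun f A = (THE B. \<forall>c v. A *v v = c *s v \<longrightarrow> B *v v = f c *s v)"

text \<open>Complex powers A^z of a positive matrix (with 0 powr z = 0).\<close>
definition mpow :: "complex^'n^'n \<Rightarrow> complex \<Rightarrow> complex^'n^'n" where
  "mpow A z = mat_fun (\<lambda>x. x powr z) A"

definition schatten_norm :: "(complex^'n^'n \<Rightarrow> complex) \<Rightarrow> real \<Rightarrow> complex^'n^'n \<Rightarrow> real" where
  "schatten_norm \<tau> p x = (Re (\<tau> (mpow (madj x ** x) (complex_of_real (p / 2))))) powr (1 / p)"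

definition op_norm :: "complex^'n^'n \<Rightarrow> real" where
  "op_norm x = onorm (\<lambda>v. x *v v)"

definition star_subalg :: "(complex^'n^'n) set \<Rightarrow> bool" where
  "star_subalg M \<longleftrightarrow> mat 1 \<in> M \<and> (\<forall>x\<in>M. \<forall>y\<in>M. x + y \<in> M \<and> x ** y \<in> M)
     \<and> (\<forall>c. \<forall>x\<in>M. cscale c x \<in> M) \<and> (\<forall>x\<in>M. madj x \<in> M)"

definition faithful_trace :: "(complex^'n^'n) set \<Rightarrow> (complex^'n^'n \<Rightarrow> complex) \<Rightarrow> bool" where
  "faithful_trace M \<tau> \<longleftrightarrow>
     (\<forall>x\<in>M. \<forall>y\<in>M. \<tau> (x + y) = \<tau> x + \<tau> y \<and> \<tau> (x ** y) = \<tau> (y ** x))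
   \<and> (\<forall>c. \<forall>x\<in>M. \<tau> (cscale c x) = c * \<tau> x)
   \<and> (\<forall>x\<in>M. x \<noteq> 0 \<longrightarrow> Im (\<tau> (madj x ** x)) = 0 \<and> Re (\<tau> (madj x ** x)) > 0)"

definition cond_exp :: "(complex^'n^'n) set \<Rightarrow> (complex^'n^'n) set \<Rightarrow> (complex^'n^'n \<Rightarrow> complex)
    \<Rightarrow> (complex^'n^'n \<Rightarrow> complex^'n^'n) \<Rightarrow> bool" where
  "cond_exp M N \<tau> E \<longleftrightarrow>
     (\<forall>x\<in>M. E x \<in> N)
   \<and> (\<forall>x\<in>M. \<forall>y\<in>M. E (x + y) = E x + E y)
   \<and> (\<forall>c. \<forall>x\<in>M. E (cscale c x) = cscale c (E x))
   \<and> (\<forall>y\<in>N. E y = y)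
   \<and> (\<forall>a\<in>N. \<forall>b\<in>N. \<forall>x\<in>M. E (a ** x ** b) = a ** E x ** b)
   \<and> (\<forall>x\<in>M. psd x \<longrightarrow> psd (E x))
   \<and> (\<forall>x\<in>M. \<tau> (E x) = \<tau> x)"

definition faithful_state :: "(complex^'n^'n) set \<Rightarrow> (complex^'n^'n \<Rightarrow> complex) \<Rightarrow> complex^'n^'n \<Rightarrow> bool" where
  "faithful_state M \<tau> \<rho> \<longleftrightarrow> \<rho> \<in> M \<and> psd \<rho> \<and> \<tau> \<rho> = 1 \<and> invertible \<rho>"

definition Q_sand :: "(complex^'n^'n \<Rightarrow> complex) \<Rightarrow> real \<Rightarrow> complex^'n^'n \<Rightarrow> complex^'n^'n \<Rightarrow> real" where
  "Q_sand \<tau> \<alpha> \<rho> \<sigma> = schatten_norm \<tau> \<alpha>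
     (mpow \<rho> (1/2) ** mpow \<sigma> (complex_of_real (- 1 / (\<alpha> / (\<alpha> - 1)))) ** mpow \<rho> (1/2))"

definition Q_inf :: "complex^'n^'n \<Rightarrow> complex^'n^'n \<Rightarrow> real" where
  "Q_inf \<rho> \<sigma> = op_norm (mpow \<rho> (1/2) ** mpow \<sigma> (-1) ** mpow \<rho> (1/2))"

definition petz_rot :: "(complex^'n^'n \<Rightarrow> complex^'n^'n) \<Rightarrow> complex^'n^'n \<Rightarrow> real
    \<Rightarrow> complex^'n^'n \<Rightarrow> complex^'n^'n" where
  "petz_rot E \<sigma> t x =
     mpow \<sigma> (1/2 - \<i> * complex_of_real t) ** mpow (E \<sigma>) (- 1/2 + \<i> * complex_of_real t) ** x
       ** mpow (E \<sigma>) (- 1/2 - \<i> * complex_of_real t) ** mpow \<sigma> (1/2 + \<i> * complex_of_real t)"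

definition petz_univ :: "(complex^'n^'n \<Rightarrow> complex^'n^'n) \<Rightarrow> complex^'n^'n
    \<Rightarrow> complex^'n^'n \<Rightarrow> complex^'n^'n" where
  "petz_univ E \<sigma> x = integral UNIV (\<lambda>t. (pi / 2 / (cosh (pi * t) + 1)) *\<^sub>R petz_rot E \<sigma> (t / 2) x)"

end

theory Submission
  imports Defs "HOL-Complex_Analysis.Complex_Analysis" "HOL-Real_Asymp.Real_Asymp"
    "HOL-Computational_Algebra.Fundamental_Theorem_Algebra"
begin

text \<open>
  For \<open>\<alpha> \<le> 2\<close> let \<open>W\<close> be the normalised \<open>\<alpha>\<close>-th power of
  \<open>\<rho>N^(1/2) \<sigma>N^\<beta> \<rho>N^(1/2)\<close>, \<open>\<beta> = 1/\<alpha> - 1\<close>, and \<open>\<Omega> = v\<^sup>* W v\<close> with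
  \<open>v = \<rho>N^(-1/2) \<rho>^(1/2)\<close>. The quantity for \<open>N\<close> is the \<open>\<beta>\<close>-th moment of the operator
  \<open>x \<mapsto> \<sigma>N x W^(-1)\<close> at \<open>\<rho>N^(1/2)\<close>, while Hoelder's inequality compares the one for \<open>M\<close> with the
  same moment of \<open>x \<mapsto> \<sigma> x \<Omega>^(-1)\<close> at \<open>\<rho>^(1/2)\<close>. The difference of the moments is a
  Mellin transform of the difference \<open>h\<close> of the resolvent forms, and \<open>h\<close> bounds the squared distance of the
  resolvent vectors. Integrating these vectors against \<open>\<lambda>^(-1/2 + i t)\<close>, with cut-offs at
  \<open>D\<close> and \<open>1/D\<close>, bounds \<open>\<rho> - R\<^sup>t(\<rho>N)\<close>; the logarithm from the middle range costs the \<open>\<epsilon>\<close>.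

  For \<open>\<alpha> > 2\<close> the tail of \<open>h\<close> is too heavy for the required constant. There the three lines theorem is applied to an
  analytic family that interpolates between a trace-norm estimate and an \<open>L\<^sup>2\<close> contraction with
  remainder, which gives \<open>(\<parallel>\<rho> - R\<^sup>t(\<rho>N)\<parallel>\<^sub>1 / (2 cosh \<pi>t))\<^sup>\<alpha> \<le> Q\<^sup>\<alpha> - Q\<^sub>N\<^sup>\<alpha>\<close>. The
  remainder comes from the Poisson formula on a strip. The bound for \<open>R\<^sup>u\<close> follows by averaging over \<open>t\<close>.
\<close>

subsection \<open>Mellin transform of the resolvent\<close>

text \<open>The dividing line \<alpha> = 2 comes from the tail term \<open>C / r * D powr r\<close>.
  For \<alpha> > 1 the moments of \<open>W\<close> give a tail of \<open>h\<close> of order -1 -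
  1/\<alpha>, hence r = 1/(2 \<alpha>), and 1/r <= 4 holds only up to \<alpha> = 2, while the
  constant to be reached does not grow with \<alpha>. With s = |1 - 1/\<alpha>| = 1/|\<alpha>'|, the
  term 4 \<open>Q_inf\<close>^(1/2) and the 4 in 1/K pay for the two outer ranges; the middle root
  is the Mellin factor pi / sin(pi s) combined with 2 ln(1/D) <= D^(-2 \<epsilon>) / (e \<epsilon>).
  \<open>W\<close> makes Hoelder's inequality an equality on N. On M it is one-sided, and for either
  sign of 1/\<alpha> - 1 it errs so that the difference of the moments is at most that of the
  quantities. \<open>Om\<close> is chosen so that the form on N is a compression of the form on M;
  completing a square then gives both h >= 0 and the distance of the resolvent vectors. Trace norms
  are treated by pairing with a self-adjoint X with X X = 1. The number D stays strictly above the
  difference and below 1, because ln(1/D) must be positive and finite; only at the end does it tend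
  to the difference.\<close>

lemma exp_plus_one_eq_0_strip:
  fixes w :: complex
  assumes "1 + exp w = 0" "-pi < Im w" "Im w < 3 * pi"
  shows "w = \<i> * pi"
proof -
  have "exp w = exp (\<i> * pi)" using assms(1) by (simp add: add_eq_0_iff)
  then obtain n :: int where n: "w = \<i> * pi + of_int (2 * n) * pi * \<i>"
    using exp_eq by metis
  have "Im w = pi + 2 * n * pi" using n by simp
  with assms have "- (2 * pi) < 2 * n * pi" "2 * n * pi < 2 * pi" by linarith+
  hence "(-1) * (2 * pi) < real_of_int n * (2 * pi)" "real_of_int n * (2 * pi) < 1 * (2 * pi)" by (simp_all add: mult_ac)
  hence "-1 < real_of_int n" "real_of_int n < 1"
    using pi_gt_zero mult_less_cancel_right_pos[of "2 * pi"] by (metis mult_pos_pos zero_less_numeral)+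
  hence "n = 0" by linarith
  thus ?thesis using n by simp
qed

text \<open>A shift by 2 pi i multiplies the integrand by exp(2 pi i z), so the two horizontal sides
  of the rectangle combine into one integral, and the only enclosed pole is i pi. \<open>V\<close>
  collects the vertical sides.\<close>

lemma rect_integral_exp_over_one_plus_exp:
  fixes z :: complex and R :: real
  assumes R: "R > 0"
  defines "f \<equiv> (\<lambda>w. exp (z * w) / (1 + exp w))"
  defines "V \<equiv> contour_integral (linepath (Complex R 0) (Complex R (2*pi))) f
             + contour_integral (linepath (Complex (-R) (2*pi)) (Complex (-R) 0)) f"
  shows "(1 - exp (2 * pi * \<i> * z)) * integral {-R..R} (\<lambda>u. f (of_real u)) + V
           = - 2 * pi * \<i> * exp (\<i> * pi * z)"
    and "norm V \<le> (exp (Re z * R) / (exp R - 1) + exp (- Re z * R) / (1 - exp (-R)))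
                     * exp (2 * pi * \<bar>Im z\<bar>) * (2 * pi)"
proof -
  \<comment> \<open>The widest horizontal strip in which i pi is the only zero of 1 + exp; it
    contains the closed rectangle, as the residue theorem requires.\<close>
  define S where "S = {w :: complex. -pi < Im w \<and> Im w < 3 * pi}"
  define p where "p = \<i> * complex_of_real pi"
  have opS: "open S" unfolding S_def
    by (intro open_Collect_conj open_halfspace_Im_gt open_halfspace_Im_lt)
  have cS: "convex S"
  proof -
    have "S = {w. Im w > -pi} \<inter> {w. Im w < 3*pi}" by (auto simp: S_def)
    thus ?thesis by (simp add: convex_Int convex_halfspace_Im_gt convex_halfspace_Im_lt)
  qed
  have nz: "1 + exp w \<noteq> 0" if "w \<in> S - {p}" for w
    using that exp_plus_one_eq_0_strip[of w] by (auto simp: S_def p_def)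
  have holo: "f holomorphic_on S - {p}"
    unfolding f_def using nz by (intro holomorphic_intros) auto
  have pS: "p \<in> S" by (simp add: S_def p_def)
  have ep: "exp p = -1" by (simp add: p_def)
  have res: "residue f p = - exp (\<i> * pi * z)"
  proof -
    have "residue (\<lambda>w. exp (z * w) / (1 + exp w)) p = exp (z * p) / exp p"
      by (rule residue_simple_pole_deriv[of _ UNIV])
         (auto intro!: holomorphic_intros derivative_eq_intros simp: ep)
    thus ?thesis by (simp add: f_def ep p_def mult_ac)
  qed
  define g where "g = rectpath (Complex (-R) 0) (Complex R (2*pi))"
  have pin: "p \<in> box (Complex (-R) 0) (Complex R (2*pi))"
    using R by (simp add: in_box_complex_iff p_def)
  have img: "path_image g \<subseteq> S - {p}"
  proof -
    have "path_image g \<subseteq> cbox (Complex (-R) 0) (Complex R (2*pi)) - box (Complex (-R) 0) (Complex R (2*pi))"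
      unfolding g_def using R by (simp add: path_image_rectpath_cbox_minus_box)
    also have "\<dots> \<subseteq> S - {p}" using pin pi_gt_zero
      by (auto simp: in_cbox_complex_iff S_def intro: order_less_le_trans[of _ 0] order_le_less_trans[of _ "2*pi"])
    finally show ?thesis .
  qed
  have "contour_integral g f = 2 * pi * \<i> * (\<Sum>q\<in>{p}. winding_number g q * residue f q)"
  proof (rule Residue_theorem[OF opS _ _ holo])
    show "connected S" using cS convex_connected by blast
    show "path_image g \<subseteq> S - {p}" by (rule img)
    show "\<forall>w. w \<notin> S \<longrightarrow> winding_number g w = 0"
      using img cS by (auto intro!: winding_number_zero_outside simp: g_def)
  qed (auto simp: g_def)
  moreover have "winding_number g p = 1" unfolding g_def by (rule winding_number_rectpath[OF pin])
  ultimately have ci: "contour_integral g f = - 2 * pi * \<i> * exp (\<i> * pi * z)"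
    using res by simp
  have contf: "continuous_on (S - {p}) f" using holo holomorphic_on_imp_continuous_on by blast
  have cint: "f contour_integrable_on linepath a b" if "closed_segment a b \<subseteq> S - {p}" for a b
    using contf that continuous_on_subset contour_integrable_continuous_linepath by blast
  have segs: "path_image g = closed_segment (Complex (-R) 0) (Complex R 0)
      \<union> (closed_segment (Complex R 0) (Complex R (2*pi))
      \<union> (closed_segment (Complex R (2*pi)) (Complex (-R) (2*pi))
      \<union> closed_segment (Complex (-R) (2*pi)) (Complex (-R) 0)))"
    unfolding g_def rectpath_def Let_def by (simp add: path_image_join)
  have i1: "f contour_integrable_on linepath (Complex (-R) 0) (Complex R 0)"
   and i2: "f contour_integrable_on linepath (Complex R 0) (Complex R (2*pi))"
   and i3: "f contour_integrable_on linepath (Complex R (2*pi)) (Complex (-R) (2*pi))"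
   and i4: "f contour_integrable_on linepath (Complex (-R) (2*pi)) (Complex (-R) 0)"
    using img segs by (auto intro!: cint)
  have split: "contour_integral g f = contour_integral (linepath (Complex (-R) 0) (Complex R 0)) f
     + contour_integral (linepath (Complex R (2*pi)) (Complex (-R) (2*pi))) f + V"
    unfolding g_def rectpath_def Let_def V_def using i1 i2 i3 i4
    by (simp add: contour_integral_join)
  have e1: "contour_integral (linepath (Complex (-R) 0) (Complex R 0)) f
              = integral {-R..R} (\<lambda>u. f (of_real u))"
    using R by (subst contour_integral_linepath_Reals_eq)
               (auto simp: complex_is_Real_iff)
  have e3: "contour_integral (linepath (Complex R (2*pi)) (Complex (-R) (2*pi))) f
              = - exp (2 * pi * \<i> * z) * contour_integral (linepath (Complex (-R) 0) (Complex R 0)) f"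
  proof -
    have i1': "f contour_integrable_on linepath (Complex R 0) (Complex (-R) 0)"
      using i1 contour_integrable_reversepath[of "linepath (Complex (-R) 0) (Complex R 0)"]
      by auto
    then obtain J where J: "(f has_contour_integral J) (linepath (Complex R 0) (Complex (-R) 0))"
      using contour_integrable_on_def by blast
    have shift: "f (w + 2 * pi * \<i>) = exp (2 * pi * \<i> * z) * f w" for w
      by (simp add: f_def exp_add ring_distribs mult_ac)
    have lp: "linepath (Complex R (2*pi)) (Complex (-R) (2*pi)) x
          = linepath (Complex R 0) (Complex (-R) 0) x + 2 * pi * \<i>" for x
      by (simp add: linepath_def complex_eq_iff algebra_simps)
    have "(f has_contour_integral exp (2 * pi * \<i> * z) * J)
            (linepath (Complex R (2*pi)) (Complex (-R) (2*pi)))"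
    proof -
      have "((\<lambda>x. f (linepath (Complex R 0) (Complex (-R) 0) x) * (Complex (-R) 0 - Complex R 0))
              has_integral J) {0..1}"
        using J by (simp add: has_contour_integral_linepath)
      from has_integral_mult_right[OF this, of "exp (2 * pi * \<i> * z)"]
      have "((\<lambda>x. f (linepath (Complex R (2*pi)) (Complex (-R) (2*pi)) x) * (Complex (-R) 0 - Complex R 0))
              has_integral exp (2 * pi * \<i> * z) * J) {0..1}"
        unfolding lp shift by (simp add: mult.assoc)
      moreover have "Complex (-R) 0 - Complex R 0 = Complex (-R) (2*pi) - Complex R (2*pi)"
        by (simp add: complex_eq_iff)
      ultimately show ?thesis by (simp only: has_contour_integral_linepath)
    qed
    moreover have "J = - contour_integral (linepath (Complex (-R) 0) (Complex R 0)) f"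
      using contour_integral_unique[OF J] contour_integral_reverse_linepath
      using contf continuous_on_subset segs img
      by (metis (no_types, lifting) contour_integral_reversepath reversepath_linepath valid_path_linepath)
    ultimately show ?thesis using contour_integral_unique by fastforce
  qed
  show "(1 - exp (2 * pi * \<i> * z)) * integral {-R..R} (\<lambda>u. f (of_real u)) + V
           = - 2 * pi * \<i> * exp (\<i> * pi * z)"
    using ci split e1 e3 by (simp add: algebra_simps)
  have ee: "norm (exp (z * w)) \<le> exp (Re z * Re w) * exp (2 * pi * \<bar>Im z\<bar>)"
    if "0 \<le> Im w" "Im w \<le> 2 * pi" for w
  proof -
    have "- (Im z * Im w) \<le> \<bar>Im z\<bar> * (2 * pi)"
      using that by (metis abs_ge_minus_self abs_mult abs_of_nonneg abs_ge_zero mult_left_mono order_trans)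
    thus ?thesis by (simp add: exp_add[symmetric] algebra_simps)
  qed
  define C where "C = exp (2 * pi * \<bar>Im z\<bar>)"
  have b2: "norm (contour_integral (linepath (Complex R 0) (Complex R (2*pi))) f)
      \<le> exp (Re z * R) * C / (exp R - 1) * norm (Complex R (2*pi) - Complex R 0)"
  proof (rule contour_integral_bound_linepath[OF i2])
    show "0 \<le> exp (Re z * R) * C / (exp R - 1)" using R by (simp add: C_def)
    fix w assume "w \<in> closed_segment (Complex R 0) (Complex R (2*pi))"
    hence w: "Re w = R" "0 \<le> Im w" "Im w \<le> 2 * pi"
      using closed_segment_same_Re[of "Complex R 0" "Complex R (2*pi)"]
      by (auto simp: closed_segment_eq_real_ivl)
    have "exp R - 1 \<le> norm (1 + exp w)"
      using norm_triangle_ineq2[of "exp w" "-1"] w by (simp add: add.commute)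
    thus "norm (f w) \<le> exp (Re z * R) * C / (exp R - 1)"
      unfolding f_def norm_divide using ee[of w] w R by (intro frac_le) (auto simp: C_def)
  qed
  have b4: "norm (contour_integral (linepath (Complex (-R) (2*pi)) (Complex (-R) 0)) f)
      \<le> exp (- Re z * R) * C / (1 - exp (-R)) * norm (Complex (-R) 0 - Complex (-R) (2*pi))"
  proof (rule contour_integral_bound_linepath[OF i4])
    show "0 \<le> exp (- Re z * R) * C / (1 - exp (-R))" using R by (simp add: C_def)
    fix w assume "w \<in> closed_segment (Complex (-R) (2*pi)) (Complex (-R) 0)"
    hence w: "Re w = -R" "0 \<le> Im w" "Im w \<le> 2 * pi"
      using closed_segment_same_Re[of "Complex (-R) (2*pi)" "Complex (-R) 0"] pi_gt_zero
      by (auto simp: closed_segment_eq_real_ivl not_le[symmetric])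
    have "1 - exp (-R) \<le> norm (1 + exp w)"
      using norm_triangle_ineq2[of 1 "- exp w"] w by simp
    thus "norm (f w) \<le> exp (- Re z * R) * C / (1 - exp (-R))"
      unfolding f_def norm_divide using ee[of w] w R by (intro frac_le) (auto simp: C_def)
  qed
  have n: "norm (Complex R (2*pi) - Complex R 0) = 2 * pi" 
          "norm (Complex (-R) 0 - Complex (-R) (2*pi)) = 2 * pi"
    by (simp_all add: cmod_def real_sqrt_mult)
  have "norm V \<le> exp (Re z * R) * C / (exp R - 1) * (2*pi) + exp (- Re z * R) * C / (1 - exp (-R)) * (2*pi)"
    unfolding V_def using norm_triangle_mono[OF b2 b4] by (simp only: n)
  thus "norm V \<le> (exp (Re z * R) / (exp R - 1) + exp (- Re z * R) / (1 - exp (-R)))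
                     * exp (2 * pi * \<bar>Im z\<bar>) * (2 * pi)"
    by (simp add: C_def algebra_simps)
qed

lemma norm_exp_over_one_plus_exp_le:
  fixes z :: complex
  assumes "0 < \<delta>" "\<delta> \<le> Re z" "\<delta> \<le> 1 - Re z"
  shows "norm (exp (z * of_real u) / (1 + exp (of_real u))) \<le> exp (- \<delta> * \<bar>u\<bar>)"
proof -
  have n: "norm (1 + exp (complex_of_real u)) = 1 + exp u"
    by (metis abs_of_pos add_pos_pos exp_gt_zero exp_of_real less_numeral_extra(1) norm_of_real of_real_1 of_real_add)
  have *: "norm (exp (z * of_real u) / (1 + exp (of_real u))) = exp (Re z * u) / (1 + exp u)"
    by (simp add: norm_divide n)
  show ?thesis
  proof (cases "u \<ge> 0")
    case True
    have "exp (Re z * u) / (1 + exp u) \<le> exp (Re z * u) / exp u"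
      by (intro divide_left_mono) (auto intro!: mult_pos_pos add_pos_pos)
    also have "\<dots> = exp (- (1 - Re z) * u)" by (simp add: exp_diff[symmetric] algebra_simps)
    also have "\<dots> \<le> exp (- \<delta> * \<bar>u\<bar>)"
      using True assms mult_right_mono[of \<delta> "1 - Re z" u] by (simp add: algebra_simps)
    finally show ?thesis using * by simp
  next
    case False
    have "exp (Re z * u) / (1 + exp u) \<le> exp (Re z * u) / 1"
      by (intro divide_left_mono) (auto intro!: mult_pos_pos add_pos_pos)
    also have "\<dots> \<le> exp (- \<delta> * \<bar>u\<bar>)"
      using False assms mult_right_mono_neg[of \<delta> "Re z" u] by simp
    finally show ?thesis using * by simp
  qed
qed

lemma has_bochner_integral_exp_minus_atLeast:
  assumes "a > (0::real)"
  shows "has_bochner_integral lborel (\<lambda>u. indicator {c..} u * exp (- a * u)) (exp (- a * c) / a)"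
proof (rule has_bochner_integral_nn_integral)
  have "(\<integral>\<^sup>+ u. ennreal (exp (- a * u)) * indicator {c..} u \<partial>lborel) = ennreal (0 - (- exp (- a * c) / a))"
  proof (rule nn_integral_FTC_atLeast)
    show "((\<lambda>u. - exp (- a * u) / a) \<longlongrightarrow> 0) at_top" using assms by real_asymp
    show "DERIV (\<lambda>u. - exp (- a * u) / a) x :> exp (- a * x)" for x
      using assms by (auto intro!: derivative_eq_intros)
  qed auto
  moreover have "(\<integral>\<^sup>+ u. ennreal (indicator {c..} u * exp (- a * u)) \<partial>lborel)
     = (\<integral>\<^sup>+ u. ennreal (exp (- a * u)) * indicator {c..} u \<partial>lborel)"
    by (intro nn_integral_cong) (auto simp: indicator_def)
  ultimately show "(\<integral>\<^sup>+ u. ennreal (indicator {c..} u * exp (- a * u)) \<partial>lborel) = ennreal (exp (- a * c) / a)"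
    by simp
qed (use assms in auto)

lemma has_bochner_integral_exp_atMost:
  assumes "a > (0::real)"
  shows "has_bochner_integral lborel (\<lambda>u. indicator {..c} u * exp (a * u)) (exp (a * c) / a)"
proof -
  have "has_bochner_integral lborel (\<lambda>u. indicator {-c..} (0 + (-1) * u) * exp (- a * (0 + (-1) * u))) (exp (- a * (-c)) / a /\<^sub>R \<bar>-1\<bar>)"
    using has_bochner_integral_exp_minus_atLeast[OF assms, of "-c"]
    by (subst lborel_has_bochner_integral_real_affine_iff[symmetric]) auto
  moreover have "indicator {-c..} (0 + (-1) * u) = (indicator {..c} u :: real)" for u
    by (auto simp: indicator_def)
  ultimately show ?thesis by simp
qed

lemma integrable_exp_minus_abs:
  assumes "\<delta> > (0::real)"
  shows "integrable lborel (\<lambda>u. exp (- \<delta> * \<bar>u\<bar>))"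
proof (rule Bochner_Integration.integrable_bound)
  show "integrable lborel (\<lambda>u. indicator {0..} u * exp (- \<delta> * u) + indicator {..0} u * exp (\<delta> * u))"
    using has_bochner_integral_exp_minus_atLeast[OF assms] has_bochner_integral_exp_atMost[OF assms]
    by (intro Bochner_Integration.integrable_add) (auto simp: has_bochner_integral_iff)
qed (auto simp: indicator_def)

lemma integrable_exp_over_one_plus_exp:
  fixes z :: complex
  assumes "0 < Re z" "Re z < 1"
  shows "integrable lborel (\<lambda>u. exp (z * of_real u) / (1 + exp (of_real u)))"
proof (rule Bochner_Integration.integrable_bound)
  define \<delta> where "\<delta> = min (Re z) (1 - Re z)"
  show "integrable lborel (\<lambda>u. exp (- \<delta> * \<bar>u\<bar>))"
    using assms by (intro integrable_exp_minus_abs) (auto simp: \<delta>_def)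
  show "AE u in lborel. norm (exp (z * of_real u) / (1 + exp (of_real u))) \<le> norm (exp (- \<delta> * \<bar>u\<bar>))"
    using norm_exp_over_one_plus_exp_le[of \<delta> z] assms by (auto simp: \<delta>_def)
qed auto

text \<open>The width of the rectangle tends to infinity. As 0 < Re z < 1, both vertical sides
  vanish, and division by exp(i pi z) turns 1 - exp(2 pi i z) into a multiple of the sine.\<close>

lemma integral_exp_over_one_plus_exp:
  fixes z :: complex
  assumes z: "0 < Re z" "Re z < 1"
  shows "(LINT u|lborel. exp (z * of_real u) / (1 + exp (of_real u))) = pi / sin (pi * z)"
proof -
  define f where "f = (\<lambda>u::real. exp (z * of_real u) / (1 + exp (of_real u)))"
  define q where "q = exp (\<i> * pi * z)"
  have intf: "integrable lborel f"
    unfolding f_def by (rule integrable_exp_over_one_plus_exp[OF z])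
  have "(\<lambda>n. LINT u:{-real n..real n}|lborel. f u) \<longlonglongrightarrow> (LINT u:UNIV|lborel. f u)"
  proof -
    have "(\<lambda>n. LINT u|lborel. indicator {-real n..real n} u *\<^sub>R f u) \<longlonglongrightarrow> (LINT u|lborel. f u)"
    proof (rule integral_dominated_convergence[where w = "\<lambda>u. norm (f u)"])
      show "AE u in lborel. (\<lambda>n. indicator {- real n..real n} u *\<^sub>R f u) \<longlonglongrightarrow> f u"
      proof (rule AE_I2, rule tendsto_eventually)
        fix u :: real
        obtain m where "\<bar>u\<bar> \<le> real m" using real_arch_simple by blast
        thus "\<forall>\<^sub>F n in sequentially. indicator {- real n..real n} u *\<^sub>R f u = f u"
          by (intro eventually_sequentiallyI[of m]) (auto simp: indicator_def)
      qed
    qed (use intf in \<open>auto simp: indicator_def\<close>)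
    thus ?thesis by (simp add: set_lebesgue_integral_def)
  qed
  moreover have "(LINT u:{-real n..real n}|lborel. f u) = integral {-real n..real n} f" for n
  proof (rule set_borel_integral_eq_integral)
    show "set_integrable lborel {- real n..real n} f"
      unfolding set_integrable_def using intf by (intro integrable_mult_indicator) auto
  qed
  ultimately have lim: "(\<lambda>n. integral {-real n..real n} f) \<longlonglongrightarrow> (LINT u|lborel. f u)"
    by (simp add: set_lebesgue_integral_def)
  define V where "V = (\<lambda>n. - 2 * pi * \<i> * q - (1 - exp (2 * pi * \<i> * z)) * integral {-real n..real n} f)"
  have "V \<longlonglongrightarrow> 0"
  proof (rule Lim_null_comparison)
    define b where "b = Re z"
    have "((\<lambda>x::real. exp (b * x) / (exp x - 1) + exp (- b * x) / (1 - exp (-x))) \<longlongrightarrow> 0) at_top"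
    proof -
      have e0: "((\<lambda>x::real. exp (- c * x)) \<longlongrightarrow> 0) at_top" if "c > 0" for c :: real
      proof -
        have "filterlim (\<lambda>x. c * x) at_top at_top" using that
          by (intro filterlim_tendsto_pos_mult_at_top[OF tendsto_const _ filterlim_ident])
        hence "((\<lambda>x. exp (- (c * x))) \<longlongrightarrow> 0) at_top"
          by (intro filterlim_compose[OF exp_at_bot] filterlim_compose[OF filterlim_uminus_at_bot_at_top])
        thus ?thesis by simp
      qed
      have e1: "((\<lambda>x::real. 1 - exp (- x)) \<longlongrightarrow> 1) at_top" by real_asymp
      have lim0: "((\<lambda>x::real. exp (- (1 - b) * x) / (1 - exp (-x)) + exp (- b * x) / (1 - exp (-x))) \<longlongrightarrow> 0 / 1 + 0 / 1) at_top"
        using z by (intro tendsto_add tendsto_divide e0 e1) (auto simp: b_def)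
      have ev: "\<forall>\<^sub>F x in at_top. exp (- (1 - b) * x) / (1 - exp (-x)) = exp (b * x) / (exp x - 1)"
        using eventually_gt_at_top[of 0]
      proof eventually_elim
        case (elim x)
        have "exp (- (1 - b) * x) = exp (b * x) * exp (- x)"
          unfolding exp_add[symmetric] by (rule arg_cong[where f = exp]) (simp add: algebra_simps)
        moreover have "1 - exp (- x) = (exp x - 1) * exp (- x)"
          using exp_add[of x "- x"] by (simp add: left_diff_distrib)
        ultimately show ?case by simp
      qed
      from ev have ev2: "\<forall>\<^sub>F x in at_top. exp (- (1 - b) * x) / (1 - exp (-x)) + exp (- b * x) / (1 - exp (-x))
            = exp (b * x) / (exp x - 1) + exp (- b * x) / (1 - exp (-x))"
        by eventually_elim simp
      have "((\<lambda>x::real. exp (b * x) / (exp x - 1) + exp (- b * x) / (1 - exp (-x))) \<longlongrightarrow> 0 / 1 + 0 / 1) at_top"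
        by (rule Lim_transform_eventually[OF lim0 ev2])
      thus ?thesis by simp
    qed
    hence "((\<lambda>x::real. (exp (b * x) / (exp x - 1) + exp (- b * x) / (1 - exp (-x))) * exp (2 * pi * \<bar>Im z\<bar>) * (2 * pi)) \<longlongrightarrow> 0) at_top"
      by (intro tendsto_mult_left_zero)
    thus "(\<lambda>n. (exp (Re z * n) / (exp n - 1) + exp (- Re z * n) / (1 - exp (-real n))) * exp (2 * pi * \<bar>Im z\<bar>) * (2 * pi)) \<longlonglongrightarrow> 0"
      unfolding b_def by (rule filterlim_compose[OF _ filterlim_real_sequentially])
    show "\<forall>\<^sub>F n in sequentially. norm (V n) \<le> (exp (Re z * n) / (exp n - 1) + exp (- Re z * n) / (1 - exp (-real n))) * exp (2 * pi * \<bar>Im z\<bar>) * (2 * pi)"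
    proof (rule eventually_sequentiallyI[of 1])
      fix n :: nat assume "1 \<le> n"
      hence n: "real n > 0" by simp
      note r = rect_integral_exp_over_one_plus_exp[OF n, of z, folded f_def]
      have "V n = contour_integral (linepath (Complex n 0) (Complex n (2*pi))) (\<lambda>w. exp (z * w) / (1 + exp w))
             + contour_integral (linepath (Complex (- real n) (2*pi)) (Complex (- real n) 0)) (\<lambda>w. exp (z * w) / (1 + exp w))"
        unfolding V_def q_def r(1)[symmetric] by (rule add_diff_cancel_left')
      thus "norm (V n) \<le> (exp (Re z * n) / (exp n - 1) + exp (- Re z * n) / (1 - exp (-real n))) * exp (2 * pi * \<bar>Im z\<bar>) * (2 * pi)"
        using r(2) by simp
    qed
  qed
  moreover have "V \<longlonglongrightarrow> - 2 * pi * \<i> * q - (1 - exp (2 * pi * \<i> * z)) * (LINT u|lborel. f u)"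
    unfolding V_def by (intro tendsto_intros lim)
  ultimately have eq: "(1 - exp (2 * pi * \<i> * z)) * (LINT u|lborel. f u) = - 2 * pi * \<i> * q"
    using LIMSEQ_unique by fastforce
  have qq: "exp (2 * pi * \<i> * z) = q * q"
    by (simp add: q_def exp_add[symmetric] mult_ac)
  have q0: "q \<noteq> 0" by (simp add: q_def)
  have sn: "sin (pi * z) = (q - 1 / q) / (2 * \<i>)"
    by (simp add: sin_exp_eq q_def exp_minus inverse_eq_divide mult_ac)
  have s0: "sin (pi * z) \<noteq> 0"
  proof
    assume "sin (pi * z) = 0"
    then obtain n :: int where "pi * z = complex_of_real (n * pi)" using sin_eq_0 by blast
    hence "z = of_int n" by simp
    hence "0 < n" "n < 1" using z by auto
    thus False by simp
  qed
  have "(LINT u|lborel. f u) * sin (pi * z) = pi"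
  proof -
    have e: "(1 - q * q) * (LINT u|lborel. f u) = - 2 * pi * \<i> * q" using eq qq by simp
    have "(q - 1 / q) * (LINT u|lborel. f u) = - ((1 - q * q) * (LINT u|lborel. f u)) / q" using q0
      by (simp add: field_simps)
    also have "\<dots> = 2 * pi * \<i>" unfolding e using q0 by simp
    finally have "(q - 1 / q) * (LINT u|lborel. f u) = 2 * pi * \<i>" .
    thus ?thesis unfolding sn by (simp add: field_simps)
  qed
  thus ?thesis using s0 by (simp add: f_def field_simps)
qed

text \<open>With l = exp u this is the classical integral of l^(z-1) / (x + l) over the half line.
  Translating u by ln x reduces it to x = 1; the logarithmic variable is kept from here on.\<close>

lemma mellin_resolvent:
  fixes z :: complex and x :: real
  assumes z: "0 < Re z" "Re z < 1" and x: "x > 0"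
  shows "integrable lborel (\<lambda>u. exp (z * of_real u) / of_real (x + exp u))"
    and "(LINT u|lborel. exp (z * of_real u) / of_real (x + exp u))
           = of_real x powr (z - 1) * (pi / sin (pi * z))"
proof -
  define f where "f = (\<lambda>u::real. exp (z * of_real u) / of_real (x + exp u))"
  have eq: "f (ln x + 1 * u) = of_real x powr (z - 1) * (exp (z * of_real u) / (1 + exp (of_real u)))" for u
  proof -
    have "exp (complex_of_real (ln x)) = of_real x" using x by (simp add: exp_of_real)
    hence "of_real x powr (z - 1) = exp (z * of_real (ln x)) / of_real x"
      using x by (simp add: powr_def Ln_of_real left_diff_distrib exp_diff)
    moreover have "of_real (x + exp (ln x + u)) = of_real x * (1 + exp (complex_of_real u))"
      using x by (simp add: exp_add algebra_simps exp_of_real)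
    ultimately show ?thesis by (simp add: f_def exp_add ring_distribs)
  qed
  have "integrable lborel (\<lambda>u. f (ln x + 1 * u))"
    unfolding eq by (intro integrable_mult_right integrable_exp_over_one_plus_exp z)
  thus "integrable lborel (\<lambda>u. exp (z * of_real u) / of_real (x + exp u))"
    by (subst (asm) lborel_integrable_real_affine_iff) (simp_all add: f_def)
  have "(LINT u|lborel. f u) = \<bar>1\<bar> *\<^sub>R (LINT u|lborel. f (ln x + 1 * u))"
    by (rule lborel_integral_real_affine) simp
  also have "\<dots> = of_real x powr (z - 1) * (LINT u|lborel. exp (z * of_real u) / (1 + exp (of_real u)))"
    unfolding eq by (simp only: integral_mult_right_zero abs_one scaleR_one)
  finally show "(LINT u|lborel. exp (z * of_real u) / of_real (x + exp u))
           = of_real x powr (z - 1) * (pi / sin (pi * z))"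
    using integral_exp_over_one_plus_exp[OF z] by (simp add: f_def)
qed

lemma mellin_resolvent_real:
  fixes b x :: real
  assumes b: "0 < b" "b < 1" and x: "x > 0"
  shows "integrable lborel (\<lambda>u. exp (b * u) / (x + exp u))"
    and "(LINT u|lborel. exp (b * u) / (x + exp u)) = x powr (b - 1) * (pi / sin (pi * b))"
proof -
  have eq: "exp (of_real b * of_real u) / of_real (x + exp u) = complex_of_real (exp (b * u) / (x + exp u))" for u
    by (simp add: exp_of_real[symmetric])
  show "integrable lborel (\<lambda>u. exp (b * u) / (x + exp u))"
    using integrable_Re[OF mellin_resolvent(1)[of "of_real b" x]] b x unfolding eq by simp
  have "complex_of_real (LINT u|lborel. exp (b * u) / (x + exp u)) = (LINT u|lborel. complex_of_real (exp (b * u) / (x + exp u)))"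
    by (rule integral_complex_of_real[symmetric])
  also have "\<dots> = of_real (x powr (b - 1) * (pi / sin (pi * b)))"
    using mellin_resolvent(2)[of "of_real b" x] b x unfolding eq
    by (simp add: sin_of_real[symmetric] powr_of_real[symmetric])
  finally show "(LINT u|lborel. exp (b * u) / (x + exp u)) = x powr (b - 1) * (pi / sin (pi * b))"
    by (simp only: of_real_eq_iff)
qed

subsection \<open>Comparing two spectral measures through their resolvents\<close>

text \<open>\<open>x\<close>, \<open>m\<close> are the atoms and masses of the spectral measure on
  the M side, \<open>y\<close>, \<open>n\<close> those on the N side. In the application the indices
  are pairs of eigenvalues and the atoms are their quotients.\<close>

locale spectral_gap =
  fixes I :: "'i set" and J :: "'j set" and x m :: "'i \<Rightarrow> real" and y n :: "'j \<Rightarrow> real"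
  assumes fin: "finite I" "finite J"
    and xpos: "\<And>i. i \<in> I \<Longrightarrow> x i > 0" and ypos: "\<And>j. j \<in> J \<Longrightarrow> y j > 0"
    and mnn: "\<And>i. i \<in> I \<Longrightarrow> m i \<ge> 0" and nnn: "\<And>j. j \<in> J \<Longrightarrow> n j \<ge> 0"
    and msum: "sum m I = 1" and nsum: "sum n J = 1"
begin

definition h :: "real \<Rightarrow> real" where
  "h l = (\<Sum>i\<in>I. m i / (x i + l)) - (\<Sum>j\<in>J. n j / (y j + l))"

text \<open>Both total masses are 1, so the leading terms 1/l of the two resolvents cancel. The
  result serves the tail bound and the case of positive exponents.\<close>

lemma h_times:
  assumes "l > 0"
  shows "l * h l = (\<Sum>j\<in>J. n j * y j / (y j + l)) - (\<Sum>i\<in>I. m i * x i / (x i + l))"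
proof -
  have 1: "l * (m i / (x i + l)) = m i - m i * x i / (x i + l)" if "i \<in> I" for i
    using xpos[OF that] assms by (simp add: field_simps)
  have 2: "l * (n j / (y j + l)) = n j - n j * y j / (y j + l)" if "j \<in> J" for j
    using ypos[OF that] assms by (simp add: field_simps)
  have "l * h l = (\<Sum>i\<in>I. l * (m i / (x i + l))) - (\<Sum>j\<in>J. l * (n j / (y j + l)))"
    by (simp add: h_def right_diff_distrib sum_distrib_left)
  also have "\<dots> = (\<Sum>i\<in>I. m i - m i * x i / (x i + l)) - (\<Sum>j\<in>J. n j - n j * y j / (y j + l))"
    using 1 2 by simp
  finally show ?thesis using msum nsum by (simp add: sum_subtractf)
qed

text \<open>The order of subtraction depends on the sign of \<beta> because powr \<beta> is operator
  convex for -1 < \<beta> < 0 and operator concave for 0 < \<beta> < 1. With this order a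
  nonnegative \<open>h\<close> gives a nonnegative gap.\<close>

definition gap :: "real \<Rightarrow> real" where
  "gap \<beta> = (if \<beta> < 0 then (\<Sum>i\<in>I. m i * x i powr \<beta>) - (\<Sum>j\<in>J. n j * y j powr \<beta>)
            else (\<Sum>j\<in>J. n j * y j powr \<beta>) - (\<Sum>i\<in>I. m i * x i powr \<beta>))"

text \<open>For \<beta> < 0 the Mellin integral with exponent 1 + \<beta> is applied to
  \<open>h\<close>. For \<beta> > 0 this exponent exceeds 1, so one factor exp u is moved into
  \<open>h\<close> by \<open>h_times\<close> and the exponent \<beta> is used.\<close>

lemma gap_integral:
  assumes b: "-1 < \<beta>" "\<beta> < 1" "\<beta> \<noteq> 0"
  shows "has_bochner_integral lborel (\<lambda>u. exp ((1 + \<beta>) * u) * h (exp u)) (pi / sin (pi * \<bar>\<beta>\<bar>) * gap \<beta>)"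
proof (cases "\<beta> < 0")
  case True
  have bb: "0 < 1 + \<beta>" "1 + \<beta> < 1" using b True by auto
  have s: "sin (pi * (1 + \<beta>)) = sin (pi * \<bar>\<beta>\<bar>)"
    using True by (simp add: distrib_left sin_add)
  have "has_bochner_integral lborel
     (\<lambda>u. (\<Sum>i\<in>I. m i * (exp ((1+\<beta>) * u) / (x i + exp u))) - (\<Sum>j\<in>J. n j * (exp ((1+\<beta>) * u) / (y j + exp u))))
     ((\<Sum>i\<in>I. m i * (x i powr \<beta> * (pi / sin (pi * \<bar>\<beta>\<bar>)))) - (\<Sum>j\<in>J. n j * (y j powr \<beta> * (pi / sin (pi * \<bar>\<beta>\<bar>)))))"
    using mellin_resolvent_real[OF bb xpos] mellin_resolvent_real[OF bb ypos]
    by (intro has_bochner_integral_diff has_bochner_integral_sum has_bochner_integral_mult_right)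
       (auto simp: has_bochner_integral_iff s)
  moreover have "exp ((1 + \<beta>) * u) * h (exp u) = (\<Sum>i\<in>I. m i * (exp ((1+\<beta>) * u) / (x i + exp u))) - (\<Sum>j\<in>J. n j * (exp ((1+\<beta>) * u) / (y j + exp u)))" for u
    by (simp add: h_def right_diff_distrib sum_distrib_left mult_ac)
  moreover have "pi / sin (pi * \<bar>\<beta>\<bar>) * gap \<beta> = (\<Sum>i\<in>I. m i * (x i powr \<beta> * (pi / sin (pi * \<bar>\<beta>\<bar>)))) - (\<Sum>j\<in>J. n j * (y j powr \<beta> * (pi / sin (pi * \<bar>\<beta>\<bar>))))"
    using True by (simp add: gap_def right_diff_distrib sum_distrib_left mult_ac)
  ultimately show ?thesis by simp
next
  case False
  have bb: "0 < \<beta>" "\<beta> < 1" using b False by auto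
  have "has_bochner_integral lborel
     (\<lambda>u. (\<Sum>j\<in>J. n j * y j * (exp (\<beta> * u) / (y j + exp u))) - (\<Sum>i\<in>I. m i * x i * (exp (\<beta> * u) / (x i + exp u))))
     ((\<Sum>j\<in>J. n j * y j * (y j powr (\<beta> - 1) * (pi / sin (pi * \<beta>)))) - (\<Sum>i\<in>I. m i * x i * (x i powr (\<beta> - 1) * (pi / sin (pi * \<beta>)))))"
    using mellin_resolvent_real[OF bb xpos] mellin_resolvent_real[OF bb ypos]
    by (intro has_bochner_integral_diff has_bochner_integral_sum has_bochner_integral_mult_right)
       (auto simp: has_bochner_integral_iff)
  moreover have "exp ((1 + \<beta>) * u) * h (exp u) = (\<Sum>j\<in>J. n j * y j * (exp (\<beta> * u) / (y j + exp u))) - (\<Sum>i\<in>I. m i * x i * (exp (\<beta> * u) / (x i + exp u)))" for u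
  proof -
    have "exp ((1 + \<beta>) * u) * h (exp u) = exp (\<beta> * u) * (exp u * h (exp u))"
      by (simp add: distrib_right exp_add)
    thus ?thesis unfolding h_times[OF exp_gt_zero]
      by (simp add: right_diff_distrib sum_distrib_left mult_ac)
  qed
  moreover have "pi / sin (pi * \<bar>\<beta>\<bar>) * gap \<beta> = (\<Sum>j\<in>J. n j * y j * (y j powr (\<beta> - 1) * (pi / sin (pi * \<beta>)))) - (\<Sum>i\<in>I. m i * x i * (x i powr (\<beta> - 1) * (pi / sin (pi * \<beta>))))"
  proof -
    have 1: "n j * y j * (y j powr (\<beta> - 1) * c) = c * (n j * y j powr \<beta>)" if "j \<in> J" for j c
      using ypos[OF that] by (simp add: powr_diff)
    have 2: "m i * x i * (x i powr (\<beta> - 1) * c) = c * (m i * x i powr \<beta>)" if "i \<in> I" for i c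
      using xpos[OF that] by (simp add: powr_diff)
    have "(\<Sum>j\<in>J. n j * y j * (y j powr (\<beta> - 1) * c)) = c * (\<Sum>j\<in>J. n j * y j powr \<beta>)"
      "(\<Sum>i\<in>I. m i * x i * (x i powr (\<beta> - 1) * c)) = c * (\<Sum>i\<in>I. m i * x i powr \<beta>)" for c
      unfolding sum_distrib_left using 1 2 by (auto intro!: sum.cong)
    moreover have "gap \<beta> = (\<Sum>j\<in>J. n j * y j powr \<beta>) - (\<Sum>i\<in>I. m i * x i powr \<beta>)" "\<bar>\<beta>\<bar> = \<beta>"
      using False by (simp_all add: gap_def)
    ultimately show ?thesis by (simp only: right_diff_distrib)
  qed
  ultimately show ?thesis by simp
qed

lemma h_le_moment:
  assumes "l > 0" shows "h l \<le> (\<Sum>i\<in>I. m i * x i powr (-1))"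
proof -
  have "h l \<le> (\<Sum>i\<in>I. m i / (x i + l))"
    unfolding h_def using ypos nnn assms by (simp add: sum_nonneg less_imp_le add_pos_pos)
  also have "\<dots> \<le> (\<Sum>i\<in>I. m i * x i powr (-1))"
  proof (rule sum_mono)
    fix i assume i: "i \<in> I"
    have "m i / (x i + l) \<le> m i / x i"
      using xpos[OF i] mnn[OF i] assms by (intro divide_left_mono) auto
    thus "m i / (x i + l) \<le> m i * x i powr (-1)" using xpos[OF i] by (simp add: powr_minus divide_inverse)
  qed
  finally show ?thesis .
qed

text \<open>Rests on y / (y + l) <= min 1 (y / l) <= (y / l)^p; a moment of order p on the N side
  thus controls \<open>h\<close> at infinity.\<close>

lemma h_le_tail:
  assumes "l > 0" "0 < p" "p \<le> 1"
  shows "h l \<le> (\<Sum>j\<in>J. n j * y j powr p) * l powr (- 1 - p)"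
proof -
  have "l * h l \<le> (\<Sum>j\<in>J. n j * y j / (y j + l))"
    unfolding h_times[OF assms(1)] using xpos mnn assms by (simp add: sum_nonneg less_imp_le add_pos_pos)
  also have "\<dots> \<le> (\<Sum>j\<in>J. n j * y j powr p * l powr (- p))"
  proof (rule sum_mono)
    fix j assume j: "j \<in> J"
    have y: "y j > 0" by (rule ypos[OF j])
    have "y j / (y j + l) \<le> (y j / l) powr p"
    proof (cases "y j \<le> l")
      case True
      have "y j / (y j + l) \<le> (y j / l) powr 1" using y assms by (simp add: frac_le)
      also have "\<dots> \<le> (y j / l) powr p" using y assms True by (intro powr_mono') auto
      finally show ?thesis .
    next
      case False
      have "y j / (y j + l) \<le> 1" using y assms by simp
      also have "\<dots> \<le> (y j / l) powr p" using y assms False by (intro ge_one_powr_ge_zero) auto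
      finally show ?thesis .
    qed
    also have "\<dots> = y j powr p * l powr (- p)" using y assms by (simp add: powr_divide powr_minus_divide)
    finally show "n j * y j / (y j + l) \<le> n j * y j powr p * l powr (- p)"
      using mult_left_mono[OF _ nnn[OF j]] by (fastforce simp: mult.assoc)
  qed
  also have "\<dots> = l * ((\<Sum>j\<in>J. n j * y j powr p) * l powr (- 1 - p))"
  proof -
    have "l * l powr (- 1 - p) = l powr (- p)" using assms powr_mult_base[of l "- 1 - p"] by simp
    thus ?thesis unfolding sum_distrib_right[symmetric]
      by (metis mult.assoc mult.commute)
  qed
  finally show ?thesis using assms by simp
qed

text \<open>The Mellin transform at z = 1/2 + i t turns resolvents into powers -1/2 + i t, with
  factor pi / sin(pi z) = pi / cosh(pi t). The integrand is at most \<open>N\<close> exp(u/2)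
  sqrt(h). Below u = -ln(1/D) the bound \<open>q\<close> is used, above ln(1/D) the tail bound, and
  in between the inequality of arithmetic and geometric means against exp((1 + \<beta>) u) h, whose
  full integral is known from \<open>gap_integral\<close>.\<close>

theorem resolvent_transfer_bound:
  fixes a b :: "_ \<Rightarrow> complex" and \<beta> D t N q r C :: real
  assumes beta: "-1 < \<beta>" "\<beta> < 1" "\<beta> \<noteq> 0"
    and D: "0 < D" "D < 1" and gapD: "gap \<beta> \<le> D" and r: "r > 0"
    and h0: "\<And>l. l > 0 \<Longrightarrow> h l \<ge> 0"
    and hq: "\<And>l. l > 0 \<Longrightarrow> h l \<le> q"
    and ht: "\<And>l. l > 0 \<Longrightarrow> h l \<le> C\<^sup>2 * l powr (- 1 - 2 * r)" and C: "C \<ge> 0"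
    and N: "N \<ge> 0"
    and bound: "\<And>l. l > 0 \<Longrightarrow> norm ((\<Sum>j\<in>J. b j / of_real (y j + l)) - (\<Sum>i\<in>I. a i / of_real (x i + l))) \<le> N * sqrt (h l)"
  shows "norm ((\<Sum>j\<in>J. b j * of_real (y j) powr (-1/2 + \<i> * t)) - (\<Sum>i\<in>I. a i * of_real (x i) powr (-1/2 + \<i> * t)))
    \<le> cosh (pi * t) / pi * N * (2 * sqrt q * sqrt D + C / r * D powr r
         + sqrt (2 * ln (1 / D) * (pi / sin (pi * \<bar>\<beta>\<bar>)) * D powr (1 - \<bar>\<beta>\<bar>)))"
proof -
  define L where "L = ln (1 / D)"
  have L: "L > 0" and DL: "D = exp (- L)" using D by (auto simp: L_def ln_div)
  define s where "s = \<bar>\<beta>\<bar>"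
  have s: "0 < s" "s < 1" using beta by (auto simp: s_def)
  define c0 where "c0 = pi / sin (pi * s)"
  have c0: "c0 > 0" unfolding c0_def using s by (intro divide_pos_pos sin_gt_zero) auto
  define z where "z = 1/2 + \<i> * complex_of_real t"
  have z: "0 < Re z" "Re z < 1" by (simp_all add: z_def)
  have sz: "sin (pi * z) = complex_of_real (cosh (pi * t))"
  proof -
    have "sin (pi * z) = sin (pi/2 + \<i> * complex_of_real (pi * t))"
      by (rule arg_cong[where f = sin]) (simp add: z_def algebra_simps)
    also have "\<dots> = cos (\<i> * complex_of_real (pi * t))"
      by (simp add: sin_add sin_of_real[symmetric] cos_of_real[symmetric])
    also have "\<dots> = complex_of_real (cosh (pi * t))"
      by (simp add: cos_i_times cosh_field_def exp_minus exp_of_real[symmetric])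
    finally show ?thesis .
  qed
  define \<Theta> where "\<Theta> = (\<lambda>l. (\<Sum>j\<in>J. b j / of_real (y j + l)) - (\<Sum>i\<in>I. a i / complex_of_real (x i + l)))"
  define T where "T = (\<Sum>j\<in>J. b j * of_real (y j) powr (-1/2 + \<i> * t)) - (\<Sum>i\<in>I. a i * of_real (x i) powr (-1/2 + \<i> * t))"
  have z1: "z - 1 = -1/2 + \<i> * t" by (simp add: z_def)
  have hb: "has_bochner_integral lborel (\<lambda>u. exp (z * of_real u) * \<Theta> (exp u)) (pi / sin (pi * z) * T)"
  proof -
    have "has_bochner_integral lborel
      (\<lambda>u. (\<Sum>j\<in>J. b j * (exp (z * of_real u) / of_real (y j + exp u))) - (\<Sum>i\<in>I. a i * (exp (z * of_real u) / of_real (x i + exp u))))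
      ((\<Sum>j\<in>J. b j * (of_real (y j) powr (z - 1) * (pi / sin (pi * z)))) - (\<Sum>i\<in>I. a i * (of_real (x i) powr (z - 1) * (pi / sin (pi * z)))))"
      using mellin_resolvent[OF z xpos] mellin_resolvent[OF z ypos]
      by (intro has_bochner_integral_diff has_bochner_integral_sum has_bochner_integral_mult_right)
         (auto simp: has_bochner_integral_iff)
    moreover have "(\<Sum>j\<in>J. b j * (exp (z * of_real u) / of_real (y j + exp u))) - (\<Sum>i\<in>I. a i * (exp (z * of_real u) / of_real (x i + exp u)))
       = exp (z * of_real u) * \<Theta> (exp u)" for u
      by (simp add: \<Theta>_def right_diff_distrib sum_distrib_left mult_ac)
    moreover have "(\<Sum>j\<in>J. b j * (of_real (y j) powr (z - 1) * (pi / sin (pi * z)))) - (\<Sum>i\<in>I. a i * (of_real (x i) powr (z - 1) * (pi / sin (pi * z))))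
       = pi / sin (pi * z) * T"
      unfolding T_def z1 by (simp add: right_diff_distrib sum_distrib_left mult_ac)
    ultimately show ?thesis by simp
  qed
  \<comment> \<open>Minimises \<kappa> L + exp(s L) c0 D / (2 \<kappa>), the total contribution of
    the middle range; both summands then equal \<kappa> L.\<close>
  define \<kappa> where "\<kappa> = sqrt (exp (s * L) * c0 * D / (2 * L))"
  have kap: "\<kappa> > 0" unfolding \<kappa>_def using c0 D L by simp
  define g where "g = (\<lambda>u. sqrt q * (indicator {..-L} u * exp (1/2 * u)) + (\<kappa> / 2 * indicator {-L..L} u
      + exp (s * L) / (2 * \<kappa>) * (exp ((1 + \<beta>) * u) * h (exp u))) + C * (indicator {L..} u * exp (- r * u)))"
  have q0: "q \<ge> 0" using h0[of 1] hq[of 1] by linarith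
  have gI: "has_bochner_integral lborel g (sqrt q * (exp (1/2 * (-L)) / (1/2)) + (\<kappa> / 2 * (2 * L)
      + exp (s * L) / (2 * \<kappa>) * (c0 * gap \<beta>)) + C * (exp (- r * L) / r))"
  proof -
    have ind: "has_bochner_integral lborel (indicator {-L..L}) (2 * L)"
      using L has_bochner_integral_real_indicator[of "{-L..L}" lborel] by simp
    show ?thesis unfolding g_def c0_def s_def
      by (intro has_bochner_integral_add has_bochner_integral_mult_right has_bochner_integral_exp_atMost
            has_bochner_integral_exp_minus_atLeast ind gap_integral beta r) auto
  qed
  have le: "norm (exp (z * of_real u) * \<Theta> (exp u)) \<le> N * g u" for u
  proof -
    define H where "H = h (exp u)"
    have H0: "H \<ge> 0" using h0 by (simp add: H_def)
    have tt: "exp ((1 + \<beta>) * u) * H \<ge> 0" using H0 by simp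
    have nn: "exp (s * L) / (2 * \<kappa>) * (exp ((1 + \<beta>) * u) * H) \<ge> 0" using H0 kap by simp
    have "norm (exp (z * of_real u) * \<Theta> (exp u)) \<le> exp (1/2 * u) * (N * sqrt H)"
      unfolding norm_mult \<Theta>_def H_def using bound[of "exp u"]
      by (intro mult_mono) (auto simp: z_def)
    also have "\<dots> = N * (exp (1/2 * u) * sqrt H)" by simp
    also have "\<dots> \<le> N * g u"
    proof (rule mult_left_mono[OF _ N])
      consider "u < -L" | "-L \<le> u" "u \<le> L" | "u > L" by linarith
      thus "exp (1/2 * u) * sqrt H \<le> g u"
      proof cases
        case 1
        have "sqrt H \<le> sqrt q" using hq[of "exp u"] by (simp add: H_def)
        thus ?thesis using 1 nn L q0 by (simp add: g_def H_def[symmetric] mult.commute add_nonneg_nonneg mult_left_mono add_increasing2)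
      next
        case 3
        have "sqrt H \<le> C * exp (u * (- 1 - 2 * r) / 2)"
        proof -
          have "H \<le> C\<^sup>2 * exp (u * (- 1 - 2 * r))" using ht[of "exp u"] by (simp add: H_def powr_def mult.commute)
          also have "\<dots> = (C * exp (u * (- 1 - 2 * r) / 2))\<^sup>2"
            by (simp add: power_mult_distrib exp_double[symmetric])
          finally show ?thesis using C by (simp add: real_le_lsqrt)
        qed
        hence "exp (1/2 * u) * sqrt H \<le> exp (1/2 * u) * (C * exp (u * (- 1 - 2 * r) / 2))" by simp
        also have "\<dots> = C * exp (- r * u)" by (simp add: mult_exp_exp algebra_simps add_divide_distrib[symmetric])
        finally show ?thesis using 3 nn L by (simp add: g_def H_def[symmetric])
      next
        case 2
        have "(1 - \<beta> * 1) * 0 \<le> 0" by simp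
        \<comment> \<open>In the middle range exp u exceeds exp((1 + \<beta>) u) by a factor of at
          most exp(s L). This loss lowers the final power of D from 1 to 1 - s.\<close>
        have su: "- (s * L) \<le> \<beta> * u"
        proof -
          have "\<bar>\<beta> * u\<bar> \<le> s * L" unfolding abs_mult s_def using 2 L by (intro mult_mono) auto
          thus ?thesis by linarith
        qed
        have e2: "exp u * H \<le> exp (s * L) * (exp ((1 + \<beta>) * u) * H)"
        proof -
          have "exp u \<le> exp (s * L) * exp ((1 + \<beta>) * u)" using su by (simp add: mult_exp_exp algebra_simps)
          thus ?thesis using H0 by (simp add: mult_right_mono flip: mult.assoc)
        qed
        have "2 * (exp (1/2 * u) * sqrt H) * \<kappa> \<le> \<kappa>\<^sup>2 + (exp (1/2 * u) * sqrt H)\<^sup>2"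
          using sum_squares_bound[of \<kappa> "exp (1/2 * u) * sqrt H"] by (simp add: mult_ac)
        also have "(exp (1/2 * u) * sqrt H)\<^sup>2 = exp u * H"
          using H0 by (simp add: power_mult_distrib exp_double[symmetric])
        finally have "exp (1/2 * u) * sqrt H \<le> \<kappa> / 2 + (exp u * H) / (2 * \<kappa>)"
          using kap by (simp add: field_simps power2_eq_square)
        also have "\<dots> \<le> \<kappa> / 2 + exp (s * L) / (2 * \<kappa>) * (exp ((1 + \<beta>) * u) * H)"
          using divide_right_mono[OF e2, of "2 * \<kappa>"] kap by simp
        also have "\<dots> \<le> g u"
          using 2 C q0 unfolding g_def H_def[symmetric] by (simp add: indicator_def)
        finally show ?thesis .
      qed
    qed
    finally show ?thesis .
  qed
  have "norm (pi / sin (pi * z) * T) \<le> N * (sqrt q * (exp (1/2 * (-L)) / (1/2)) + (\<kappa> / 2 * (2 * L)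
      + exp (s * L) / (2 * \<kappa>) * (c0 * gap \<beta>)) + C * (exp (- r * L) / r))"
  proof -
    have "norm (LINT u|lborel. exp (z * of_real u) * \<Theta> (exp u)) \<le> (LINT u|lborel. norm (exp (z * of_real u) * \<Theta> (exp u)))"
      by (rule integral_norm_bound)
    also have "\<dots> \<le> (LINT u|lborel. N * g u)"
      using le gI hb by (intro integral_mono integrable_norm integrable_mult_right) (auto simp: has_bochner_integral_iff)
    finally show ?thesis using hb gI by (simp add: has_bochner_integral_iff)
  qed
  also have "\<dots> \<le> N * (2 * sqrt q * sqrt D + C / r * D powr r + sqrt (2 * L * c0 * D powr (1 - s)))"
  proof (rule mult_left_mono[OF _ N])
    have "sqrt D = exp (1/2 * (-L))"
      by (rule real_sqrt_unique) (auto simp: DL exp_double[symmetric])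
    moreover have "D powr r = exp (- r * L)" unfolding DL by (simp add: powr_def)
    moreover have "\<kappa> / 2 * (2 * L) + exp (s * L) / (2 * \<kappa>) * (c0 * gap \<beta>) \<le> sqrt (2 * L * c0 * D powr (1 - s))"
    proof -
      have k2: "\<kappa>\<^sup>2 = exp (s * L) * c0 * D / (2 * L)" unfolding \<kappa>_def using c0 D L by simp
      have "exp (s * L) / (2 * \<kappa>) * (c0 * gap \<beta>) \<le> exp (s * L) / (2 * \<kappa>) * (c0 * D)"
        using gapD kap c0 by (intro mult_left_mono) auto
      also have "\<dots> = (2 * L * \<kappa>\<^sup>2) / (2 * \<kappa>)" unfolding k2 using L by simp
      also have "\<dots> = L * \<kappa>" using kap by (simp add: power2_eq_square)
      finally have "\<kappa> / 2 * (2 * L) + exp (s * L) / (2 * \<kappa>) * (c0 * gap \<beta>) \<le> 2 * L * \<kappa>" by simp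
      also have "2 * L * \<kappa> = sqrt ((2 * L * \<kappa>)\<^sup>2)" using L kap by simp
      also have "(2 * L * \<kappa>)\<^sup>2 = 2 * L * c0 * (exp (s * L) * D)"
        unfolding power_mult_distrib k2 using L by (simp add: power2_eq_square)
      also have "exp (s * L) * D = D powr (1 - s)" unfolding DL by (simp add: powr_def mult_exp_exp algebra_simps)
      finally show ?thesis .
    qed
    ultimately show "sqrt q * (exp (1/2 * (-L)) / (1/2)) + (\<kappa> / 2 * (2 * L)
      + exp (s * L) / (2 * \<kappa>) * (c0 * gap \<beta>)) + C * (exp (- r * L) / r) \<le> 2 * sqrt q * sqrt D + C / r * D powr r + sqrt (2 * L * c0 * D powr (1 - s))"
      by simp
  qed
  finally have main: "pi / cosh (pi * t) * norm T \<le> N * (2 * sqrt q * sqrt D + C / r * D powr r + sqrt (2 * L * c0 * D powr (1 - s)))"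
    unfolding sz by (simp add: norm_mult norm_divide)
  have "norm T = cosh (pi * t) / pi * (pi / cosh (pi * t) * norm T)" by simp
  also have "\<dots> \<le> cosh (pi * t) / pi * (N * (2 * sqrt q * sqrt D + C / r * D powr r + sqrt (2 * L * c0 * D powr (1 - s))))"
    using main by (intro mult_left_mono) auto
  finally show ?thesis by (simp add: T_def L_def c0_def s_def mult.assoc)
qed

end

subsection \<open>Three lines and the Poisson formula on a strip\<close>

text \<open>The factor \<open>p\<close> normalises both boundary bounds to 1, exp(e z^2) forces
  decay along the strip, the maximum principle is applied on a rectangle, and finally e tends to
  0.\<close>

lemma three_lines_half_strip:
  fixes F :: "complex \<Rightarrow> complex" and A B M \<theta> :: real
  assumes hol: "F holomorphic_on UNIV" and A: "A > 0" and B: "B > 0"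
    and M: "\<And>z. 0 \<le> Re z \<Longrightarrow> Re z \<le> 1/2 \<Longrightarrow> norm (F z) \<le> M"
    and bA: "\<And>v. norm (F (\<i> * of_real v)) \<le> A"
    and bB: "\<And>v. norm (F (1/2 + \<i> * of_real v)) \<le> B"
    and \<theta>: "0 \<le> \<theta>" "\<theta> \<le> 1/2"
  shows "norm (F (of_real \<theta>)) \<le> A powr (1 - 2 * \<theta>) * B powr (2 * \<theta>)"
proof -
  define p where "p = (\<lambda>z::complex. exp (- (1 - 2 * z) * of_real (ln A) - 2 * z * of_real (ln B)))"
  have np: "norm (p z) = exp (- (1 - 2 * Re z) * ln A - 2 * Re z * ln B)" for z by (simp add: p_def)
  define C where "C = exp (\<bar>ln A\<bar> + \<bar>ln B\<bar>)"
  have pC: "norm (p z) \<le> C" if "0 \<le> Re z" "Re z \<le> 1/2" for z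
  proof -
    have "\<bar>(1 - 2 * Re z) * ln A\<bar> \<le> 1 * \<bar>ln A\<bar>" unfolding abs_mult using that by (intro mult_right_mono) auto
    moreover have "\<bar>2 * Re z * ln B\<bar> \<le> 1 * \<bar>ln B\<bar>" unfolding abs_mult using that by (intro mult_right_mono) auto
    ultimately have "- (1 - 2 * Re z) * ln A - 2 * Re z * ln B \<le> \<bar>ln A\<bar> + \<bar>ln B\<bar>" by (simp only: mult_minus_left)
    thus ?thesis by (simp add: np C_def)
  qed
  have M0: "M \<ge> 0" using order_trans[OF norm_ge_zero M[of 0]] by simp
  have key: "norm (F \<theta>) * norm (p \<theta>) * exp (e * \<theta>\<^sup>2) \<le> exp (e / 4)" if e: "e > 0" for e :: real
  proof -
    define G where "G = (\<lambda>z. F z * p z * exp (of_real e * z\<^sup>2))"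
    \<comment> \<open>So high that on the horizontal sides the damping exp(e (1/4 - R^2)) is at most
      1 / (M C + 1), which beats the bound M C of the undamped function.\<close>
    define R where "R = sqrt ((e / 4 + ln (M * C + 1)) / e) + 1"
    have lnn: "ln (M * C + 1) \<ge> 0" using M0 by (intro ln_ge_zero) (auto simp: C_def)
    have R0: "R \<ge> 1" using lnn e by (simp add: R_def)
    have R2: "e * R\<^sup>2 \<ge> e / 4 + ln (M * C + 1)"
    proof -
      have "(e / 4 + ln (M * C + 1)) / e = (sqrt ((e / 4 + ln (M * C + 1)) / e))\<^sup>2" using lnn e by simp
      also have "\<dots> \<le> R\<^sup>2" unfolding R_def using lnn e by (intro power_mono) auto
      finally show ?thesis using e by (simp add: field_simps)
    qed
    have nG: "norm (G z) = norm (F z) * norm (p z) * exp (e * ((Re z)\<^sup>2 - (Im z)\<^sup>2))" for z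
      by (simp add: G_def norm_mult power2_eq_square)
    have "norm (G \<theta>) \<le> exp (e / 4)"
    proof (rule maximum_modulus_frontier[where f = G and S = "cbox (Complex 0 (-R)) (Complex (1/2) R)"])
      have hG: "G holomorphic_on UNIV" unfolding G_def p_def by (intro holomorphic_intros hol)
      show "G holomorphic_on interior (cbox (Complex 0 (-R)) (Complex (1/2) R))"
        by (rule holomorphic_on_subset[OF hG]) auto
      show "continuous_on (closure (cbox (Complex 0 (-R)) (Complex (1/2) R))) G"
        by (rule continuous_on_subset[OF holomorphic_on_imp_continuous_on[OF hG]]) auto
      show "complex_of_real \<theta> \<in> cbox (Complex 0 (- R)) (Complex (1 / 2) R)"
        using \<theta> R0 by (simp add: in_cbox_complex_iff)
      fix z assume "z \<in> frontier (cbox (Complex 0 (- R)) (Complex (1 / 2) R))"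
      hence z: "z \<in> cbox (Complex 0 (- R)) (Complex (1 / 2) R)" "z \<notin> box (Complex 0 (- R)) (Complex (1 / 2) R)"
        by (auto simp: frontier_cbox)
      hence zr: "0 \<le> Re z" "Re z \<le> 1/2" by (auto simp: in_cbox_complex_iff)
      have x2: "(Re z)\<^sup>2 \<le> 1/4" using power_mono[OF zr(2,1), of 2] by (simp add: power_divide)
      consider "Re z = 0" | "Re z = 1/2" | "(Im z)\<^sup>2 = R\<^sup>2"
        using z by (auto simp: in_cbox_complex_iff in_box_complex_iff power2_eq_iff)
      thus "norm (G z) \<le> exp (e / 4)"
      proof cases
        case 1
        hence "z = \<i> * of_real (Im z)" by (simp add: complex_eq_iff)
        hence "norm (F z) \<le> A" using bA[of "Im z"] by simp
        hence "norm (F z) * norm (p z) \<le> A * (1 / A)" using 1 A by (intro mult_mono) (auto simp: np exp_minus inverse_eq_divide)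
        hence "norm (F z) * norm (p z) * exp (e * ((Re z)\<^sup>2 - (Im z)\<^sup>2)) \<le> 1 * exp (e / 4)"
          using 1 e A by (intro mult_mono) (auto simp: mult_nonneg_nonneg intro: order_trans[of _ 0])
        thus ?thesis by (simp add: nG)
      next
        case 2
        hence "z = 1/2 + \<i> * of_real (Im z)" by (simp add: complex_eq_iff)
        hence "norm (F z) \<le> B" using bB[of "Im z"] by simp
        hence "norm (F z) * norm (p z) \<le> B * (1 / B)" using B
          unfolding np 2 by (intro mult_mono) (auto simp: exp_minus inverse_eq_divide)
        moreover have "e * ((Re z)\<^sup>2 - (Im z)\<^sup>2) \<le> e * (1 / 4)" using x2 e
          by (intro mult_left_mono) (use zero_le_power2[of "Im z"] in linarith, simp)
        ultimately have "norm (F z) * norm (p z) * exp (e * ((Re z)\<^sup>2 - (Im z)\<^sup>2)) \<le> 1 * exp (e / 4)"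
          using B by (intro mult_mono) auto
        thus ?thesis by (simp add: nG)
      next
        case 3
        have "e * ((Re z)\<^sup>2 - (Im z)\<^sup>2) \<le> e * (1 / 4 - R\<^sup>2)" using x2 e 3 by (intro mult_left_mono) auto
        also have "\<dots> \<le> - ln (M * C + 1)" using R2 by (simp add: right_diff_distrib)
        finally have "exp (e * ((Re z)\<^sup>2 - (Im z)\<^sup>2)) \<le> exp (- ln (M * C + 1))" by simp
        also have "\<dots> = 1 / (M * C + 1)" using M0 by (simp add: exp_minus C_def inverse_eq_divide add_nonneg_pos)
        finally have "norm (G z) \<le> M * C * (1 / (M * C + 1))" unfolding nG
          using M[OF zr] pC[OF zr] M0 by (intro mult_mono) (auto simp: C_def)
        also have "\<dots> \<le> 1" using M0 by (simp add: C_def add_nonneg_pos)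
        also have "1 \<le> exp (e / 4)" using e by simp
        finally show ?thesis .
      qed
    qed (auto)
    thus ?thesis by (simp add: nG)
  qed
  have "norm (F \<theta>) * norm (p \<theta>) \<le> 1"
  proof (rule tendsto_le[of "at_right (0::real)"])
    show "((\<lambda>e. exp (e / 4)) \<longlongrightarrow> 1) (at_right (0::real))" by (auto intro!: tendsto_eq_intros)
    show "((\<lambda>e. norm (F \<theta>) * norm (p \<theta>) * exp (e * \<theta>\<^sup>2)) \<longlongrightarrow> norm (F \<theta>) * norm (p \<theta>)) (at_right 0)"
      by (auto intro!: tendsto_eq_intros)
    show "\<forall>\<^sub>F e in at_right 0. norm (F \<theta>) * norm (p \<theta>) * exp (e * \<theta>\<^sup>2) \<le> exp (e / 4)"
      using key eventually_at_right_less[of "0::real"] by (auto elim: eventually_mono)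
  qed auto
  moreover have "norm (p \<theta>) = 1 / (A powr (1 - 2 * \<theta>) * B powr (2 * \<theta>))"
  proof -
    have "norm (p \<theta>) = exp (- ((1 - 2 * \<theta>) * ln A + 2 * \<theta> * ln B))" by (simp add: np algebra_simps)
    also have "\<dots> = 1 / (A powr (1 - 2 * \<theta>) * B powr (2 * \<theta>))"
      unfolding exp_minus exp_add using A B by (simp add: powr_def inverse_eq_divide)
    finally show ?thesis .
  qed
  ultimately show ?thesis using A B by (simp add: field_simps)
qed

text \<open>Since 1 / cosh w = 2 exp w / (1 + exp(2 w)), the substitution u = 4 pi (v - t) leads
  back to the integral of exp(z u) / (1 + exp u), now on the line Re z = 1/2.\<close>

lemma fourier_sech:
  fixes c t :: real
  shows "has_bochner_integral lborel (\<lambda>v. exp (\<i> * of_real (c * v)) / of_real (cosh (2 * pi * (v - t))))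
           (exp (\<i> * of_real (c * t)) / (2 * of_real (cosh (c / 4))))"
proof -
  define s where "s = c / (4 * pi)"
  define z where "z = 1/2 + \<i> * complex_of_real s"
  have z: "0 < Re z" "Re z < 1" by (simp_all add: z_def)
  have sz: "sin (pi * z) = complex_of_real (cosh (c / 4))"
  proof -
    have "sin (pi * z) = sin (pi/2 + \<i> * complex_of_real (c / 4))"
      by (rule arg_cong[where f = sin]) (simp add: z_def s_def field_simps)
    also have "\<dots> = cos (\<i> * complex_of_real (c / 4))"
      by (simp add: sin_add sin_of_real[symmetric] cos_of_real[symmetric])
    also have "\<dots> = complex_of_real (cosh (c / 4))"
      unfolding cos_i_times exp_minus exp_of_real by (simp add: cosh_field_def exp_minus)
    finally show ?thesis .
  qed
  define f where "f = (\<lambda>u::real. exp (z * of_real u) / (1 + exp (of_real u)))"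
  have hb: "has_bochner_integral lborel f (complex_of_real (pi / cosh (c / 4)))"
    using integrable_exp_over_one_plus_exp[OF z] integral_exp_over_one_plus_exp[OF z] sz
    by (simp add: has_bochner_integral_iff f_def)
  have "has_bochner_integral lborel (\<lambda>v. f (- 4 * pi * t + 4 * pi * v)) ((complex_of_real (pi / cosh (c / 4))) /\<^sub>R \<bar>4 * pi\<bar>)"
    using hb by (subst lborel_has_bochner_integral_real_affine_iff[symmetric]) auto
  hence "has_bochner_integral lborel (\<lambda>v. (2 * exp (\<i> * of_real (c * t))) * f (- 4 * pi * t + 4 * pi * v))
     ((2 * exp (\<i> * of_real (c * t))) * ((complex_of_real (pi / cosh (c / 4))) /\<^sub>R \<bar>4 * pi\<bar>))"
    by (rule has_bochner_integral_mult_right)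
  moreover have "(2 * exp (\<i> * of_real (c * t))) * f (- 4 * pi * t + 4 * pi * v)
      = exp (\<i> * of_real (c * v)) / of_real (cosh (2 * pi * (v - t)))" for v
  proof -
    define w where "w = 2 * pi * (v - t)"
    have u: "- 4 * pi * t + 4 * pi * v = 2 * w" by (simp add: w_def algebra_simps)
    have c: "2 * s * w = c * (v - t)" by (simp add: s_def w_def field_simps)
    have "z * of_real (2 * w) = of_real w + \<i> * of_real (2 * s * w)" by (simp add: z_def algebra_simps)
    hence e1: "exp (z * of_real (2 * w)) = of_real (exp w) * exp (\<i> * of_real (c * (v - t)))"
      unfolding c by (simp add: exp_add exp_of_real)
    have e2: "exp (\<i> * of_real (c * t)) * exp (\<i> * of_real (c * (v - t))) = exp (\<i> * of_real (c * v))"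
      by (simp add: mult_exp_exp algebra_simps)
    have e3: "1 + exp (complex_of_real (2 * w)) = of_real (2 * exp w * cosh w)"
    proof -
      have "1 + exp (complex_of_real (2 * w)) = of_real (1 + exp (2 * w))" by (simp only: exp_of_real of_real_add of_real_1)
      also have "1 + exp (2 * w) = 2 * exp w * cosh w"
      proof -
        have "exp (2 * w) = exp w * exp w" "exp w * exp (- w) = 1" by (simp_all add: mult_exp_exp)
        thus ?thesis by (simp add: cosh_field_def distrib_left)
      qed
      finally show ?thesis .
    qed
    have "(2 * exp (\<i> * of_real (c * t))) * f (2 * w)
       = (exp (\<i> * of_real (c * t)) * exp (\<i> * of_real (c * (v - t)))) * (of_real (2 * exp w) / of_real (2 * exp w * cosh w))"
      unfolding f_def e1 e3 by simp
    also have "\<dots> = exp (\<i> * of_real (c * v)) / of_real (cosh w)" unfolding e2 by simp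
    finally show ?thesis unfolding u by (simp add: w_def)
  qed
  moreover have "(2 * exp (\<i> * of_real (c * t))) * ((complex_of_real (pi / cosh (c / 4))) /\<^sub>R \<bar>4 * pi\<bar>)
      = exp (\<i> * of_real (c * t)) / (2 * of_real (cosh (c / 4)))"
  proof -
    have "complex_of_real (pi / cosh (c / 4)) /\<^sub>R \<bar>4 * pi\<bar> = of_real (pi / cosh (c / 4) / \<bar>4 * pi\<bar>)"
      by (simp add: scaleR_conv_of_real)
    also have "pi / cosh (c / 4) / \<bar>4 * pi\<bar> = 1 / (4 * cosh (c / 4))" by simp
    finally show ?thesis by simp
  qed
  ultimately show ?thesis by (simp only:)
qed

text \<open>1 / cosh(2 pi v) is the Poisson kernel of the strip |Re w| <= 1/4 seen from its centre
  line. For an exponential the two boundary values add up to a factor 2 cosh(b/4), which cancels the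
  Fourier multiplier of the kernel.\<close>

lemma poisson_quarter_strip:
  fixes b t :: real
  shows "has_bochner_integral lborel
     (\<lambda>v. (exp (of_real b * (1/4 + \<i> * of_real v)) + exp (of_real b * (-1/4 + \<i> * of_real v))) / of_real (cosh (2 * pi * (v - t))))
     (exp (of_real b * (\<i> * of_real t)))"
proof -
  have "has_bochner_integral lborel
     (\<lambda>v. (2 * of_real (cosh (b / 4))) * (exp (\<i> * of_real (b * v)) / of_real (cosh (2 * pi * (v - t)))))
     ((2 * of_real (cosh (b / 4))) * (exp (\<i> * of_real (b * t)) / (2 * of_real (cosh (b / 4)))))"
    by (rule has_bochner_integral_mult_right) (rule fourier_sech)
  moreover have "exp (of_real b * (1/4 + \<i> * of_real v)) + exp (of_real b * (-1/4 + \<i> * of_real v))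
     = (2 * of_real (cosh (b / 4))) * exp (\<i> * of_real (b * v))" for v
  proof -
    have "exp (of_real b * (1/4 + \<i> * of_real v)) = exp (complex_of_real (b/4)) * exp (\<i> * of_real (b * v))"
      unfolding mult_exp_exp by (rule arg_cong[where f = exp]) (simp add: algebra_simps)
    moreover have "exp (of_real b * (-1/4 + \<i> * of_real v)) = exp (complex_of_real (-(b/4))) * exp (\<i> * of_real (b * v))"
      unfolding mult_exp_exp by (rule arg_cong[where f = exp]) (simp add: algebra_simps)
    ultimately show ?thesis
      by (simp only: exp_of_real) (simp add: cosh_field_def algebra_simps)
  qed
  moreover have "(2 * complex_of_real (cosh (b / 4))) * (exp (\<i> * of_real (b * t)) / (2 * of_real (cosh (b / 4)))) = exp (of_real b * (\<i> * of_real t))"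
    by (simp add: mult_ac)
  ultimately show ?thesis by simp
qed

lemma sech_integral:
  "has_bochner_integral lborel (\<lambda>v. 1 / cosh (2 * pi * (v - t))) (1/2)"
proof -
  have "has_bochner_integral lborel (\<lambda>v. Re (exp (\<i> * of_real (0 * v)) / of_real (cosh (2 * pi * (v - t)))))
           (Re (exp (\<i> * of_real (0 * t)) / (2 * of_real (cosh (0 / 4)))))"
    by (rule has_bochner_integral_Re[OF fourier_sech])
  thus ?thesis by simp
qed

text \<open>A Harnack inequality comparing the Poisson kernels of the points i t and 0; it is the
  origin of the weight exp(2 pi |t|).\<close>

lemma cosh_shift_le: "1 / cosh (2 * pi * (v - t)) \<le> exp (2 * pi * \<bar>t\<bar>) / cosh (2 * pi * v)"
proof -
  have "cosh (2 * pi * v) \<le> exp (2 * pi * \<bar>t\<bar>) * cosh (2 * pi * (v - t))"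
  proof -
    have "cosh (2 * pi * v) = cosh (2 * pi * (v - t) + 2 * pi * t)" by (simp add: algebra_simps)
    also have "\<dots> \<le> exp (2 * pi * \<bar>t\<bar>) * cosh (2 * pi * (v - t))"
    proof -
      define a where "a = 2 * pi * (v - t)"
      define d where "d = 2 * pi * t"
      have d: "\<bar>d\<bar> = 2 * pi * \<bar>t\<bar>" by (simp add: d_def abs_mult)
      have "exp (a + d) \<le> exp \<bar>d\<bar> * exp a" "exp (- (a + d)) \<le> exp \<bar>d\<bar> * exp (- a)"
        by (auto simp: mult_exp_exp)
      hence "cosh (a + d) \<le> exp \<bar>d\<bar> * cosh a"
        by (simp add: cosh_field_def ring_distribs add_divide_distrib)
      thus ?thesis unfolding d[symmetric] by (simp add: a_def d_def)
    qed
    finally show ?thesis .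
  qed
  thus ?thesis by (simp add: field_simps)
qed

text \<open>The measure of the averaged map is a probability measure; -1 / (exp(pi t) + 1) is an
  antiderivative of its density.\<close>

lemma has_bochner_integral_sech_sq:
  "has_bochner_integral lborel (\<lambda>t. pi / 2 / (cosh (pi * t) + 1)) 1"
proof -
  define f where "f = (\<lambda>t::real. pi / 2 / (cosh (pi * t) + 1))"
  have pos: "cosh (pi * t) + 1 > 0" for t by (intro add_pos_pos cosh_real_pos) simp
  have f0: "f t \<ge> 0" for t using pos[of t] by (simp add: f_def less_imp_le)
  have fb: "f \<in> borel_measurable borel" unfolding f_def cosh_field_def by measurable
  have half: "has_bochner_integral lborel (\<lambda>t. indicator {0..} t * f t) (1/2)"
  proof (rule has_bochner_integral_nn_integral)
    have "(\<integral>\<^sup>+ t. ennreal (f t) * indicator {0..} t \<partial>lborel) = ennreal (1/2 - (- 1 / (exp (pi * 0) + 1) + 1/2))"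
    proof (rule nn_integral_FTC_atLeast[OF fb])
      have "filterlim (\<lambda>t. pi * t) at_top at_top"
        by (intro filterlim_tendsto_pos_mult_at_top[OF tendsto_const _ filterlim_ident]) auto
      hence "filterlim (\<lambda>t. exp (pi * t)) at_top at_top"
        by (rule filterlim_compose[OF exp_at_top])
      hence "filterlim (\<lambda>t. exp (pi * t) + 1) at_top at_top"
        by (rule filterlim_at_top_mono) simp
      hence "((\<lambda>t. - 1 / (exp (pi * t) + 1)) \<longlongrightarrow> 0) at_top"
        by (intro tendsto_divide_0[OF tendsto_const] filterlim_at_top_imp_at_infinity)
      thus "((\<lambda>t. - 1 / (exp (pi * t) + 1) + 1/2) \<longlongrightarrow> 1/2) at_top"
        using tendsto_add[OF _ tendsto_const[of "1/2::real" at_top]] by fastforce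
      fix t :: real
      show "DERIV (\<lambda>t. - 1 / (exp (pi * t) + 1) + 1/2) t :> f t"
      proof -
        have e: "exp (pi * t) + 1 \<noteq> 0" by (metis add_pos_pos exp_gt_zero less_irrefl zero_less_one)
        have "DERIV (\<lambda>t. - 1 / (exp (pi * t) + 1) + 1/2) t :> pi * exp (pi * t) / (exp (pi * t) + 1)\<^sup>2"
          using e by (auto intro!: derivative_eq_intros simp: power2_eq_square)
        moreover have "cosh (pi * t) + 1 = (exp (pi * t) + 1)\<^sup>2 / (2 * exp (pi * t))"
        proof -
          define d where "d = exp (pi * t)"
          have "d > 0" by (simp add: d_def)
          moreover have "cosh (pi * t) = (d + inverse d) / 2" by (simp add: d_def cosh_field_def exp_minus)
          ultimately show ?thesis unfolding d_def[symmetric] by (simp add: field_simps power2_eq_square)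
        qed
        ultimately have "f t = pi * exp (pi * t) / (exp (pi * t) + 1)\<^sup>2" by (simp only: f_def) simp
        thus ?thesis using \<open>DERIV _ t :> _\<close> by simp
      qed
    qed (use f0 in auto)
    thus "(\<integral>\<^sup>+ t. ennreal (indicator {0..} t * f t) \<partial>lborel) = ennreal (1/2)"
      by (subst (asm) nn_integral_cong[where v = "\<lambda>t. ennreal (indicator {0..} t * f t)"]) (auto simp: indicator_def)
  qed (use f0 fb in auto)
  have refl: "has_bochner_integral lborel (\<lambda>t. indicator {0..} (0 + (-1) * t) * f (0 + (-1) * t)) ((1/2) /\<^sub>R \<bar>-1\<bar>)"
    using half by (subst lborel_has_bochner_integral_real_affine_iff[symmetric]) auto
  have half': "has_bochner_integral lborel (\<lambda>t. indicator {..0} t * f t) (1/2)"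
  proof -
    have "indicator {0..} (- t) = (indicator {..0} t :: real)" for t :: real by (auto simp: indicator_def)
    moreover have "f (- t) = f t" for t by (simp add: f_def)
    ultimately show ?thesis using refl by simp
  qed
  have "has_bochner_integral lborel (\<lambda>t. indicator {0..} t * f t + indicator {..0} t * f t) (1/2 + 1/2)"
    by (rule has_bochner_integral_add[OF half half'])
  moreover have "AE t in lborel. indicator {0..} t * f t + indicator {..0} t * f t = f t"
    using AE_lborel_singleton[of 0] by eventually_elim (auto simp: indicator_def)
  ultimately show ?thesis
    unfolding f_def[symmetric] using fb by (subst has_bochner_integral_cong_AE[symmetric]) auto
qed

subsection \<open>Numerical estimates\<close>

text \<open>From y <= exp(y - 1) at y = 2 \<epsilon> ln(1/D). The factors e and \<epsilon> in the
  constant K originate here.\<close>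

lemma log_le_powr_over_exp:
  fixes D \<epsilon> :: real
  assumes "0 < D" "D < 1" "\<epsilon> > 0"
  shows "2 * ln (1 / D) \<le> D powr (- 2 * \<epsilon>) / (exp 1 * \<epsilon>)"
proof -
  define y where "y = 2 * \<epsilon> * ln (1 / D)"
  have "1 + (y - 1) \<le> exp (y - 1)" by (rule exp_ge_add_one_self)
  hence "y \<le> exp y / exp 1" by (simp add: exp_diff)
  moreover have "exp y = D powr (- 2 * \<epsilon>)" using assms by (simp add: y_def powr_def ln_div)
  ultimately show ?thesis using assms by (simp add: y_def field_simps)
qed

text \<open>The first alternative of \<open>rC\<close> arises for \<alpha> < 1, the second for 1 <
  \<alpha> <= 2. In the second, s <= 1/2 gives r >= 1/4 and C <= q^(1/4), so C / r <= 4 q^(1/4) <= 2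
  sqrt q + 2.\<close>

lemma resolvent_bound_numeric:
  fixes q D s \<epsilon> r C :: real
  assumes q: "q \<ge> 1" and D: "0 < D" "D < 1" and s: "0 < s" "s < 1"
    and eps: "0 < \<epsilon>" "\<epsilon> < (1 - s) / 2"
    and rC: "(r = 1/2 \<and> C = 1) \<or> (s \<le> 1/2 \<and> r = (1 - s) / 2 \<and> 0 \<le> C \<and> C\<^sup>2 \<le> q powr s)"
  shows "2 * sqrt q * sqrt D + C / r * D powr r + sqrt (2 * ln (1 / D) * (pi / sin (pi * s)) * D powr (1 - s))
     \<le> (4 * sqrt q + sqrt (pi / (exp 1 * \<epsilon> * sin (pi * s))) + 4) * D powr ((1 - s) / 2 - \<epsilon>)"
proof -
  define a where "a = (1 - s) / 2 - \<epsilon>"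
  have sn: "sin (pi * s) > 0" using s by (intro sin_gt_zero) auto
  have sD: "sqrt D = D powr (1/2)" using D by (simp add: powr_half_sqrt)
  have D1: "sqrt D \<le> D powr a" unfolding sD a_def using D s eps by (intro powr_mono') (auto simp: field_simps)
  have part1: "2 * sqrt q * sqrt D + C / r * D powr r \<le> (4 * sqrt q + 4) * D powr a"
    using rC
  proof
    assume "r = 1/2 \<and> C = 1"
    hence r: "r = 1/2" and C: "C = 1" by simp_all
    have "2 * sqrt q * sqrt D + C / r * D powr r = (2 * sqrt q + 2) * sqrt D"
      unfolding sD r C by (simp add: algebra_simps)
    also have "\<dots> \<le> (4 * sqrt q + 4) * D powr a" using D1 q D by (intro mult_mono) auto
    finally show ?thesis .
  next
    assume rC: "s \<le> 1/2 \<and> r = (1 - s) / 2 \<and> 0 \<le> C \<and> C\<^sup>2 \<le> q powr s"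
    define k where "k = sqrt (sqrt q)"
    have k: "k \<ge> 1" "k\<^sup>2 = sqrt q" using q by (auto simp: k_def)
    have "C\<^sup>2 \<le> q powr (1/2)" using rC q powr_mono[of s "1/2" q] by linarith
    also have "\<dots> = k\<^sup>2" using q k(2) by (simp add: powr_half_sqrt)
    finally have Ck: "C \<le> k" by (rule power2_le_imp_le) (use k in simp)
    have r4: "1/4 \<le> r" using rC by simp
    have "C / r \<le> k / (1/4)" using rC r4 Ck k by (intro frac_le) auto
    moreover have Dr: "D powr r \<le> D powr a" unfolding a_def using D eps rC by (intro powr_mono') linarith+
    ultimately have "C / r * D powr r \<le> 4 * k * D powr a" using k by (intro mult_mono) auto
    moreover have "2 * sqrt q * sqrt D \<le> 2 * sqrt q * D powr a" using D1 q by (intro mult_left_mono) auto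
    moreover have "2 * sqrt q + 4 * k \<le> 4 * sqrt q + 4"
    proof -
      have "2 * k * 1 \<le> k\<^sup>2 + 1\<^sup>2" by (rule sum_squares_bound)
      thus ?thesis using k(2) by simp
    qed
    hence "(2 * sqrt q + 4 * k) * D powr a \<le> (4 * sqrt q + 4) * D powr a" by (intro mult_right_mono) auto
    ultimately show ?thesis by (simp add: algebra_simps)
  qed
  have part2: "sqrt (2 * ln (1 / D) * (pi / sin (pi * s)) * D powr (1 - s)) \<le> sqrt (pi / (exp 1 * \<epsilon> * sin (pi * s))) * D powr a"
  proof -
    have "2 * ln (1 / D) * (pi / sin (pi * s)) * D powr (1 - s) \<le> D powr (- 2 * \<epsilon>) / (exp 1 * \<epsilon>) * (pi / sin (pi * s)) * D powr (1 - s)"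
      using log_le_powr_over_exp[OF D eps(1)] sn by (intro mult_right_mono) auto
    also have "\<dots> = pi / (exp 1 * \<epsilon> * sin (pi * s)) * (D powr (- 2 * \<epsilon>) * D powr (1 - s))" by simp
    also have "D powr (- 2 * \<epsilon>) * D powr (1 - s) = (D powr a)\<^sup>2"
    proof -
      have "- 2 * \<epsilon> + (1 - s) = a + a" by (simp add: a_def)
      thus ?thesis by (simp only: power2_eq_square powr_add[symmetric])
    qed
    finally have "sqrt (2 * ln (1 / D) * (pi / sin (pi * s)) * D powr (1 - s)) \<le> sqrt (pi / (exp 1 * \<epsilon> * sin (pi * s)) * (D powr a)\<^sup>2)"
      by (rule real_sqrt_le_mono)
    also have "\<dots> = sqrt (pi / (exp 1 * \<epsilon> * sin (pi * s))) * D powr a"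
      by (subst real_sqrt_mult) simp
    finally show ?thesis .
  qed
  show ?thesis using part1 part2 by (simp add: a_def algebra_simps)
qed

text \<open>The maximum of \<alpha>^(1/\<alpha>) is exp(1/e); the rational estimates 1/e <= 3/8 and
  exp(3/8) <= 8/5 suffice.\<close>

lemma powr_inverse_self_le:
  assumes "\<alpha> \<ge> (1::real)"
  shows "\<alpha> powr (1 / \<alpha>) \<le> 8 / 5"
proof -
  have "1 + (ln \<alpha> - 1) \<le> exp (ln \<alpha> - 1)" by (rule exp_ge_add_one_self)
  hence "ln \<alpha> \<le> \<alpha> / exp 1" using assms by (simp add: exp_diff)
  hence "ln \<alpha> / \<alpha> \<le> exp (-1)" using assms by (simp add: field_simps exp_minus)
  also have "exp (-1::real) \<le> 3/8"
  proof -
    have "8/3 \<le> exp (1::real)" using e_approx_32 by (simp add: abs_if split: if_splits)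
    thus ?thesis by (simp add: exp_minus field_simps)
  qed
  finally have "\<alpha> powr (1 / \<alpha>) \<le> exp (3/8)" using assms by (simp add: powr_def)
  also have "exp (3/8::real) \<le> 8/5"
  proof -
    have "5/8 \<le> exp (-(3/8)::real)" using exp_ge_add_one_self[of "-(3/8)::real"] by simp
    thus ?thesis by (simp add: exp_minus field_simps)
  qed
  finally show ?thesis .
qed

text \<open>By contradiction: the \<alpha>-th root of \<open>main\<close> gives y <= 8/5 q D^(2 a),
  because 1/\<alpha> >= 2 a and D < 1. If D^a < pi y / B, this is less than (8/5 pi^2 q / B^2) y^2,
  and 8/5 pi^2 < 16 with B >= 4 sqrt q leaves y < y^2 <= y.\<close>

lemma interpolation_bound_numeric:
  fixes q D \<alpha> a y B :: real
  assumes q: "q \<ge> 1" and D: "D \<ge> 0" and \<alpha>: "\<alpha> \<ge> 2" and a: "0 < a" "a \<le> 1 / (2 * \<alpha>)"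
    and y: "0 \<le> y" "y \<le> 1" and B: "B \<ge> 4 * sqrt q"
    and main: "y powr \<alpha> \<le> \<alpha> * q powr (\<alpha> - 1) * D"
  shows "pi * y / B \<le> D powr a"
proof (rule ccontr)
  assume "\<not> pi * y / B \<le> D powr a"
  hence c: "D powr a < pi * y / B" by simp
  have pi4: "pi < 4" by (rule pi_less_4)
  have B4: "B \<ge> 4" using B q by (smt (verit) real_sqrt_ge_1_iff)
  have y0: "y > 0" using c B4 y by (cases "y = 0") auto
  have Dp: "D > 0"
  proof (rule ccontr)
    assume "\<not> D > 0" hence "y powr \<alpha> \<le> 0" using main D by simp
    thus False using y0 by simp
  qed
  have "pi * y / B \<le> 1"
  proof -
    have "pi * y \<le> 4 * 1" using pi4 y by (intro mult_mono) auto
    thus ?thesis using B4 by simp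
  qed
  hence "D powr a < 1" using c by linarith
  hence D1: "D < 1" using a by (metis Dp ge_one_powr_ge_zero less_eq_real_def not_less)
  have "y = (y powr \<alpha>) powr (1 / \<alpha>)" using y0 \<alpha> by (simp add: powr_powr)
  also have "\<dots> \<le> (\<alpha> * q powr (\<alpha> - 1) * D) powr (1 / \<alpha>)" using main \<alpha> by (intro powr_mono2) auto
  also have "\<dots> = \<alpha> powr (1 / \<alpha>) * q powr ((\<alpha> - 1) / \<alpha>) * D powr (1 / \<alpha>)"
    using \<alpha> q Dp by (simp add: powr_mult powr_powr)
  also have "\<dots> \<le> 8/5 * q powr 1 * D powr (2 * a)"
  proof (intro mult_mono)
    show "\<alpha> powr (1 / \<alpha>) \<le> 8/5" using \<alpha> by (intro powr_inverse_self_le) auto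
    show "q powr ((\<alpha> - 1) / \<alpha>) \<le> q powr 1" using \<alpha> q by (intro powr_mono) auto
    show "D powr (1 / \<alpha>) \<le> D powr (2 * a)" using a \<alpha> Dp D1 by (intro powr_mono') (auto simp: field_simps)
  qed auto
  also have "D powr (2 * a) = D powr a * D powr a" by (simp add: powr_add[symmetric])
  also have "8/5 * q powr 1 * (D powr a * D powr a) < 8/5 * q powr 1 * ((pi * y / B) * (pi * y / B))"
    using c q Dp by (intro mult_strict_left_mono mult_strict_mono') auto
  also have "\<dots> = y * (8/5 * pi\<^sup>2 * q / B\<^sup>2) * y" using q by (simp add: power2_eq_square)
  also have "\<dots> \<le> y * 1 * 1"
  proof (intro mult_mono)
    have "pi\<^sup>2 \<le> 3.15\<^sup>2" using pi_approx by (intro power_mono) auto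
    hence "8/5 * pi\<^sup>2 * q \<le> 16 * q" using q by (simp add: power2_eq_square)
    also have "\<dots> = (4 * sqrt q)\<^sup>2" using q by (simp add: power_mult_distrib)
    also have "\<dots> \<le> B\<^sup>2" using B q by (intro power_mono) auto
    finally show "8/5 * pi\<^sup>2 * q / B\<^sup>2 \<le> 1" using B4 by simp
  qed (use y q in auto)
  finally show False by simp
qed

type_synonym 'n cmat = "complex^'n^'n"

subsection \<open>Complex matrices\<close>

lemma bounded_bilinear_matrix_mult: "bounded_bilinear ((**) :: 'n::finite cmat \<Rightarrow> 'n cmat \<Rightarrow> 'n cmat)"
proof -
  have "bilinear ((**) :: 'n::finite cmat \<Rightarrow> 'n cmat \<Rightarrow> 'n cmat)"
    unfolding bilinear_def
    by (auto intro!: linearI simp: matrix_add_ldistrib matrix_matrix_mult_def vec_eq_iff distrib_right distrib_left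
        sum.distrib scaleR_sum_right)
  thus ?thesis by (simp add: bilinear_conv_bounded_bilinear)
qed

interpretation mm: bounded_bilinear "(**) :: 'n::finite cmat \<Rightarrow> 'n cmat \<Rightarrow> 'n cmat"
  by (rule bounded_bilinear_matrix_mult)

lemmas mmult_assoc = matrix_mul_assoc[symmetric]
lemmas mm_distribs = mm.add_left mm.add_right mm.diff_left mm.diff_right mm.minus_left mm.minus_right

lemma cscale_simps [simp]:
  fixes A B :: "'n::finite cmat"
  shows "cscale c A ** B = cscale c (A ** B)" "A ** cscale c B = cscale c (A ** B)"
    "cscale c (cscale d A) = cscale (c * d) A" "cscale 1 A = A" "cscale 0 A = 0" "cscale c 0 = 0"
  by (auto simp: cscale_def matrix_matrix_mult_def vec_eq_iff sum_distrib_left mult_ac)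

lemma cscale_add: "cscale c (A + B) = cscale c A + cscale c B"
  and cscale_add_left: "cscale (c + d) A = cscale c A + cscale d A"
  and cscale_diff: "cscale c (A - B) = cscale c A - cscale c B"
  and cscale_diff_left: "cscale (c - d) A = cscale c A - cscale d A"
  and cscale_minus: "cscale (- c) A = - cscale c A"
  by (auto simp: cscale_def vec_eq_iff algebra_simps)

lemma scaleR_cscale: "r *\<^sub>R A = cscale (of_real r) A"
  unfolding cscale_def vec_eq_iff by (simp, simp add: scaleR_conv_of_real)

lemma cscale_sum: "cscale c (sum f I) = (\<Sum>i\<in>I. cscale c (f i))"
  by (induction I rule: infinite_finite_induct) (auto simp: cscale_add)

lemma cscale_vec: "cscale c A *v x = c *s (A *v x)"
  by (auto simp: cscale_def matrix_vector_mult_def vec_eq_iff sum_distrib_left mult_ac)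

lemma linear_cscale: "bounded_linear (\<lambda>c. cscale c (A::'n::finite cmat))"
proof -
  have "linear (\<lambda>c. cscale c (A::'n cmat))"
    by (rule linearI) (auto simp: cscale_add_left scaleR_cscale, auto simp: scaleR_conv_of_real)
  thus ?thesis by (simp add: linear_conv_bounded_linear)
qed

lemma madj_simps [simp]:
  fixes A B :: "'n::finite cmat"
  shows "madj (A ** B) = madj B ** madj A" "madj (madj A) = A" "madj (mat 1 :: 'n cmat) = mat 1"
    "madj (cscale c A) = cscale (cnj c) (madj A)" "madj 0 = (0 :: 'n cmat)"
    "madj (A + B) = madj A + madj B" "madj (A - B) = madj A - madj B" "madj (- A) = - madj A"
  by (auto simp: madj_def cscale_def mat_def matrix_matrix_mult_def vec_eq_iff mult_ac)

lemma madj_sum: "madj (sum f I) = (\<Sum>i\<in>I. madj (f i))"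
  by (induction I rule: infinite_finite_induct) auto

lemma bounded_linear_madj: "bounded_linear (madj :: 'n::finite cmat \<Rightarrow> _)"
proof -
  have "linear (madj :: 'n::finite cmat \<Rightarrow> _)"
    by (rule linearI) (auto simp: scaleR_cscale)
  thus ?thesis by (simp add: linear_conv_bounded_linear)
qed

lemma mat_1_neq_0 [simp]: "(mat 1 :: 'n::finite cmat) \<noteq> 0" "0 \<noteq> (mat 1 :: 'n::finite cmat)"
  by (auto simp: mat_def vec_eq_iff)

definition cip :: "complex^'n \<Rightarrow> complex^'n \<Rightarrow> complex" where
  "cip u v = (\<Sum>i\<in>UNIV. cnj (u $ i) * v $ i)"

lemma cip_madj: "cip (A *v u) v = cip u (madj A *v v)"
proof -
  have "cip (A *v u) v = (\<Sum>i\<in>UNIV. \<Sum>j\<in>UNIV. cnj (A $ i $ j) * cnj (u $ j) * v $ i)"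
    by (simp add: cip_def matrix_vector_mult_def sum_distrib_right)
  also have "\<dots> = (\<Sum>j\<in>UNIV. \<Sum>i\<in>UNIV. cnj (A $ i $ j) * cnj (u $ j) * v $ i)"
    by (rule sum.swap)
  also have "\<dots> = cip u (madj A *v v)"
    by (simp add: cip_def matrix_vector_mult_def madj_def sum_distrib_left mult_ac)
  finally show ?thesis .
qed

lemma cip_self: "cip v v = of_real ((norm v)\<^sup>2)"
proof -
  have "(norm v)\<^sup>2 = (\<Sum>i\<in>UNIV. (cmod (v $ i))\<^sup>2)"
    by (simp add: norm_vec_def L2_set_def sum_nonneg)
  hence "complex_of_real ((norm v)\<^sup>2) = (\<Sum>i\<in>UNIV. of_real ((cmod (v $ i))\<^sup>2))"
    by (simp only: of_real_sum)
  thus ?thesis by (simp only: cip_def complex_norm_square mult.commute)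
qed

lemma psd_iff: "psd A \<longleftrightarrow> hermitian A \<and> (\<forall>v. 0 \<le> Re (cip v (A *v v)))"
  by (simp add: psd_def cip_def)

lemma cip_scale: "cip u (c *s v) = c * cip u v"
  by (simp add: cip_def sum_distrib_left mult_ac)

lemma madj_mult_self_eq_0:
  fixes Y :: "'n::finite cmat"
  assumes "madj Y ** Y = 0" shows "Y = 0"
proof -
  have "Y *v v = 0" for v
  proof -
    have "cip (Y *v v) (Y *v v) = cip v ((madj Y ** Y) *v v)"
      by (simp add: cip_madj matrix_vector_mul_assoc)
    thus ?thesis using assms by (simp add: cip_self) (simp add: cip_def)
  qed
  thus ?thesis by (simp add: matrix_eq)
qed

lemma psd_madj_mult: "psd (madj B ** B)"
proof -
  have "cip v ((madj B ** B) *v v) = of_real ((norm (B *v v))\<^sup>2)" for v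
    by (metis cip_madj cip_self matrix_vector_mul_assoc madj_simps(2))
  thus ?thesis by (simp add: psd_iff hermitian_def)
qed

subsection \<open>Spectral resolutions\<close>

text \<open>p(A) by Horner's scheme. Spectral projections will be polynomials in A, which places
  them in every subalgebra that contains A.\<close>

definition peval :: "complex poly \<Rightarrow> 'n::finite cmat \<Rightarrow> 'n cmat" where
  "peval p A = fold_coeffs (\<lambda>a B. cscale a (mat 1) + A ** B) p 0"

lemma peval_0 [simp]: "peval 0 A = 0" by (simp add: peval_def)

lemma peval_pCons [simp]: "peval (pCons a p) A = cscale a (mat 1) + A ** peval p A"
  by (cases "p = 0 \<and> a = 0") (auto simp: peval_def)

lemma peval_add: "peval (p + q) A = peval p A + peval q A"
  by (induction p q rule: poly_induct2) (auto simp: cscale_add_left mm_distribs)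

lemma peval_smult: "peval (smult c p) A = cscale c (peval p A)"
  by (induction p) (auto simp: cscale_add)

lemma peval_diff: "peval (p - q) A = peval p A - peval q A"
proof -
  have "peval (p + smult (-1) q) A = peval p A + cscale (-1) (peval q A)"
    by (simp only: peval_add peval_smult)
  thus ?thesis by (simp add: cscale_minus)
qed

lemma peval_mult: "peval (p * q) A = peval p A ** peval q A"
  by (induction p) (auto simp: peval_add peval_smult mm_distribs mmult_assoc)

lemma peval_1 [simp]: "peval 1 A = mat 1" by (simp add: one_pCons)

lemma peval_sum: "peval (sum f I) A = (\<Sum>i\<in>I. peval (f i) A)"
  by (induction I rule: infinite_finite_induct) (auto simp: peval_add)

lemma star_subalgD:
  assumes "star_subalg M"
  shows "mat 1 \<in> M" "x \<in> M \<Longrightarrow> y \<in> M \<Longrightarrow> x + y \<in> M" "x \<in> M \<Longrightarrow> y \<in> M \<Longrightarrow> x ** y \<in> M"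
    "x \<in> M \<Longrightarrow> cscale c x \<in> M" "x \<in> M \<Longrightarrow> madj x \<in> M"
  using assms by (auto simp: star_subalg_def)

lemma star_subalg_zero: "star_subalg M \<Longrightarrow> 0 \<in> M"
  using star_subalgD(1,4)[of M] by (metis cscale_simps(5))

lemma peval_mem: "star_subalg M \<Longrightarrow> A \<in> M \<Longrightarrow> peval p A \<in> M"
  by (induction p) (auto intro!: star_subalgD star_subalg_zero)

lemma peval_eigen:
  assumes "A ** P = cscale c P"
  shows "peval p A ** P = cscale (poly p c) P"
  by (induction p) (auto simp: mm_distribs mmult_assoc assms cscale_add_left mult.commute)

text \<open>With c complex, N = A - c is only normal. From N N X = 0 and normality the product of
  \<open>madj N ** N ** X\<close> with its adjoint vanishes, so N^* N X = 0 and then N X =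
  0.\<close>

lemma normal_kernel_square:
  fixes A X :: "'n::finite cmat"
  assumes A: "madj A = A" and z: "peval [:-c, 1:] A ** (peval [:-c, 1:] A ** X) = 0"
  shows "peval [:-c, 1:] A ** X = 0"
proof -
  define N where "N = peval [:-c, 1:] A"
  have N: "N = A - cscale c (mat 1)" by (simp add: N_def cscale_minus)
  have comm: "madj N ** N = N ** madj N" by (simp add: N A mm_distribs cscale_diff mult.commute)
  have "madj (madj N ** N ** X) ** (madj N ** N ** X) = madj X ** madj N ** (N ** madj N) ** N ** X"
    by (simp add: mmult_assoc)
  also have "\<dots> = madj X ** madj N ** madj N ** (N ** (N ** X))"
    unfolding comm[symmetric] by (simp add: mmult_assoc)
  also have "\<dots> = 0" using z by (simp add: N_def)
  finally have "madj N ** N ** X = 0" by (rule madj_mult_self_eq_0)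
  hence "madj (N ** X) ** (N ** X) = 0" by (simp add: mmult_assoc)
  thus ?thesis unfolding N_def by (rule madj_mult_self_eq_0)
qed

text \<open>The powers of A lie in a finite-dimensional space. Coinciding powers are a separate
  case, since linear dependence is a property of the set of powers.\<close>

lemma annihilating_poly_exists:
  fixes A :: "'n::finite cmat"
  shows "\<exists>p. p \<noteq> 0 \<and> peval p A = 0"
proof -
  define f where "f = (\<lambda>k::nat. peval (monom 1 k) A)"
  show ?thesis
  proof (cases "inj f")
    case False
    then obtain i j where ij: "i \<noteq> j" "f i = f j" by (auto simp: inj_def)
    hence "peval (monom 1 i - monom 1 j) A = 0" by (simp add: peval_diff f_def)
    moreover have "monom 1 i - monom 1 j \<noteq> (0::complex poly)"
      using ij by (metis coeff_monom eq_iff_diff_eq_0 zero_neq_one)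
    ultimately show ?thesis by blast
  next
    case True
    have "infinite (range f)" using True by (simp add: finite_image_iff)
    hence "dependent (range f)" using independent_bound by blast
    then obtain T u where T: "finite T" "T \<subseteq> range f" "(\<Sum>v\<in>T. u v *\<^sub>R v) = 0" and ex: "\<exists>v\<in>T. u v \<noteq> 0"
      unfolding dependent_explicit by blast
    define K where "K = f -` T"
    have finK: "finite K" unfolding K_def using True T(1) by (simp add: finite_vimageI)
    have fK: "f ` K = T" using T(2) by (auto simp: K_def)
    define p :: "complex poly" where "p = (\<Sum>k\<in>K. smult (of_real (u (f k))) (monom 1 k))"
    have "peval p A = (\<Sum>k\<in>K. u (f k) *\<^sub>R f k)"
      by (simp add: p_def peval_sum peval_smult f_def scaleR_cscale)
    also have "\<dots> = (\<Sum>v\<in>T. u v *\<^sub>R v)"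
      unfolding fK[symmetric] using inj_on_subset[OF True] by (subst sum.reindex) auto
    finally have "peval p A = 0" using T(3) by simp
    moreover obtain k where k: "k \<in> K" "u (f k) \<noteq> 0" using ex fK by blast
    have "coeff p k = (\<Sum>i\<in>K. if i = k then of_real (u (f i)) else 0)"
      by (simp add: p_def coeff_sum) (rule sum.cong, auto)
    hence "coeff p k = of_real (u (f k))" using k finK by simp
    hence "p \<noteq> 0" using k by auto
    ultimately show ?thesis by blast
  qed
qed

text \<open>Induction on the degree, removing one root at a time. The right factor \<open>B\<close>
  is arbitrary so that it can absorb the linear factor; a repeated root is reduced to a simple one
  by \<open>normal_kernel_square\<close>.\<close>

lemma squarefree_annihilates:
  fixes A B :: "'n::finite cmat"
  assumes A: "madj A = A" and "p \<noteq> 0" "peval p A ** B = 0"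
  shows "peval (\<Prod>c\<in>{c. poly p c = 0}. [:-c, 1:]) A ** B = 0"
  using assms(2,3)
proof (induction "degree p" arbitrary: p B rule: less_induct)
  case less
  show ?case
  proof (cases "degree p = 0")
    case True
    then obtain a where a: "p = [:a:]" "a \<noteq> 0" using less.prems(1) by (metis degree_eq_zeroE pCons_eq_0_iff)
    hence "cscale a B = 0" using less.prems(2) by simp
    hence "cscale (1 / a) (cscale a B) = 0" by simp
    hence "B = 0" using a by simp
    thus ?thesis by simp
  next
    case False
    then obtain c where c: "poly p c = 0"
      using fundamental_theorem_of_algebra constant_degree by metis
    then obtain r where r: "p = [:-c, 1:] * r" by (metis dvdE poly_eq_0_iff_dvd)
    have r0: "r \<noteq> 0" using less.prems(1) r by auto
    have dr: "degree r < degree p" unfolding r using r0 by (subst degree_mult_eq) auto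
    have comm: "peval x A ** peval y A = peval y A ** peval x A" for x y
      by (metis mult.commute peval_mult)
    have "peval r A ** (peval [:-c, 1:] A ** B) = 0"
      using less.prems(2) unfolding r by (metis comm matrix_mul_assoc peval_mult)
    from less.hyps[OF dr r0 this]
    have z: "peval (\<Prod>d\<in>{d. poly r d = 0}. [:-d, 1:]) A ** (peval [:-c, 1:] A ** B) = 0" .
    have fin: "finite {d. poly r d = 0}" by (rule poly_roots_finite[OF r0])
    show ?thesis
    proof (cases "poly r c = 0")
      case False
      have "{d. poly p d = 0} = insert c {d. poly r d = 0}" unfolding r by auto
      hence "(\<Prod>d\<in>{d. poly p d = 0}. [:-d, 1:]) = [:-c, 1:] * (\<Prod>d\<in>{d. poly r d = 0}. [:-d, 1:])"
        using fin False by simp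
      thus ?thesis using z by (simp only: peval_mult) (metis comm matrix_mul_assoc)
    next
      case True
      define X where "X = (\<Prod>d\<in>{d. poly r d = 0} - {c}. [:-d, 1:])"
      have "(\<Prod>d\<in>{d. poly r d = 0}. [:-d, 1:]) = [:-c, 1:] * X"
        unfolding X_def using fin True by (subst prod.remove[of _ c]) auto
      moreover have "{d. poly p d = 0} = {d. poly r d = 0}" unfolding r using True by auto
      moreover have "peval [:-c, 1:] A ** (peval X A ** B) = 0"
      proof (rule normal_kernel_square[OF A])
        show "peval [:-c, 1:] A ** (peval [:-c, 1:] A ** (peval X A ** B)) = 0"
          using z unfolding calculation(1) peval_mult by (metis comm matrix_mul_assoc)
      qed
      ultimately show ?thesis by (simp only: peval_mult mmult_assoc)
    qed
  qed
qed

text \<open>The last clause keeps the functional calculus inside any star subalgebra containing A,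
  so that powers of elements of N stay in N.\<close>

definition spec_res :: "real set \<Rightarrow> (real \<Rightarrow> 'n::finite cmat) \<Rightarrow> 'n cmat \<Rightarrow> bool" where
  "spec_res S P A \<longleftrightarrow> finite S \<and> (\<forall>c\<in>S. madj (P c) = P c \<and> P c \<noteq> 0)
     \<and> (\<forall>c\<in>S. \<forall>d\<in>S. P c ** P d = (if c = d then P c else 0))
     \<and> sum P S = mat 1 \<and> A = (\<Sum>c\<in>S. cscale (of_real c) (P c))
     \<and> (\<forall>M. star_subalg M \<longrightarrow> A \<in> M \<longrightarrow> (\<forall>c\<in>S. P c \<in> M))"

theorem spectral_resolution_exists:
  fixes A :: "'n::finite cmat"
  assumes A: "madj A = A"
  shows "\<exists>S P. spec_res S P A"
proof -
  obtain p where p: "p \<noteq> 0" "peval p A = 0" using annihilating_poly_exists by blast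
  define S where "S = {c. poly p c = 0}"
  have fin: "finite S" unfolding S_def by (rule poly_roots_finite[OF p(1)])
  define q where "q = (\<Prod>c\<in>S. [:-c, 1:])"
  have q: "peval q A = 0"
    using squarefree_annihilates[OF A p(1), of "mat 1"] p(2) by (simp add: q_def S_def)
  have S0: "S \<noteq> {}"
  proof
    assume "S = {}" hence "q = 1" by (simp add: q_def)
    thus False using q by simp
  qed
  \<comment> \<open>Lagrange basis polynomials at the roots; evaluated at A they become the spectral
    projections.\<close>
  define L where "L = (\<lambda>c. \<Prod>d\<in>S - {c}. smult (1 / (c - d)) [:-d, 1:])"
  have Lp: "poly (L d) c = (if c = d then 1 else 0)" if "c \<in> S" "d \<in> S" for c d
  proof -
    have "poly (L d) c = (\<Prod>e\<in>S - {d}. (c - e) / (d - e))"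
      by (simp add: L_def poly_prod diff_divide_distrib)
    thus ?thesis using that fin by (auto intro!: prod.neutral prod_zero)
  qed
  have degL: "degree (L d) \<le> card S - 1" if "d \<in> S" for d
  proof -
    have d1: "degree (smult a [:-e, 1:]) \<le> 1" for a e :: complex
      by (rule order_trans[OF degree_smult_le]) simp
    have "degree (L d) \<le> (\<Sum>e\<in>S - {d}. 1)"
      unfolding L_def using d1
      by (intro order_trans[OF degree_prod_sum_le[OF finite_Diff[OF fin]]] sum_mono) (auto simp only: o_def)
    thus ?thesis using that fin by simp
  qed
  have Lsum: "sum L S = 1"
  proof (rule poly_eqI_degree[of S])
    show "poly (sum L S) x = poly 1 x" if "x \<in> S" for x
      using that fin Lp by (simp add: poly_sum sum.delta' cong: sum.cong) 
    have cS: "card S > 0" using fin S0 by (simp add: card_gt_0_iff)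
    show "card S > degree (sum L S)"
      using degree_sum_le[OF fin, of L "card S - 1"] degL cS by fastforce
    show "card S > degree (1 :: complex poly)" using cS by simp
  qed
  define P where "P = (\<lambda>c. peval (L c) A)"
  have eig: "A ** P c = cscale c (P c)" if c: "c \<in> S" for c
  proof -
    have "[:-c, 1:] * L c = smult (\<Prod>d\<in>S - {c}. 1 / (c - d)) q"
    proof -
      have "q = [:-c, 1:] * (\<Prod>d\<in>S - {c}. [:-d, 1:])"
        unfolding q_def by (rule prod.remove[OF fin c])
      moreover have "L c = smult (\<Prod>d\<in>S - {c}. 1 / (c - d)) (\<Prod>d\<in>S - {c}. [:-d, 1:])"
        unfolding L_def by (rule prod_smult)
      ultimately show ?thesis by (simp only: mult_smult_right)
    qed
    hence "peval [:-c, 1:] A ** P c = 0"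
      unfolding P_def by (metis peval_mult peval_smult q cscale_simps(6))
    thus ?thesis by (simp add: mm_distribs cscale_minus)
  qed
  have PP: "P d ** P c = (if c = d then P c else 0)" if "c \<in> S" "d \<in> S" for c d
    using peval_eigen[OF eig[OF that(1)], of "L d"] Lp[OF that] unfolding P_def by (auto split: if_splits)
  have Psum: "sum P S = mat 1" unfolding P_def peval_sum[symmetric] Lsum by simp
  have Amul: "A = (\<Sum>c\<in>S. cscale c (P c))"
  proof -
    have "A = A ** sum P S" by (simp add: Psum)
    also have "\<dots> = (\<Sum>c\<in>S. A ** P c)" by (simp add: mm.sum_right)
    finally show ?thesis using eig by simp
  qed
  \<comment> \<open>A root with nonzero projection is an eigenvalue of the self-adjoint A. Other
    roots of the annihilating polynomial may be non-real and have projection 0.\<close>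
  have real: "c \<in> \<real>" if c: "c \<in> S" "P c \<noteq> 0" for c
  proof -
    have "madj (P c) ** A ** P c = cscale c (madj (P c) ** P c)" using eig[OF c(1)] by (simp add: mmult_assoc)
    moreover have "madj (P c) ** A = cscale (cnj c) (madj (P c))"
      using arg_cong[OF eig[OF c(1)], of madj] A by simp
    ultimately have "cscale (cnj c - c) (madj (P c) ** P c) = 0" by (simp add: cscale_diff_left)
    hence "cnj c - c = 0 \<or> madj (P c) ** P c = 0"
      by (metis cscale_simps(3,4,6) divide_inverse_commute nonzero_mult_div_cancel_left eq_divide_eq_1 mult.commute divide_self)
    hence "cnj c = c" using madj_mult_self_eq_0 c(2) by auto
    thus ?thesis by (simp add: Reals_cnj_iff)
  qed
  have orth: "madj (P c) ** P d = 0" if "c \<in> S" "d \<in> S" "c \<noteq> d" for c d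
  proof (cases "P c = 0 \<or> P d = 0")
    case False
    have "madj (P c) ** A = cscale c (madj (P c))"
      using arg_cong[OF eig[OF that(1)], of madj] A real[OF that(1)] False by (simp add: Reals_cnj_iff)
    hence "cscale c (madj (P c) ** P d) = madj (P c) ** A ** P d" by simp
    also have "\<dots> = cscale d (madj (P c) ** P d)" using eig[OF that(2)] by (simp add: mmult_assoc)
    finally have "cscale (1 / (c - d)) (cscale (c - d) (madj (P c) ** P d)) = 0" by (simp add: cscale_diff_left)
    thus ?thesis using that(3) by simp
  qed auto
  have sa: "madj (P c) = P c" if c: "c \<in> S" for c
  proof -
    have "madj (P c) = madj (P c) ** sum P S" by (simp add: Psum)
    also have "\<dots> = (\<Sum>d\<in>S. if d = c then madj (P c) ** P c else 0)"
      unfolding mm.sum_right using orth[OF c] by (intro sum.cong) auto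
    also have "\<dots> = madj (P c) ** P c" using fin c by simp
    finally have e: "madj (P c) = madj (P c) ** P c" .
    have "madj (madj (P c)) = madj (madj (P c) ** P c)" by (rule arg_cong[OF e])
    hence "P c = madj (P c) ** P c" by (simp only: madj_simps)
    thus ?thesis by (rule trans[OF e sym])
  qed
  \<comment> \<open>Discards the roots with zero projection; what remains is real and can be indexed
    by real numbers.\<close>
  define S' where "S' = {r::real. of_real r \<in> S \<and> P (of_real r) \<noteq> 0}"
  define P' where "P' = (\<lambda>r::real. P (of_real r))"
  have im: "of_real ` S' = {c \<in> S. P c \<noteq> 0}"
    using real by (force simp: S'_def Reals_def)
  have inj: "inj_on (of_real :: real \<Rightarrow> complex) S'" by (simp add: inj_on_def)
  have finS': "finite S'" using finite_imageD[OF _ inj] im fin by simp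
  have reidx: "(\<Sum>r\<in>S'. cscale (g (of_real r)) (P' r)) = (\<Sum>c\<in>S. cscale (g c) (P c))" for g
  proof -
    have "(\<Sum>r\<in>S'. cscale (g (of_real r)) (P' r)) = (\<Sum>c\<in>of_real ` S'. cscale (g c) (P c))"
      by (subst sum.reindex[OF inj]) (simp add: P'_def)
    also have "\<dots> = (\<Sum>c\<in>S. cscale (g c) (P c))"
      unfolding im using fin by (intro sum.mono_neutral_left) auto
    finally show ?thesis .
  qed
  have "spec_res S' P' A"
    unfolding spec_res_def
  proof (intro conjI ballI allI impI)
    show "sum P' S' = mat 1" using reidx[of "\<lambda>_. 1"] Psum by simp
    show "A = (\<Sum>c\<in>S'. cscale (of_real c) (P' c))" using reidx[of "\<lambda>c. c"] Amul by simp
    show "P' c \<in> M" if "star_subalg M" "A \<in> M" for M c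
      using peval_mem[OF that] by (simp add: P'_def P_def)
  qed (use finS' sa PP in \<open>auto simp: S'_def P'_def\<close>)
  thus ?thesis by blast
qed

text \<open>Every vector is a sum of eigenvectors P i v, which gives existence and uniqueness for
  the description. Neither distinct values \<open>c i\<close> nor self-adjoint \<open>P i\<close>
  are demanded: the first allows squares, where c and -c merge, the second allows conjugation by a
  non-unitary matrix.\<close>

lemma mat_fun_resolution:
  fixes P :: "'i \<Rightarrow> 'n::finite cmat"
  assumes fin: "finite I" and one: "sum P I = mat 1"
    and PP: "\<And>i j. i \<in> I \<Longrightarrow> j \<in> I \<Longrightarrow> P i ** P j = (if i = j then P i else 0)"
    and A: "A = (\<Sum>i\<in>I. cscale (c i) (P i))"
  shows "mat_fun f A = (\<Sum>i\<in>I. cscale (f (c i)) (P i))"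
proof -
  have AP: "A ** P i = cscale (c i) (P i)" if "i \<in> I" for i
  proof -
    have "A ** P i = (\<Sum>j\<in>I. if j = i then cscale (c i) (P i) else 0)"
      unfolding A mm.sum_left using PP[OF _ that] by (intro sum.cong) auto
    thus ?thesis using fin that by simp
  qed
  have PA: "P i ** A = cscale (c i) (P i)" if "i \<in> I" for i
  proof -
    have "P i ** A = (\<Sum>j\<in>I. if j = i then cscale (c i) (P i) else 0)"
      unfolding A mm.sum_right using PP[OF that] by (intro sum.cong) auto
    thus ?thesis using fin that by simp
  qed
  have dec: "v = (\<Sum>i\<in>I. P i *v v)" for v
  proof -
    have "v = sum P I *v v" by (simp add: one)
    also have "\<dots> = (\<Sum>i\<in>I. P i *v v)"
      using fin by (induction I rule: finite_induct) (auto simp: matrix_vector_mult_add_rdistrib)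
    finally show ?thesis .
  qed
  define B where "B = (\<Sum>i\<in>I. cscale (f (c i)) (P i))"
  have Bv: "B *v v = (\<Sum>i\<in>I. f (c i) *s (P i *v v))" for v
    unfolding B_def using fin
    by (induction I rule: finite_induct) (auto simp: matrix_vector_mult_add_rdistrib cscale_vec)
  have "mat_fun f A = B"
    unfolding mat_fun_def
  proof (rule the_equality)
    show "\<forall>x v. A *v v = x *s v \<longrightarrow> B *v v = f x *s v"
    proof (intro allI impI)
      fix x v assume e: "A *v v = x *s v"
      have "f (c i) *s (P i *v v) = f x *s (P i *v v)" if i: "i \<in> I" for i
      proof -
        have "c i *s (P i *v v) = (P i ** A) *v v" by (simp add: PA[OF i] cscale_vec)
        also have "\<dots> = P i *v (x *s v)" by (simp add: matrix_vector_mul_assoc[symmetric] e)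
        also have "\<dots> = x *s (P i *v v)" by (simp add: vector_scalar_commute)
        finally have "(c i - x) *s (P i *v v) = 0" by (simp add: vector_sub_rdistrib)
        hence "c i = x \<or> P i *v v = 0" by (auto simp: vec_eq_iff)
        thus ?thesis by auto
      qed
      hence "B *v v = (\<Sum>i\<in>I. f x *s (P i *v v))" unfolding Bv by (rule sum.cong[OF refl])
      also have "\<dots> = f x *s (\<Sum>i\<in>I. P i *v v)" by (simp add: vec.scale_sum_right)
      finally show "B *v v = f x *s v" using dec[of v] by simp
    qed
    fix B' assume B': "\<forall>x v. A *v v = x *s v \<longrightarrow> B' *v v = f x *s v"
    have "B' *v v = B *v v" for v
    proof -
      have "B' *v v = B' *v (\<Sum>i\<in>I. P i *v v)" using dec[of v] by simp
      also have "\<dots> = (\<Sum>i\<in>I. B' *v (P i *v v))"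
        using fin by (induction I rule: finite_induct) (auto simp: matrix_vector_right_distrib)
      also have "\<dots> = (\<Sum>i\<in>I. f (c i) *s (P i *v v))"
      proof (rule sum.cong)
        fix i assume i: "i \<in> I"
        have "A *v (P i *v v) = c i *s (P i *v v)" by (simp add: matrix_vector_mul_assoc AP[OF i] cscale_vec)
        thus "B' *v (P i *v v) = f (c i) *s (P i *v v)" using B' by blast
      qed auto
      finally show ?thesis by (simp add: Bv)
    qed
    thus "B' = B" by (simp add: matrix_eq)
  qed
  thus ?thesis by (simp add: B_def)
qed

subsection \<open>Complex powers of positive definite matrices\<close>

text \<open>Set and projections are the two components of one and the same choice, so that they
  match.\<close>

definition eigs :: "'n::finite cmat \<Rightarrow> real set" where
  "eigs A = fst (SOME SP. spec_res (fst SP) (snd SP) A)"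

definition eproj :: "'n::finite cmat \<Rightarrow> real \<Rightarrow> 'n cmat" where
  "eproj A = snd (SOME SP. spec_res (fst SP) (snd SP) A)"

lemma spec_res_eigs:
  assumes "madj A = A" shows "spec_res (eigs A) (eproj A) A"
proof -
  have "\<exists>SP. spec_res (fst SP) (snd SP) A" using spectral_resolution_exists[OF assms] by force
  from someI_ex[OF this] show ?thesis by (simp add: eigs_def eproj_def)
qed

lemma
  assumes A: "madj A = A"
  shows finite_eigs: "finite (eigs A)"
    and madj_eproj: "c \<in> eigs A \<Longrightarrow> madj (eproj A c) = eproj A c"
    and eproj_neq_0: "c \<in> eigs A \<Longrightarrow> eproj A c \<noteq> 0"
    and eproj_mult: "c \<in> eigs A \<Longrightarrow> d \<in> eigs A \<Longrightarrow> eproj A c ** eproj A d = (if c = d then eproj A c else 0)"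
    and eproj_sum: "sum (eproj A) (eigs A) = mat 1"
    and eigs_decomp: "A = (\<Sum>c\<in>eigs A. cscale (of_real c) (eproj A c))"
    and eproj_mem: "star_subalg M \<Longrightarrow> A \<in> M \<Longrightarrow> c \<in> eigs A \<Longrightarrow> eproj A c \<in> M"
  using spec_res_eigs[OF A] unfolding spec_res_def by blast+

lemma eigs_nonempty: "madj A = A \<Longrightarrow> eigs A \<noteq> {}"
  using eproj_sum by fastforce

lemma mat_fun_eigs:
  "madj A = A \<Longrightarrow> mat_fun f A = (\<Sum>c\<in>eigs A. cscale (f (of_real c)) (eproj A c))"
  by (rule mat_fun_resolution[OF finite_eigs eproj_sum eproj_mult eigs_decomp]) auto

lemma eig_sum_mult:
  assumes A: "madj A = A"
  shows "(\<Sum>c\<in>eigs A. cscale (f c) (eproj A c)) ** (\<Sum>c\<in>eigs A. cscale (g c) (eproj A c))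
    = (\<Sum>c\<in>eigs A. cscale (f c * g c) (eproj A c))"
proof -
  have "(\<Sum>c\<in>eigs A. cscale (f c) (eproj A c)) ** (\<Sum>c\<in>eigs A. cscale (g c) (eproj A c))
     = (\<Sum>c\<in>eigs A. \<Sum>d\<in>eigs A. if d = c then cscale (f c * g c) (eproj A c) else 0)"
    unfolding mm.sum_left mm.sum_right
    by (intro sum.cong refl) (auto simp: eproj_mult[OF A] mult.commute)
  thus ?thesis using finite_eigs[OF A] by simp
qed

lemma eproj_eigenvector:
  assumes A: "madj A = A" and c: "c \<in> eigs A"
  obtains w where "w \<noteq> 0" "A *v w = of_real c *s w"
proof -
  from eproj_neq_0[OF A c] obtain v where v: "eproj A c *v v \<noteq> 0" by (auto simp: matrix_eq)
  have "A ** eproj A c = (\<Sum>d\<in>eigs A. if d = c then cscale (of_real c) (eproj A c) else 0)"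
    by (subst eigs_decomp[OF A]) (auto simp: mm.sum_left eproj_mult[OF A _ c] intro!: sum.cong)
  also have "\<dots> = cscale (of_real c) (eproj A c)" using finite_eigs[OF A] c by simp
  finally have "A *v (eproj A c *v v) = of_real c *s (eproj A c *v v)"
    by (simp add: matrix_vector_mul_assoc cscale_vec)
  thus ?thesis using that v by blast
qed

text \<open>Positivity is read off the chosen resolution, so that powers expand at once;
  \<open>pdI\<close> is the criterion free of that choice.\<close>

definition pd :: "'n::finite cmat \<Rightarrow> bool" where
  "pd A \<longleftrightarrow> madj A = A \<and> (\<forall>c\<in>eigs A. c > 0)"

lemma pd_madj: "pd A \<Longrightarrow> madj A = A" by (simp add: pd_def)
lemma pd_eigs: "pd A \<Longrightarrow> c \<in> eigs A \<Longrightarrow> c > 0" by (simp add: pd_def)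

lemma pdI:
  assumes "madj A = A" "\<And>w c. w \<noteq> 0 \<Longrightarrow> A *v w = of_real c *s w \<Longrightarrow> c > 0"
  shows "pd A"
  using assms eproj_eigenvector unfolding pd_def by metis

lemma pd_psd_invertible:
  assumes "psd A" "invertible A" shows "pd A"
proof (rule pdI)
  show "madj A = A" using assms(1) by (simp add: psd_iff hermitian_def)
  fix w c assume w: "w \<noteq> 0" "A *v w = of_real c *s w"
  have "0 \<le> Re (cip w (A *v w))" using assms(1) by (simp add: psd_iff)
  also have "\<dots> = c * (norm w)\<^sup>2" by (simp add: w cip_scale cip_self del: of_real_power)
  finally have "c \<ge> 0" using w(1) by (simp add: zero_le_mult_iff)
  moreover have "c \<noteq> 0"
  proof
    assume "c = 0"
    hence "A *v w = 0" using w by simp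
    thus False using assms(2) w(1) unfolding invertible_def
      by (metis matrix_vector_mul_assoc matrix_vector_mul_lid matrix_vector_mult_0_right)
  qed
  ultimately show "c > 0" by simp
qed

lemma pd_madj_mult:
  assumes "C ** B = mat 1" shows "pd (madj B ** B)"
proof (rule pdI)
  fix w c assume w: "w \<noteq> 0" "(madj B ** B) *v w = of_real c *s w"
  have "B *v w \<noteq> 0"
    using assms w(1) by (metis matrix_vector_mul_assoc matrix_vector_mul_lid matrix_vector_mult_0_right)
  moreover have "cip w ((madj B ** B) *v w) = of_real ((norm (B *v w))\<^sup>2)"
    by (metis cip_madj cip_self matrix_vector_mul_assoc madj_simps(2))
  hence "c * (norm w)\<^sup>2 = (norm (B *v w))\<^sup>2"
    unfolding w(2) cip_scale cip_self by (simp only: of_real_mult[symmetric] of_real_eq_iff)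
  ultimately have "c * (norm w)\<^sup>2 > 0" by simp
  thus "c > 0" by (simp add: zero_less_mult_iff)
qed simp

lemma mpow_eigs:
  "pd A \<Longrightarrow> mpow A z = (\<Sum>c\<in>eigs A. cscale (of_real c powr z) (eproj A c))"
  unfolding mpow_def by (rule mat_fun_eigs[OF pd_madj])

lemma mpow_mult:
  assumes "pd A" shows "mpow A z ** mpow A w = mpow A (z + w)"
  by (simp add: mpow_eigs[OF assms] eig_sum_mult[OF pd_madj[OF assms]] powr_add)

lemma mpow_mult_assoc: "pd A \<Longrightarrow> mpow A z ** (mpow A w ** X) = mpow A (z + w) ** X"
  by (simp add: matrix_mul_assoc mpow_mult)

lemma mpow_0 [simp]: "pd A \<Longrightarrow> mpow A 0 = mat 1"
proof -
  assume A: "pd A"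
  have "mpow A 0 = sum (eproj A) (eigs A)"
    using pd_eigs[OF A] by (fastforce simp: mpow_eigs[OF A] intro!: sum.cong)
  thus ?thesis using eproj_sum[OF pd_madj[OF A]] by simp
qed

lemma mpow_1: "pd A \<Longrightarrow> mpow A 1 = A"
proof -
  assume A: "pd A"
  have "mpow A 1 = (\<Sum>c\<in>eigs A. cscale (of_real c) (eproj A c))"
    using pd_eigs[OF A] by (auto simp: mpow_eigs[OF A] intro!: sum.cong)
  thus ?thesis using eigs_decomp[OF pd_madj[OF A]] by simp
qed

lemma madj_mpow:
  assumes A: "pd A" shows "madj (mpow A z) = mpow A (cnj z)"
proof -
  have "cnj (complex_of_real c powr z) = of_real c powr cnj z" if "c > 0" for c
    using that by (simp add: powr_def Ln_of_real exp_cnj)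
  thus ?thesis using pd_eigs[OF A]
    by (auto simp: mpow_eigs[OF A] madj_sum madj_eproj[OF pd_madj[OF A]] intro!: sum.cong)
qed

lemma star_subalg_sum: "star_subalg M \<Longrightarrow> (\<And>i. i \<in> I \<Longrightarrow> f i \<in> M) \<Longrightarrow> sum f I \<in> M"
  by (induction I rule: infinite_finite_induct) (auto intro: star_subalgD star_subalg_zero)

lemma mpow_mem: "star_subalg M \<Longrightarrow> pd A \<Longrightarrow> A \<in> M \<Longrightarrow> mpow A z \<in> M"
  unfolding mpow_eigs by (intro star_subalg_sum star_subalgD eproj_mem[OF pd_madj])

lemma mpow_resolution:
  assumes "finite I" "sum P I = mat 1"
    and "\<And>i j. i \<in> I \<Longrightarrow> j \<in> I \<Longrightarrow> P i ** P j = (if i = j then P i else 0)"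
    and "A = (\<Sum>i\<in>I. cscale (c i) (P i))"
  shows "mpow A z = (\<Sum>i\<in>I. cscale (c i powr z) (P i))"
  unfolding mpow_def by (rule mat_fun_resolution[OF assms])

text \<open>Removes the absolute value in \<open>schatten_norm\<close>, where the power p/2 is
  applied to the square of a positive matrix.\<close>

lemma mpow_square:
  assumes A: "pd A" shows "mpow (A ** A) (z / 2) = mpow A z"
proof -
  note h = pd_madj[OF A]
  have "A ** A = (\<Sum>c\<in>eigs A. cscale (of_real c * of_real c) (eproj A c))"
    using eig_sum_mult[OF h, of "\<lambda>c. of_real c" "\<lambda>c. of_real c"] eigs_decomp[OF h] by simp
  hence "mpow (A ** A) (z / 2) = (\<Sum>c\<in>eigs A. cscale ((of_real c * of_real c) powr (z / 2)) (eproj A c))"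
    using finite_eigs[OF h] eproj_sum[OF h] eproj_mult[OF h] by (intro mpow_resolution) auto
  also have "\<dots> = mpow A z"
    unfolding mpow_eigs[OF A]
  proof (rule sum.cong[OF refl])
    fix c assume "c \<in> eigs A"
    hence c: "c > 0" by (rule pd_eigs[OF A])
    have "Ln (complex_of_real (c * c)) = 2 * of_real (ln c)"
      using c by (subst Ln_of_real) (auto simp: ln_mult_pos)
    hence "(complex_of_real c * of_real c) powr (z / 2) = of_real c powr z"
      using c by (simp add: powr_def Ln_of_real)
    thus "cscale ((complex_of_real c * of_real c) powr (z / 2)) (eproj A c) = cscale (of_real c powr z) (eproj A c)"
      by simp
  qed
  finally show ?thesis .
qed

lemma mpow_cscale_mpow:
  assumes A: "pd A" and r: "r > 0"
  shows "pd (cscale (of_real r) (mpow A (of_real p)))"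
    and "mpow (cscale (of_real r) (mpow A (of_real p))) z = cscale (of_real r powr z) (mpow A (of_real p * z))"
proof -
  note h = pd_madj[OF A]
  let ?B = "cscale (of_real (sqrt r)) (mpow A (of_real (p / 2)))"
  have "cscale (of_real (1 / sqrt r)) (mpow A (of_real (- p / 2))) ** ?B = mat 1"
    using A r by (simp add: mpow_mult)
  hence "pd (madj ?B ** ?B)" by (rule pd_madj_mult)
  moreover have "madj ?B ** ?B = cscale (of_real r) (mpow A (of_real p))"
    using A r by (simp add: madj_mpow mpow_mult flip: of_real_mult)
  ultimately show "pd (cscale (of_real r) (mpow A (of_real p)))" by simp
  have "mpow (cscale (of_real r) (mpow A (of_real p))) z
      = (\<Sum>c\<in>eigs A. cscale ((of_real r * of_real c powr of_real p) powr z) (eproj A c))"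
    using finite_eigs[OF h] eproj_sum[OF h] eproj_mult[OF h]
    by (intro mpow_resolution) (auto simp: mpow_eigs[OF A] cscale_sum)
  also have "\<dots> = cscale (of_real r powr z) (mpow A (of_real p * z))"
    unfolding mpow_eigs[OF A] cscale_sum
  proof (rule sum.cong[OF refl])
    fix c assume "c \<in> eigs A"
    hence c: "c > 0" by (rule pd_eigs[OF A])
    have "(of_real r * complex_of_real c powr of_real p) powr z = of_real (r * c powr p) powr z"
      using c by (simp add: powr_of_real)
    also have "\<dots> = of_real r powr z * of_real c powr (of_real p * z)"
      using c r by (simp add: powr_def Ln_of_real ln_mult_pos ln_powr exp_add[symmetric] algebra_simps flip: of_real_mult)
    finally show "cscale ((of_real r * of_real c powr of_real p) powr z) (eproj A c)
        = cscale (of_real r powr z) (cscale (of_real c powr (of_real p * z)) (eproj A c))" by simp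
  qed
  finally show "mpow (cscale (of_real r) (mpow A (of_real p))) z = cscale (of_real r powr z) (mpow A (of_real p * z))" .
qed

text \<open>\<open>mat_fun\<close> is defined through eigenvectors alone, so it commutes with any
  similarity, although the conjugated projections are no longer self-adjoint.\<close>

lemma mpow_similar:
  fixes A C D :: "'n::finite cmat"
  assumes A: "pd A" and C: "C ** D = mat 1" "D ** C = mat 1"
  shows "mpow (C ** A ** D) z = C ** mpow A z ** D"
proof -
  note h = pd_madj[OF A]
  have "mpow (C ** A ** D) z = (\<Sum>c\<in>eigs A. cscale (of_real c powr z) (C ** eproj A c ** D))"
  proof (rule mpow_resolution)
    have "(\<Sum>c\<in>eigs A. C ** eproj A c ** D) = C ** sum (eproj A) (eigs A) ** D"
      by (simp add: mm.sum_left mm.sum_right)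
    thus "(\<Sum>c\<in>eigs A. C ** eproj A c ** D) = mat 1" using C by (simp add: eproj_sum[OF h])
    show "(C ** eproj A i ** D) ** (C ** eproj A j ** D) = (if i = j then C ** eproj A i ** D else 0)"
      if "i \<in> eigs A" "j \<in> eigs A" for i j
    proof -
      have "(C ** eproj A i ** D) ** (C ** eproj A j ** D) = C ** eproj A i ** (D ** C) ** eproj A j ** D"
        by (simp add: mmult_assoc)
      also have "\<dots> = C ** (eproj A i ** eproj A j) ** D" unfolding C by (simp add: mmult_assoc)
      finally show ?thesis using eproj_mult[OF h that] by simp
    qed
    have "C ** A ** D = C ** (\<Sum>c\<in>eigs A. cscale (of_real c) (eproj A c)) ** D"
      using eigs_decomp[OF h] by simp
    thus "C ** A ** D = (\<Sum>c\<in>eigs A. cscale (of_real c) (C ** eproj A c ** D))"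
      by (simp add: mm.sum_left mm.sum_right)
  qed (rule finite_eigs[OF h])
  thus ?thesis by (simp add: mpow_eigs[OF A] mm.sum_left mm.sum_right)
qed

subsection \<open>Hoelder's inequality for weighted finite sums\<close>

lemma weighted_holder:
  fixes w a b :: "'i \<Rightarrow> real"
  assumes "finite I" and w: "\<And>i. i \<in> I \<Longrightarrow> w i \<ge> 0" and a: "\<And>i. i \<in> I \<Longrightarrow> a i > 0" and b: "\<And>i. i \<in> I \<Longrightarrow> b i > 0"
    and th: "0 \<le> \<theta>" "\<theta> \<le> 1"
  shows "(\<Sum>i\<in>I. w i * (a i powr \<theta> * b i powr (1 - \<theta>))) \<le> (\<Sum>i\<in>I. w i * a i) powr \<theta> * (\<Sum>i\<in>I. w i * b i) powr (1 - \<theta>)"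
proof (cases "\<forall>i\<in>I. w i = 0")
  case False
  define S where "S = (\<Sum>i\<in>I. w i * a i)"
  define T where "T = (\<Sum>i\<in>I. w i * b i)"
  from False obtain k where k: "k \<in> I" "w k > 0" using w by (metis less_eq_real_def)
  have S: "S > 0" unfolding S_def
    by (rule sum_pos2[OF assms(1) k(1)]) (use w a k in \<open>auto intro!: mult_nonneg_nonneg simp: less_imp_le\<close>)
  have T: "T > 0" unfolding T_def
    by (rule sum_pos2[OF assms(1) k(1)]) (use w b k in \<open>auto intro!: mult_nonneg_nonneg simp: less_imp_le\<close>)
  have "(\<Sum>i\<in>I. w i * (a i powr \<theta> * b i powr (1 - \<theta>)))
     \<le> (\<Sum>i\<in>I. w i * (S powr \<theta> * T powr (1 - \<theta>) * (\<theta> * (a i / S) + (1 - \<theta>) * (b i / T))))"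
  proof (intro sum_mono mult_left_mono w)
    fix i assume i: "i \<in> I"
    have "(a i / S) powr \<theta> * (b i / T) powr (1 - \<theta>) \<le> \<theta> * (a i / S) + (1 - \<theta>) * (b i / T)"
      using Youngs_inequality_0[of \<theta> "1 - \<theta>" "a i / S" "b i / T"] th a[OF i] b[OF i] S T by simp
    hence "S powr \<theta> * T powr (1 - \<theta>) * ((a i / S) powr \<theta> * (b i / T) powr (1 - \<theta>)) \<le> S powr \<theta> * T powr (1 - \<theta>) * (\<theta> * (a i / S) + (1 - \<theta>) * (b i / T))"
      by (intro mult_left_mono) auto
    moreover have "S powr \<theta> * T powr (1 - \<theta>) * ((a i / S) powr \<theta> * (b i / T) powr (1 - \<theta>)) = a i powr \<theta> * b i powr (1 - \<theta>)"
      using S T a[OF i] b[OF i] by (simp add: powr_divide)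
    ultimately show "a i powr \<theta> * b i powr (1 - \<theta>) \<le> S powr \<theta> * T powr (1 - \<theta>) * (\<theta> * (a i / S) + (1 - \<theta>) * (b i / T))" by simp
  qed
  also have "\<dots> = S powr \<theta> * T powr (1 - \<theta>) * (\<theta> * (S / S) + (1 - \<theta>) * (T / T))"
    unfolding S_def T_def sum_divide_distrib sum_distrib_left distrib_left sum.distrib
    by (simp add: mult_ac)
  finally show ?thesis using S T by (simp add: S_def T_def)
qed simp

lemma power_mean_le:
  fixes m x :: "'i \<Rightarrow> real"
  assumes "finite I" "\<And>i. i \<in> I \<Longrightarrow> m i \<ge> 0" "\<And>i. i \<in> I \<Longrightarrow> x i > 0" "sum m I = 1" "0 \<le> \<theta>" "\<theta> \<le> 1"
  shows "(\<Sum>i\<in>I. m i * x i powr \<theta>) \<le> (\<Sum>i\<in>I. m i * x i) powr \<theta>"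
  using weighted_holder[OF assms(1), of m x "\<lambda>_. 1" \<theta>] assms(2-6) by simp

subsection \<open>The trace inner product\<close>

locale traced_algebra =
  fixes M :: "'n::finite cmat set" and \<tau> :: "'n cmat \<Rightarrow> complex"
  assumes M: "star_subalg M" and tr: "faithful_trace M \<tau>"
begin

lemma mem_intros [simp, intro]:
  "mat 1 \<in> M" "0 \<in> M" "x \<in> M \<Longrightarrow> y \<in> M \<Longrightarrow> x + y \<in> M" "x \<in> M \<Longrightarrow> y \<in> M \<Longrightarrow> x ** y \<in> M"
  "x \<in> M \<Longrightarrow> cscale c x \<in> M" "x \<in> M \<Longrightarrow> madj x \<in> M" "x \<in> M \<Longrightarrow> - x \<in> M" "x \<in> M \<Longrightarrow> y \<in> M \<Longrightarrow> x - y \<in> M"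
  "x \<in> M \<Longrightarrow> r *\<^sub>R x \<in> M" "pd x \<Longrightarrow> x \<in> M \<Longrightarrow> mpow x z \<in> M"
proof -
  show neg: "- x \<in> M" if "x \<in> M" for x
    using star_subalgD(4)[OF M that, of "-1"] by (simp add: cscale_minus)
  show "x - y \<in> M" if "x \<in> M" "y \<in> M" for x y
    using star_subalgD(2)[OF M that(1) neg[OF that(2)]] by simp
  show "pd x \<Longrightarrow> x \<in> M \<Longrightarrow> mpow x z \<in> M" by (rule mpow_mem[OF M])
qed (use star_subalgD[OF M] star_subalg_zero[OF M] in \<open>auto simp: scaleR_cscale\<close>)

lemma mem_sum [intro]: "(\<And>i. i \<in> I \<Longrightarrow> f i \<in> M) \<Longrightarrow> sum f I \<in> M"
  by (rule star_subalg_sum[OF M])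

lemma tau_add: "x \<in> M \<Longrightarrow> y \<in> M \<Longrightarrow> \<tau> (x + y) = \<tau> x + \<tau> y"
  and tau_comm: "x \<in> M \<Longrightarrow> y \<in> M \<Longrightarrow> \<tau> (x ** y) = \<tau> (y ** x)"
  and tau_cscale: "x \<in> M \<Longrightarrow> \<tau> (cscale c x) = c * \<tau> x"
  and tau_pos: "x \<in> M \<Longrightarrow> x \<noteq> 0 \<Longrightarrow> Im (\<tau> (madj x ** x)) = 0 \<and> Re (\<tau> (madj x ** x)) > 0"
  using tr unfolding faithful_trace_def by blast+

lemma tau_0 [simp]: "\<tau> 0 = 0" using tau_cscale[of 0 0] by simp
lemma tau_minus: "x \<in> M \<Longrightarrow> \<tau> (- x) = - \<tau> x" using tau_cscale[of x "-1"] by (simp add: cscale_minus)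
lemma tau_diff: "x \<in> M \<Longrightarrow> y \<in> M \<Longrightarrow> \<tau> (x - y) = \<tau> x - \<tau> y"
  using tau_add[of x "- y"] tau_minus[of y] by simp
lemma tau_sum: "(\<And>i. i \<in> I \<Longrightarrow> f i \<in> M) \<Longrightarrow> \<tau> (sum f I) = (\<Sum>i\<in>I. \<tau> (f i))"
  by (induction I rule: infinite_finite_induct) (auto simp: tau_add mem_sum)

definition ip :: "'n cmat \<Rightarrow> 'n cmat \<Rightarrow> complex" where "ip x y = \<tau> (madj x ** y)"
definition n2 :: "'n cmat \<Rightarrow> real" where "n2 x = sqrt (Re (ip x x))"

lemma ip_self: assumes "x \<in> M" shows "ip x x = of_real ((n2 x)\<^sup>2)" and ip_self_nonneg: "Re (ip x x) \<ge> 0"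
proof -
  have "Im (ip x x) = 0 \<and> Re (ip x x) \<ge> 0" using tau_pos[OF assms] by (cases "x = 0") (auto simp: ip_def)
  thus "ip x x = of_real ((n2 x)\<^sup>2)" "Re (ip x x) \<ge> 0" by (auto simp: n2_def complex_eq_iff)
qed

lemma n2_nonneg [simp]: "x \<in> M \<Longrightarrow> n2 x \<ge> 0" by (simp add: n2_def ip_self_nonneg)

lemma ip_add: "x \<in> M \<Longrightarrow> y \<in> M \<Longrightarrow> z \<in> M \<Longrightarrow> ip x (y + z) = ip x y + ip x z"
  "x \<in> M \<Longrightarrow> y \<in> M \<Longrightarrow> z \<in> M \<Longrightarrow> ip (x + y) z = ip x z + ip y z"
  "x \<in> M \<Longrightarrow> y \<in> M \<Longrightarrow> z \<in> M \<Longrightarrow> ip x (y - z) = ip x y - ip x z"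
  "x \<in> M \<Longrightarrow> y \<in> M \<Longrightarrow> z \<in> M \<Longrightarrow> ip (x - y) z = ip x z - ip y z"
  "x \<in> M \<Longrightarrow> y \<in> M \<Longrightarrow> ip x (cscale c y) = c * ip x y"
  "x \<in> M \<Longrightarrow> y \<in> M \<Longrightarrow> ip (cscale c x) y = cnj c * ip x y"
  by (auto simp: ip_def mm_distribs tau_add tau_diff tau_cscale)

text \<open>A faithful trace is only required to be positive on the elements
  \<open>madj x ** x\<close>. Hermitian symmetry follows by polarisation with x + y and x + i
  y.\<close>

lemma ip_cnj: assumes x: "x \<in> M" and y: "y \<in> M" shows "ip y x = cnj (ip x y)"
proof -
  have Im0: "Im (ip z z) = 0" if "z \<in> M" for z by (simp only: ip_self(1)[OF that] Im_complex_of_real)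
  have iy: "cscale \<i> y \<in> M" using y by simp
  have "ip (x + y) (x + y) = ip x x + ip y x + (ip x y + ip y y)"
    using x y by (simp only: ip_add mem_intros)
  hence "Im (ip x y) + Im (ip y x) = 0"
    using Im0[OF mem_intros(3)[OF x y]] Im0[OF x] Im0[OF y] by simp
  moreover have "ip (x + cscale \<i> y) (x + cscale \<i> y) = ip x x + - \<i> * ip y x + (\<i> * ip x y + ip y y)"
    using x y iy by (simp only: ip_add mem_intros) (simp add: algebra_simps)
  hence "Re (ip x y) - Re (ip y x) = 0"
    using Im0[OF mem_intros(3)[OF x iy]] Im0[OF x] Im0[OF y] by simp
  ultimately show ?thesis by (simp add: complex_eq_iff)
qed

lemma tau_madj: "x \<in> M \<Longrightarrow> \<tau> (madj x) = cnj (\<tau> x)"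
  using ip_cnj[of "mat 1" x] by (simp add: ip_def)

lemma cauchy_schwarz:
  assumes x: "x \<in> M" and y: "y \<in> M"
  shows "norm (ip x y) \<le> n2 x * n2 y"
proof (cases "y = 0")
  case False
  have yy: "Re (ip y y) > 0" using tau_pos[OF y False] by (simp add: ip_def)
  hence ny: "(n2 y)\<^sup>2 > 0" by (simp add: n2_def)
  define l where "l = ip y x / of_real ((n2 y)\<^sup>2)"
  have ly: "cscale l y \<in> M" using y by simp
  have "0 \<le> Re (ip (x - cscale l y) (x - cscale l y))" using x y by (intro ip_self_nonneg) auto
  also have "ip (x - cscale l y) (x - cscale l y) = ip x x - l * ip x y - cnj l * (ip y x - l * ip y y)"
    using x y ly by (simp add: ip_add right_diff_distrib)
  also have "l * ip y y = ip y x" unfolding l_def ip_self(1)[OF y] using ny by (simp del: of_real_power)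
  also have "ip x x - l * ip x y - cnj l * (ip y x - ip y x) = ip x x - cnj (ip x y) * ip x y / of_real ((n2 y)\<^sup>2)"
    unfolding l_def ip_cnj[OF x y] by (simp del: of_real_power)
  also have "cnj (ip x y) * ip x y = of_real ((norm (ip x y))\<^sup>2)"
    by (simp only: complex_norm_square mult.commute)
  also have "Re (ip x x - of_real ((norm (ip x y))\<^sup>2) / of_real ((n2 y)\<^sup>2)) = (n2 x)\<^sup>2 - (norm (ip x y))\<^sup>2 / (n2 y)\<^sup>2"
    unfolding ip_self(1)[OF x] by (simp only: of_real_divide[symmetric] of_real_diff[symmetric] Re_complex_of_real)
  finally have "(norm (ip x y))\<^sup>2 \<le> (n2 x * n2 y)\<^sup>2" using ny by (simp add: field_simps power_mult_distrib)
  thus ?thesis by (rule power2_le_imp_le) (use x y in auto)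
qed (use assms in \<open>auto simp: ip_def\<close>)

lemma n2_madj: "x \<in> M \<Longrightarrow> n2 (madj x) = n2 x"
  by (simp add: n2_def ip_def tau_comm)

lemma n2_triangle: assumes "x \<in> M" "y \<in> M" shows "n2 (x + y) \<le> n2 x + n2 y"
proof -
  have "x + y \<in> M" using assms by simp
  from ip_self(1)[OF this] have "(n2 (x + y))\<^sup>2 = Re (ip (x + y) (x + y))" by (simp only: Re_complex_of_real)
  also have "ip (x + y) (x + y) = ip x x + ip x y + (cnj (ip x y) + ip y y)"
    unfolding ip_cnj[OF assms, symmetric] using assms by (simp add: ip_add)
  also have "Re \<dots> = (n2 x)\<^sup>2 + (n2 y)\<^sup>2 + 2 * Re (ip x y)"
    unfolding ip_self(1)[OF assms(1)] ip_self(1)[OF assms(2)] by (simp del: of_real_power)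
  also have "\<dots> \<le> (n2 x)\<^sup>2 + (n2 y)\<^sup>2 + 2 * (n2 x * n2 y)"
    using complex_Re_le_cmod[of "ip x y"] cauchy_schwarz[OF assms] by simp
  also have "\<dots> = (n2 x + n2 y)\<^sup>2" by (simp add: power2_eq_square algebra_simps)
  finally show ?thesis by (rule power2_le_imp_le) (use assms in auto)
qed

lemma n2_minus: "x \<in> M \<Longrightarrow> n2 (- x) = n2 x"
  by (simp add: n2_def ip_def mm_distribs)

lemma n2_left_isometry: "madj u ** u = mat 1 \<Longrightarrow> n2 (u ** x) = n2 x"
  by (simp add: n2_def ip_def mmult_assoc) (simp add: matrix_mul_assoc)

lemma tau_mult_bound: "x \<in> M \<Longrightarrow> y \<in> M \<Longrightarrow> norm (\<tau> (x ** y)) \<le> n2 x * n2 y"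
  using cauchy_schwarz[of "madj x" y] by (simp add: ip_def n2_madj)

lemma n2_sq: "x \<in> M \<Longrightarrow> (n2 x)\<^sup>2 = Re (\<tau> (madj x ** x))"
  using ip_self(1)[of x] by (simp add: ip_def complex_eq_iff)

lemma n2_eq_1I: "x \<in> M \<Longrightarrow> \<tau> (madj x ** x) = 1 \<Longrightarrow> n2 x = 1"
  by (simp add: n2_def ip_def)

text \<open>The spectral measure, at the vector X, of the commuting operators of left multiplication
  by A and right multiplication by W. The operator x -> A x W^(-1) has the value c/d at the pair (c,
  d).\<close>

definition wt :: "'n cmat \<Rightarrow> 'n cmat \<Rightarrow> 'n cmat \<Rightarrow> real \<times> real \<Rightarrow> real" where
  "wt A W X = (\<lambda>(c, d). (n2 (eproj A c ** X ** eproj W d))\<^sup>2)"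

lemma two_sided_expand:
  assumes "pd A" "A \<in> M" "pd W" "W \<in> M" "X \<in> M" "Y \<in> M"
  shows "\<tau> (Y ** mpow A z ** X ** mpow W v)
    = (\<Sum>(c, d)\<in>eigs A \<times> eigs W. of_real c powr z * of_real d powr v * \<tau> (Y ** eproj A c ** X ** eproj W d))"
proof -
  have pm: "eproj A c \<in> M" if "c \<in> eigs A" for c using eproj_mem[OF pd_madj M] assms that by blast
  have qm: "eproj W c \<in> M" if "c \<in> eigs W" for c using eproj_mem[OF pd_madj M] assms that by blast
  have "Y ** mpow A z ** X ** mpow W v = (\<Sum>c\<in>eigs A. \<Sum>d\<in>eigs W.
      cscale (of_real c powr z * of_real d powr v) (Y ** eproj A c ** X ** eproj W d))"
    unfolding mpow_eigs[OF assms(1)] mpow_eigs[OF assms(3)]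
    by (simp add: mm.sum_left mm.sum_right cscale_sum) (subst sum.swap, simp add: mult.commute)
  hence "\<tau> (Y ** mpow A z ** X ** mpow W v) = (\<Sum>c\<in>eigs A. \<Sum>d\<in>eigs W.
      of_real c powr z * of_real d powr v * \<tau> (Y ** eproj A c ** X ** eproj W d))"
    using pm qm assms by (simp add: tau_sum tau_cscale mem_sum)
  thus ?thesis by (simp add: sum.cartesian_product)
qed

lemma wt_tau:
  assumes "pd A" "A \<in> M" "pd W" "W \<in> M" "X \<in> M" "c \<in> eigs A" "d \<in> eigs W"
  shows "\<tau> (madj X ** eproj A c ** X ** eproj W d) = of_real (wt A W X (c, d))"
proof -
  have pm: "eproj A c \<in> M" "eproj W d \<in> M" using eproj_mem[OF pd_madj M] assms by blast+
  note p = madj_eproj[OF pd_madj[OF assms(1)] assms(6)] eproj_mult[OF pd_madj[OF assms(1)] assms(6) assms(6)]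
    madj_eproj[OF pd_madj[OF assms(3)] assms(7)] eproj_mult[OF pd_madj[OF assms(3)] assms(7) assms(7)]
  let ?Z = "eproj A c ** X ** eproj W d"
  have "of_real (wt A W X (c, d)) = \<tau> (madj ?Z ** ?Z)"
    using ip_self(1)[of ?Z] pm assms by (simp add: wt_def ip_def)
  also have "madj ?Z ** ?Z = eproj W d ** (madj X ** (eproj A c ** eproj A c) ** X ** eproj W d)"
    by (simp add: p(1) p(3) mmult_assoc)
  also have "\<tau> \<dots> = \<tau> ((madj X ** (eproj A c ** eproj A c) ** X ** eproj W d) ** eproj W d)"
    using pm assms by (intro tau_comm) auto
  also have "(madj X ** (eproj A c ** eproj A c) ** X ** eproj W d) ** eproj W d
     = madj X ** (eproj A c ** eproj A c) ** X ** (eproj W d ** eproj W d)" by (simp add: mmult_assoc)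
  finally show ?thesis by (simp add: p)
qed

lemma moment:
  assumes "pd A" "A \<in> M" "pd W" "W \<in> M" "X \<in> M"
  shows "\<tau> (madj X ** mpow A (of_real b) ** X ** mpow W (of_real e))
    = of_real (\<Sum>(c, d)\<in>eigs A \<times> eigs W. c powr b * d powr e * wt A W X (c, d))"
proof -
  have "(\<Sum>(c, d)\<in>eigs A \<times> eigs W. of_real c powr (of_real b) * of_real d powr of_real e * \<tau> (madj X ** eproj A c ** X ** eproj W d))
    = (\<Sum>(c, d)\<in>eigs A \<times> eigs W. of_real (c powr b * d powr e * wt A W X (c, d)))"
    using wt_tau[OF assms] pd_eigs[OF assms(1)] pd_eigs[OF assms(3)]
    by (intro sum.cong) (auto simp: powr_of_real less_imp_le)
  thus ?thesis using two_sided_expand[OF assms(1-5), of "madj X"] assms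
    by (simp add: case_prod_unfold)
qed

text \<open>The b-th moment at X of the relative modular operator x -> A x W^(-1).\<close>

lemma moment_ratio:
  assumes "pd A" "A \<in> M" "pd W" "W \<in> M" "X \<in> M"
  shows "\<tau> (madj X ** mpow A (of_real b) ** X ** mpow W (- of_real b))
    = of_real (\<Sum>p\<in>eigs A \<times> eigs W. wt A W X p * (fst p / snd p) powr b)"
proof -
  have "c powr b * d powr (- b) * w = w * (c / d) powr b" if "c > 0" "d > 0" for c d w :: real
    using that by (simp add: powr_divide powr_minus_divide)
  hence "(\<Sum>(c, d)\<in>eigs A \<times> eigs W. c powr b * d powr (- b) * wt A W X (c, d))
      = (\<Sum>p\<in>eigs A \<times> eigs W. wt A W X p * (fst p / snd p) powr b)"
    using pd_eigs[OF assms(1)] pd_eigs[OF assms(3)] by (intro sum.cong refl) (simp only: case_prod_unfold mem_Times_iff prod.collapse)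
  thus ?thesis using moment[OF assms, of b "- b"] by (simp only: of_real_minus)
qed

lemma sum_wt:
  assumes "pd A" "A \<in> M" "pd W" "W \<in> M" "X \<in> M"
  shows "(\<Sum>p\<in>eigs A \<times> eigs W. wt A W X p) = Re (\<tau> (madj X ** X))"
proof -
  have "fst p / snd p > 0" if "p \<in> eigs A \<times> eigs W" for p
    using that pd_eigs[OF assms(1), of "fst p"] pd_eigs[OF assms(3), of "snd p"] by (auto simp: mem_Times_iff)
  hence "(\<Sum>p\<in>eigs A \<times> eigs W. wt A W X p) = (\<Sum>p\<in>eigs A \<times> eigs W. wt A W X p * (fst p / snd p) powr 0)"
    by (intro sum.cong refl) fastforce
  also have "\<dots> = Re (\<tau> (madj X ** X))" using moment_ratio[OF assms, of 0] assms by simp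
  finally show ?thesis .
qed

lemma wt_nonneg: "wt A W X p \<ge> 0" by (simp add: wt_def case_prod_unfold)

text \<open>At X = 1 the weights \<open>wt\<close> form a joint distribution of the eigenvalues of A
  and W, which reduces the claim to Hoelder's inequality for sums.\<close>

lemma trace_holder:
  assumes A: "pd A" "A \<in> M" and W: "pd W" "W \<in> M" and th: "0 \<le> \<theta>" "\<theta> \<le> 1"
    and u: "u = \<theta> * a + (1 - \<theta>) * a'" and v: "v = \<theta> * b + (1 - \<theta>) * b'"
  shows "Re (\<tau> (mpow A (of_real u) ** mpow W (of_real v)))
    \<le> Re (\<tau> (mpow A (of_real a) ** mpow W (of_real b))) powr \<theta> * Re (\<tau> (mpow A (of_real a') ** mpow W (of_real b'))) powr (1 - \<theta>)"
proof -
  have one: "Re (\<tau> (mpow A (of_real u) ** mpow W (of_real v)))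
      = (\<Sum>p\<in>eigs A \<times> eigs W. wt A W (mat 1) p * (fst p powr u * snd p powr v))" for u v
    using moment[OF A W, of "mat 1" u v] by (simp add: case_prod_unfold mult_ac)
  have pos: "fst p > 0" "snd p > 0" if "p \<in> eigs A \<times> eigs W" for p
    using that pd_eigs[OF A(1), of "fst p"] pd_eigs[OF W(1), of "snd p"] by (auto simp: mem_Times_iff)
  have "fst p powr u * snd p powr v = (fst p powr a * snd p powr b) powr \<theta> * (fst p powr a' * snd p powr b') powr (1 - \<theta>)"
    if "p \<in> eigs A \<times> eigs W" for p
    using pos[OF that] by (simp add: powr_mult powr_powr u v powr_add mult_ac)
  hence "Re (\<tau> (mpow A (of_real u) ** mpow W (of_real v)))
      = (\<Sum>p\<in>eigs A \<times> eigs W. wt A W (mat 1) p * ((fst p powr a * snd p powr b) powr \<theta> * (fst p powr a' * snd p powr b') powr (1 - \<theta>)))"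
    unfolding one by (intro sum.cong refl) simp
  also have "\<dots> \<le> (\<Sum>p\<in>eigs A \<times> eigs W. wt A W (mat 1) p * (fst p powr a * snd p powr b)) powr \<theta>
      * (\<Sum>p\<in>eigs A \<times> eigs W. wt A W (mat 1) p * (fst p powr a' * snd p powr b')) powr (1 - \<theta>)"
  proof (rule weighted_holder)
    show "finite (eigs A \<times> eigs W)" using finite_eigs[OF pd_madj[OF A(1)]] finite_eigs[OF pd_madj[OF W(1)]] by simp
  qed (use th pos in \<open>simp_all add: wt_nonneg, auto simp: less_imp_neq[THEN not_sym]\<close>)
  finally show ?thesis unfolding one .
qed

end

section \<open>Duality for the trace norm, normalised powers, and resolvents of two-sided
  multiplication\<close>

context traced_algebra
begin

text \<open>X is the sign of y, with value 1 on the kernel so that X X = 1. Fixing X turns a trace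
  norm into a linear functional, which can be interpolated and averaged.\<close>

lemma trace_norm_sign:
  assumes y: "y \<in> M" "madj y = y"
  obtains X where "X \<in> M" "madj X = X" "X ** X = mat 1" "schatten_norm \<tau> 1 y = Re (\<tau> (X ** y))"
proof -
  define X where "X = (\<Sum>c\<in>eigs y. cscale (if c \<ge> 0 then 1 else -1) (eproj y c))"
  have pm: "eproj y c \<in> M" if "c \<in> eigs y" for c using eproj_mem[OF y(2) M y(1) that] .
  have dec: "y = (\<Sum>c\<in>eigs y. cscale (of_real c) (eproj y c))" by (rule eigs_decomp[OF y(2)])
  have XM: "X \<in> M" unfolding X_def using pm by auto
  have Xa: "madj X = X" unfolding X_def madj_sum by (intro sum.cong refl) (auto simp: madj_eproj[OF y(2)])
  have "X ** X = (\<Sum>c\<in>eigs y. cscale 1 (eproj y c))"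
    unfolding X_def eig_sum_mult[OF y(2)] by (intro sum.cong refl) auto
  hence XX: "X ** X = mat 1" using eproj_sum[OF y(2)] by simp
  have Xy: "X ** y = (\<Sum>c\<in>eigs y. cscale (of_real \<bar>c\<bar>) (eproj y c))"
  proof -
    have "X ** y = X ** (\<Sum>c\<in>eigs y. cscale (of_real c) (eproj y c))" using dec by simp
    also have "\<dots> = (\<Sum>c\<in>eigs y. cscale (of_real \<bar>c\<bar>) (eproj y c))"
      unfolding X_def eig_sum_mult[OF y(2)] by (intro sum.cong refl) auto
    finally show ?thesis .
  qed
  have yy: "madj y ** y = (\<Sum>c\<in>eigs y. cscale (of_real (c * c)) (eproj y c))"
  proof -
    have "madj y ** y = (\<Sum>c\<in>eigs y. cscale (of_real c) (eproj y c)) ** (\<Sum>c\<in>eigs y. cscale (of_real c) (eproj y c))"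
      using dec y(2) by simp
    thus ?thesis unfolding eig_sum_mult[OF y(2)] by simp
  qed
  have "mpow (madj y ** y) (of_real (1 / 2)) = (\<Sum>c\<in>eigs y. cscale (of_real (c * c) powr of_real (1/2)) (eproj y c))"
    by (rule mpow_resolution[OF finite_eigs[OF y(2)] eproj_sum[OF y(2)] eproj_mult[OF y(2)] yy])
  also have "\<dots> = X ** y"
  proof -
    have "complex_of_real (c * c) powr of_real (1/2) = of_real \<bar>c\<bar>" for c
    proof -
      have "complex_of_real (c * c) powr of_real (1/2) = of_real ((c * c) powr (1/2))"
        by (rule powr_of_real) simp
      also have "(c * c) powr (1/2) = \<bar>c\<bar>" by (simp add: powr_half_sqrt)
      finally show ?thesis .
    qed
    thus ?thesis unfolding Xy by simp
  qed
  finally have s: "schatten_norm \<tau> 1 y = Re (\<tau> (X ** y)) powr 1" by (simp add: schatten_norm_def)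
  have "\<tau> (X ** y) = (\<Sum>c\<in>eigs y. of_real \<bar>c\<bar> * \<tau> (eproj y c))"
    unfolding Xy using pm by (simp add: tau_sum tau_cscale)
  also have "Re \<dots> \<ge> 0"
  proof -
    have "Re (\<tau> (eproj y c)) \<ge> 0" if c: "c \<in> eigs y" for c
      using ip_self_nonneg[OF pm[OF c]] by (simp add: ip_def madj_eproj[OF y(2) c] eproj_mult[OF y(2) c c])
    thus ?thesis by (simp add: sum_nonneg)
  qed
  finally have "schatten_norm \<tau> 1 y = Re (\<tau> (X ** y))" using s by simp
  thus ?thesis using that XM Xa XX by blast
qed

lemma n2_mpow_half:
  assumes "pd A" "A \<in> M" "\<tau> A = 1"
  shows "n2 (mpow A (1/2)) = 1"
  using assms by (intro n2_eq_1I) (auto simp: madj_mpow mpow_mult mpow_1)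

lemma tau_mpow_real:
  assumes A: "pd A" "A \<in> M"
  shows "\<tau> (mpow A (of_real p)) = of_real (Re (\<tau> (mpow A (of_real p))))"
    and tau_mpow_pos: "Re (\<tau> (mpow A (of_real p))) > 0"
proof -
  let ?H = "mpow A (of_real (p / 2))"
  have e: "madj ?H ** ?H = mpow A (of_real p)"
    using A by (simp add: madj_mpow mpow_mult)
  have "?H \<noteq> 0"
  proof
    assume "?H = 0"
    hence "mpow A (of_real (- p / 2)) ** ?H = 0" by simp
    thus False using A by (simp add: mpow_mult)
  qed
  thus "\<tau> (mpow A (of_real p)) = of_real (Re (\<tau> (mpow A (of_real p))))" "Re (\<tau> (mpow A (of_real p))) > 0"
    using tau_pos[of ?H] A unfolding e by (auto simp: complex_eq_iff)
qed

lemma normalized_mpow: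
  fixes A :: "'n cmat" and \<alpha> z :: real
  assumes A: "pd A" "A \<in> M"
  defines "P \<equiv> Re (\<tau> (mpow A (of_real \<alpha>)))"
  defines "W \<equiv> cscale (of_real (1 / P)) (mpow A (of_real \<alpha>))"
  shows "W \<in> M" "pd W" "\<tau> W = 1"
    and "mpow W (of_real z) = cscale (of_real (P powr (- z))) (mpow A (of_real (\<alpha> * z)))"
proof -
  have P: "P > 0" unfolding P_def by (rule tau_mpow_pos[OF A])
  show "W \<in> M" using A by (simp add: W_def)
  show "pd W" unfolding W_def using P by (intro mpow_cscale_mpow(1) A) simp
  have "\<tau> (mpow A (of_real \<alpha>)) = of_real P" unfolding P_def by (rule tau_mpow_real[OF A])
  thus "\<tau> W = 1" unfolding W_def using P A by (subst tau_cscale) simp_all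
  have "complex_of_real (1 / P) powr of_real z = of_real (P powr (- z))"
    using P by (subst powr_of_real) (auto simp: powr_divide powr_minus_divide less_imp_le)
  thus "mpow W (of_real z) = cscale (of_real (P powr (- z))) (mpow A (of_real (\<alpha> * z)))"
    unfolding W_def using P by (subst mpow_cscale_mpow(2)[OF A(1)]) (simp_all del: of_real_divide)
qed

text \<open>The resolvent at -l of x -> A x W^(-1), applied to X and written out in the
  eigenprojections.\<close>

definition resolv :: "'n cmat \<Rightarrow> 'n cmat \<Rightarrow> 'n cmat \<Rightarrow> real \<Rightarrow> 'n cmat" where
  "resolv A W X l = (\<Sum>(c, d)\<in>eigs A \<times> eigs W. cscale (1 / of_real (c / d + l)) (eproj A c ** X ** eproj W d))"

lemma resolv_mem:
  assumes "pd A" "A \<in> M" "pd W" "W \<in> M" "X \<in> M"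
  shows "resolv A W X l \<in> M"
  unfolding resolv_def using eproj_mem[OF pd_madj M] assms by (intro mem_sum) auto

lemma resolv_eq:
  assumes A: "pd A" and W: "pd W" and l: "l > 0"
  shows "A ** resolv A W X l ** mpow W (-1) + cscale (of_real l) (resolv A W X l) = X"
proof -
  note hA = pd_madj[OF A] and hW = pd_madj[OF W]
  have eA: "A ** eproj A c = cscale (of_real c) (eproj A c)" if c: "c \<in> eigs A" for c
  proof -
    have "A ** eproj A c = (\<Sum>d\<in>eigs A. if d = c then cscale (of_real c) (eproj A c) else 0)"
      by (subst eigs_decomp[OF hA]) (auto simp: mm.sum_left eproj_mult[OF hA _ c] intro!: sum.cong)
    thus ?thesis using finite_eigs[OF hA] c by simp
  qed
  have eW: "eproj W d ** mpow W (-1) = cscale (1 / of_real d) (eproj W d)" if d: "d \<in> eigs W" for d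
  proof -
    have "eproj W d ** mpow W (-1) = (\<Sum>e\<in>eigs W. if e = d then cscale (of_real d powr (-1)) (eproj W d) else 0)"
      unfolding mpow_eigs[OF W] by (auto simp: mm.sum_right eproj_mult[OF hW d] intro!: sum.cong)
    also have "\<dots> = cscale (of_real d powr (-1)) (eproj W d)" using finite_eigs[OF hW] d by simp
    also have "complex_of_real d powr (-1) = 1 / of_real d"
      using pd_eigs[OF W d] by (simp add: powr_minus inverse_eq_divide)
    finally show ?thesis .
  qed
  have "A ** resolv A W X l ** mpow W (-1) + cscale (of_real l) (resolv A W X l)
     = (\<Sum>(c, d)\<in>eigs A \<times> eigs W. eproj A c ** X ** eproj W d)"
    unfolding resolv_def mm.sum_right mm.sum_left cscale_sum sum.distrib[symmetric]
  proof (rule sum.cong[OF refl], clarify)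
    fix c d assume cd: "c \<in> eigs A" "d \<in> eigs W"
    have pos: "c > 0" "d > 0" using cd pd_eigs[OF A] pd_eigs[OF W] by auto
    let ?k = "1 / complex_of_real (c / d + l)"
    have "A ** cscale ?k (eproj A c ** X ** eproj W d) ** mpow W (-1) = cscale ?k ((A ** eproj A c) ** X ** (eproj W d ** mpow W (-1)))"
      by (simp add: mmult_assoc)
    also have "\<dots> = cscale (?k * of_real (c / d)) (eproj A c ** X ** eproj W d)"
      unfolding eA[OF cd(1)] eW[OF cd(2)] by (simp add: mult_ac)
    finally have "A ** cscale ?k (eproj A c ** X ** eproj W d) ** mpow W (-1) + cscale (of_real l) (cscale ?k (eproj A c ** X ** eproj W d))
      = cscale (?k * of_real (c / d) + of_real l * ?k) (eproj A c ** X ** eproj W d)"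
      by (simp only: cscale_add_left cscale_simps)
    also have "?k * of_real (c / d) + of_real l * ?k = 1"
    proof -
      have "?k * of_real (c / d) + of_real l * ?k = ?k * of_real (c / d + l)" by (simp only: of_real_add ring_distribs mult.commute)
      moreover have "complex_of_real (c / d + l) \<noteq> 0" using pos l by (simp only: of_real_eq_0_iff) (smt (verit) divide_pos_pos)
      ultimately show ?thesis by simp
    qed
    finally show "A ** cscale ?k (eproj A c ** X ** eproj W d) ** mpow W (-1) + cscale (of_real l) (cscale ?k (eproj A c ** X ** eproj W d)) = eproj A c ** X ** eproj W d"
      by simp
  qed
  also have "\<dots> = (\<Sum>c\<in>eigs A. eproj A c) ** X ** (\<Sum>d\<in>eigs W. eproj W d)"
    unfolding mm.sum_left mm.sum_right sum.cartesian_product[symmetric] by (rule sum.swap)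
  also have "\<dots> = X" using eproj_sum[OF hA] eproj_sum[OF hW] by simp
  finally show ?thesis .
qed

lemma tau_resolv:
  assumes "pd A" "A \<in> M" "pd W" "W \<in> M" "X \<in> M" "Y \<in> M"
  shows "\<tau> (Y ** resolv A W X l) = (\<Sum>p\<in>eigs A \<times> eigs W. \<tau> (Y ** eproj A (fst p) ** X ** eproj W (snd p)) / of_real (fst p / snd p + l))"
proof -
  have pm: "eproj A c \<in> M" if "c \<in> eigs A" for c using eproj_mem[OF pd_madj M] assms that by blast
  have qm: "eproj W c \<in> M" if "c \<in> eigs W" for c using eproj_mem[OF pd_madj M] assms that by blast
  have "Y ** resolv A W X l = (\<Sum>p\<in>eigs A \<times> eigs W. cscale (1 / of_real (fst p / snd p + l)) (Y ** eproj A (fst p) ** X ** eproj W (snd p)))"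
    unfolding resolv_def case_prod_unfold mm.sum_right by (simp add: mmult_assoc)
  moreover have mem: "Y ** eproj A (fst p) ** X ** eproj W (snd p) \<in> M" if "p \<in> eigs A \<times> eigs W" for p
    using that pm[of "fst p"] qm[of "snd p"] assms by (auto simp: mem_Times_iff)
  ultimately have "\<tau> (Y ** resolv A W X l) = (\<Sum>p\<in>eigs A \<times> eigs W. \<tau> (cscale (1 / of_real (fst p / snd p + l)) (Y ** eproj A (fst p) ** X ** eproj W (snd p))))"
    by (simp only: tau_sum[OF mem_intros(5)[OF mem]])
  thus ?thesis by (simp add: tau_cscale[OF mem] cong: sum.cong)
qed

lemma tau_resolv_self:
  assumes "pd A" "A \<in> M" "pd W" "W \<in> M" "X \<in> M"
  shows "ip X (resolv A W X l) = of_real (\<Sum>p\<in>eigs A \<times> eigs W. wt A W X p / (fst p / snd p + l))"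
proof -
  have "ip X (resolv A W X l) = (\<Sum>p\<in>eigs A \<times> eigs W. \<tau> (madj X ** eproj A (fst p) ** X ** eproj W (snd p)) / of_real (fst p / snd p + l))"
    unfolding ip_def by (rule tau_resolv) (use assms in auto)
  also have "\<dots> = (\<Sum>p\<in>eigs A \<times> eigs W. of_real (wt A W X p / (fst p / snd p + l)))"
    using wt_tau[OF assms] by (intro sum.cong refl) (auto simp only: of_real_divide mem_Times_iff prod.collapse)
  finally show ?thesis by (simp only: of_real_sum)
qed

lemma tau_ratio_power:
  assumes "pd A" "A \<in> M" "pd W" "W \<in> M" "X \<in> M" "Y \<in> M"
  shows "\<tau> (Y ** mpow A z ** X ** mpow W (- z))
    = (\<Sum>p\<in>eigs A \<times> eigs W. \<tau> (Y ** eproj A (fst p) ** X ** eproj W (snd p)) * of_real (fst p / snd p) powr z)"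
proof -
  have "of_real c powr z * of_real d powr (- z) = complex_of_real (c / d) powr z" if "c > 0" "d > 0" for c d
    using that by (simp add: powr_def Ln_of_real ln_div exp_add[symmetric] algebra_simps flip: of_real_divide)
  thus ?thesis unfolding two_sided_expand[OF assms] case_prod_unfold
    using pd_eigs[OF assms(1)] pd_eigs[OF assms(3)] by (intro sum.cong refl) (auto simp: mem_Times_iff)
qed

end

subsection \<open>Recovery by the rotated Petz map\<close>

locale recovery = traced_algebra M \<tau> for M :: "'n::finite cmat set" and \<tau> +
  fixes N E and \<rho> \<sigma> :: "'n cmat"
  assumes N: "star_subalg N" and NM: "N \<subseteq> M" and E: "cond_exp M N \<tau> E"
    and rho: "faithful_state M \<tau> \<rho>" and sigma: "faithful_state M \<tau> \<sigma>"
begin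

sublocale N: traced_algebra N \<tau>
proof
  show "faithful_trace N \<tau>" using tr NM unfolding faithful_trace_def by blast
qed (rule N)

lemma N_sub [simp]: "x \<in> N \<Longrightarrow> x \<in> M" using NM by blast

lemma E_in [simp]: "x \<in> M \<Longrightarrow> E x \<in> N"
  and E_add: "x \<in> M \<Longrightarrow> y \<in> M \<Longrightarrow> E (x + y) = E x + E y"
  and E_cscale: "x \<in> M \<Longrightarrow> E (cscale c x) = cscale c (E x)"
  and E_id: "y \<in> N \<Longrightarrow> E y = y"
  and E_bimod: "a \<in> N \<Longrightarrow> b \<in> N \<Longrightarrow> x \<in> M \<Longrightarrow> E (a ** x ** b) = a ** E x ** b"
  and E_psd: "x \<in> M \<Longrightarrow> psd x \<Longrightarrow> psd (E x)"
  and tau_E: "x \<in> M \<Longrightarrow> \<tau> (E x) = \<tau> x"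
  using E unfolding cond_exp_def by blast+

lemma E_left: "a \<in> N \<Longrightarrow> x \<in> M \<Longrightarrow> E (a ** x) = a ** E x"
  using E_bimod[of a "mat 1" x] by simp
lemma E_right: "b \<in> N \<Longrightarrow> x \<in> M \<Longrightarrow> E (x ** b) = E x ** b"
  using E_bimod[of "mat 1" b x] by simp
lemma E_diff: "x \<in> M \<Longrightarrow> y \<in> M \<Longrightarrow> E (x - y) = E x - E y"
  using E_add[of x "cscale (-1) y"] E_cscale[of y "-1"] by (simp add: cscale_minus)

lemma tau_E_left: "y \<in> N \<Longrightarrow> x \<in> M \<Longrightarrow> \<tau> (y ** E x) = \<tau> (y ** x)"
  using tau_E[of "y ** x"] by (simp add: E_left)
lemma tau_E_right: "y \<in> N \<Longrightarrow> x \<in> M \<Longrightarrow> \<tau> (E x ** y) = \<tau> (x ** y)"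
  using tau_E[of "x ** y"] by (simp add: E_right)

text \<open>Compatibility with adjoints is not among the clauses of \<open>cond_exp\<close>. It
  follows from the trace: both sides have the same pairing with every element of N, and the trace is
  faithful.\<close>

lemma E_madj: assumes x: "x \<in> M" shows "E (madj x) = madj (E x)"
proof -
  define d where "d = E (madj x) - madj (E x)"
  have d: "d \<in> N" using x by (simp add: d_def)
  have z: "\<tau> (d ** y) = 0" if y: "y \<in> N" for y
  proof -
    have "\<tau> (madj (E x) ** y) = cnj (\<tau> (madj y ** E x))"
      using tau_madj[of "madj y ** E x"] x y by simp
    also have "\<dots> = cnj (\<tau> (madj y ** x))" using x y by (simp add: tau_E_left)
    also have "\<dots> = \<tau> (madj x ** y)" using tau_madj[of "madj y ** x"] x y by simp
    finally show ?thesis using x y by (simp add: d_def mm_distribs tau_diff tau_E_right)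
  qed
  have "\<tau> (madj d ** d) = 0" using z[of "madj d"] d tau_comm[of d "madj d"] by simp
  hence "d = 0" using tau_pos[of d] d by fastforce
  thus ?thesis by (simp add: d_def)
qed

lemma pd_rho: "pd \<rho>" and rho_M [simp]: "\<rho> \<in> M" and tau_rho: "\<tau> \<rho> = 1"
  and pd_sigma: "pd \<sigma>" and sigma_M [simp]: "\<sigma> \<in> M" and tau_sigma: "\<tau> \<sigma> = 1"
  using rho sigma pd_psd_invertible unfolding faithful_state_def by blast+

text \<open>x dominates its smallest eigenvalue c0 times the identity; positivity of E transports
  this to E x.\<close>

lemma pd_E: assumes x: "pd x" "x \<in> M" shows "pd (E x)"
proof -
  note h = pd_madj[OF x(1)]
  define c0 where "c0 = Min (eigs x)"
  have fin: "finite (eigs x)" "eigs x \<noteq> {}" using finite_eigs[OF h] eigs_nonempty[OF h] by auto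
  have c0: "c0 > 0" "\<And>c. c \<in> eigs x \<Longrightarrow> c0 \<le> c" unfolding c0_def using fin pd_eigs[OF x(1)] by auto
  define B where "B = (\<Sum>c\<in>eigs x. cscale (of_real (sqrt (c - c0))) (eproj x c))"
  have mB: "madj B = B" unfolding B_def madj_sum by (intro sum.cong refl) (auto simp: madj_eproj[OF h])
  have "madj B ** B = (\<Sum>c\<in>eigs x. cscale (of_real c) (eproj x c) - cscale (of_real c0) (eproj x c))"
    unfolding mB unfolding B_def eig_sum_mult[OF h]
    using c0(2) by (intro sum.cong refl) (simp add: cscale_diff_left[symmetric] flip: of_real_mult of_real_diff)
  also have "\<dots> = x - cscale (of_real c0) (mat 1)"
    unfolding sum_subtractf cscale_sum[symmetric] eproj_sum[OF h] using eigs_decomp[OF h] by simp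
  finally have e: "x - cscale (of_real c0) (mat 1) = madj B ** B" by simp
  have m1: "cscale c (mat 1) \<in> M" for c by simp
  have "psd (E (x - cscale (of_real c0) (mat 1)))"
    using x m1 by (intro E_psd) (simp, unfold e, rule psd_madj_mult)
  hence ps: "psd (E x - cscale (of_real c0) (mat 1))" using x by (simp add: E_diff E_cscale E_id)
  show ?thesis
  proof (rule pdI)
    show "madj (E x) = E x" using E_madj[OF x(2)] h by simp
    fix w c assume w: "w \<noteq> 0" "E x *v w = of_real c *s w"
    have "0 \<le> Re (cip w ((E x - cscale (of_real c0) (mat 1)) *v w))" using ps by (simp add: psd_iff)
    also have "(E x - cscale (of_real c0) (mat 1)) *v w = of_real (c - c0) *s w"
      by (simp add: matrix_vector_mult_diff_rdistrib w cscale_vec vector_sub_rdistrib)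
    also have "Re (cip w (of_real (c - c0) *s w)) = (c - c0) * (norm w)\<^sup>2"
      unfolding cip_scale cip_self by (simp only: of_real_mult[symmetric] Re_complex_of_real)
    finally have "c \<ge> c0" using w(1) by (simp add: zero_le_mult_iff)
    thus "c > 0" using c0 by simp
  qed
qed

definition "\<rho>N = E \<rho>"
definition "\<sigma>N = E \<sigma>"

lemma pd_rhoN: "pd \<rho>N" and rhoN_N [simp]: "\<rho>N \<in> N" and tau_rhoN: "\<tau> \<rho>N = 1"
  and pd_sigmaN: "pd \<sigma>N" and sigmaN_N [simp]: "\<sigma>N \<in> N" and tau_sigmaN: "\<tau> \<sigma>N = 1"
  using pd_E pd_rho pd_sigma tau_E tau_rho tau_sigma by (auto simp: \<rho>N_def \<sigma>N_def)

lemmas pds = pd_rho pd_sigma pd_rhoN pd_sigmaN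

lemma tau_sigma_N: "y \<in> N \<Longrightarrow> \<tau> (\<sigma> ** y) = \<tau> (\<sigma>N ** y)"
  by (simp add: \<sigma>N_def tau_E_right)
lemma tau_rho_N: "y \<in> N \<Longrightarrow> \<tau> (\<rho> ** y) = \<tau> (\<rho>N ** y)"
  by (simp add: \<rho>N_def tau_E_right)

end

section \<open>The isometry from N to M and the resolvent estimate for a density W in N\<close>

context recovery
begin

lemma minus_it: "- (\<i> * complex_of_real t) - 1/2 = - (1/2) - \<i> * complex_of_real t" by simp

lemmas alg = mmult_assoc mpow_mult mpow_mult_assoc madj_mpow mpow_1

text \<open>Left multiplication by elements of \<open>N\<close> on \<open>v0\<close> is an isometry for the trace inner products, and it maps \<open>xi\<close> to
  \<open>a0\<close>; \<open>Om\<close> is the density that makes this intertwine \<open>x \<mapsto> \<sigma>N x W^(-1)\<close> with \<open>x \<mapsto> \<sigma> x Om^(-1)\<close> as forms.\<close>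

definition "v0 = mpow \<rho>N (-1/2) ** mpow \<rho> (1/2)"
definition "vi = mpow \<rho> (-1/2) ** mpow \<rho>N (1/2)"

lemma v0_M [simp]: "v0 \<in> M" "vi \<in> M" by (auto simp: v0_def vi_def pds)

lemma v0_inv: "v0 ** vi = mat 1" "vi ** v0 = mat 1"
  by (simp_all add: v0_def vi_def alg pds)

text \<open>v0 v0^* = \<open>\<rho>N\<close>^(-1/2) \<rho> \<open>\<rho>N\<close>^(-1/2), and E maps
  this to the identity.\<close>

lemma tau_v0: assumes x: "x \<in> N" shows "\<tau> (madj v0 ** x ** v0) = \<tau> x"
proof -
  have "\<tau> (madj v0 ** x ** v0) = \<tau> (v0 ** madj v0 ** x)"
    using x tau_comm[of "madj v0 ** x" v0] by (simp add: mmult_assoc)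
  also have "v0 ** madj v0 ** x = mpow \<rho>N (-1/2) ** (\<rho> ** (mpow \<rho>N (-1/2) ** x))"
    by (simp add: v0_def alg pds)
  also have "\<tau> \<dots> = \<tau> (\<rho> ** (mpow \<rho>N (-1/2) ** x ** mpow \<rho>N (-1/2)))"
    using x tau_comm[of "mpow \<rho>N (-1/2)" "\<rho> ** (mpow \<rho>N (-1/2) ** x)"] by (simp add: mmult_assoc pds)
  also have "\<dots> = \<tau> (\<rho>N ** (mpow \<rho>N (-1/2) ** x ** mpow \<rho>N (-1/2)))"
    using x by (intro tau_rho_N) (simp add: pds)
  also have "\<dots> = \<tau> ((\<rho>N ** mpow \<rho>N (-1/2) ** x) ** mpow \<rho>N (-1/2))" by (simp add: mmult_assoc)
  also have "\<dots> = \<tau> (mpow \<rho>N (-1/2) ** (\<rho>N ** mpow \<rho>N (-1/2) ** x))"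
    using x by (intro tau_comm) (simp_all add: pds)
  also have "mpow \<rho>N (-1/2) ** (\<rho>N ** mpow \<rho>N (-1/2) ** x) = mpow \<rho>N (-1/2) ** (mpow \<rho>N 1 ** (mpow \<rho>N (-1/2) ** x))"
    by (simp add: mmult_assoc mpow_1 pds)
  also have "\<dots> = x" by (simp add: alg pds del: mpow_1)
  finally show ?thesis .
qed

definition "a0 = mpow \<rho> (1/2)"
definition "xi = mpow \<rho>N (1/2)"

lemma a0_xi: "a0 \<in> M" "xi \<in> N" "xi ** v0 = a0" "madj a0 = a0" "madj xi = xi" "\<tau> (a0 ** a0) = 1" "\<tau> (xi ** xi) = 1"
  using tau_rho tau_rhoN by (simp_all add: a0_def xi_def v0_def alg pds)

context
  fixes W assumes WN: "W \<in> N" and pdW: "pd W" and tauW: "\<tau> W = 1"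
begin

definition "Om = madj v0 ** W ** v0"

lemma Om_M [simp]: "Om \<in> M" using WN by (simp add: Om_def)

lemma pd_Om: "pd Om"
proof -
  have "(vi ** mpow W (-1/2)) ** (mpow W (1/2) ** v0) = vi ** (mpow W (-1/2) ** mpow W (1/2)) ** v0"
    by (simp add: mmult_assoc)
  also have "\<dots> = mat 1" using pdW v0_inv by (simp add: mpow_mult)
  finally have "pd (madj (mpow W (1/2) ** v0) ** (mpow W (1/2) ** v0))" by (rule pd_madj_mult)
  moreover have "madj (mpow W (1/2) ** v0) ** (mpow W (1/2) ** v0) = Om"
    using pdW by (simp add: Om_def alg)
  ultimately show ?thesis by simp
qed

lemma tau_Om: "\<tau> Om = 1" using tau_v0[OF WN] tauW by (simp add: Om_def)

lemma Om_inv: "mpow Om (-1) = vi ** mpow W (-1) ** madj vi"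
proof -
  have adj: "madj v0 ** madj vi = mat 1" "madj vi ** madj v0 = mat 1"
    using v0_inv by (metis madj_simps(1,3))+
  have "W ** mpow W (-1) = mat 1" using mpow_mult[OF pdW, of 1 "-1"] pdW by (simp add: mpow_1)
  hence "Om ** (vi ** mpow W (-1) ** madj vi) = mat 1"
    using adj v0_inv unfolding Om_def by (metis matrix_mul_assoc matrix_mul_rid)
  hence "mpow Om (-1) ** (Om ** (vi ** mpow W (-1) ** madj vi)) = mpow Om (-1)" by simp
  moreover have "mpow Om (-1) ** (Om ** X) = X" for X
    using mpow_mult[OF pd_Om, of "-1" 1] pd_Om by (simp add: matrix_mul_assoc mpow_1)
  ultimately show ?thesis by metis
qed

lemma v0_Om_v0: "v0 ** mpow Om (-1) ** madj v0 = mpow W (-1)"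
proof -
  have adj: "madj v0 ** madj vi = mat 1" "madj vi ** madj v0 = mat 1"
    using v0_inv by (metis madj_simps(1,3))+
  show ?thesis unfolding Om_inv using adj v0_inv by (metis matrix_mul_assoc matrix_mul_rid matrix_mul_lid)
qed

lemmas pdm = pdW pd_Om pds WN N_sub[OF WN] a0_xi(1,2) N_sub[OF a0_xi(2)]

text \<open>Write D for x -> \<sigma> x Om^(-1). Completing the square, the value of the form of D +
  l at w = p v0 - q is Re <a0, q> - Re <xi, p>. It dominates the form of D alone, which is the
  left-hand side.\<close>

lemma resolvent_gap_bound:
  assumes l: "l > 0"
  defines "p \<equiv> N.resolv \<sigma>N W xi l" and "q \<equiv> resolv \<sigma> Om a0 l"
  shows "(n2 (mpow \<sigma> (1/2) ** (p ** v0 - q) ** mpow Om (-1/2)))\<^sup>2 \<le> Re (ip a0 q) - Re (ip xi p)"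
proof -
  define w where "w = p ** v0 - q"
  have pN: "p \<in> N" unfolding p_def by (intro N.resolv_mem) (simp_all add: pdm)
  have qM: "q \<in> M" unfolding q_def by (intro resolv_mem) (simp_all add: pdm)
  have pM [simp]: "p \<in> M" "p ** v0 \<in> M" using pN by auto
  have wM: "w \<in> M" using pM qM by (simp add: w_def)
  have Oi: "mpow Om (-1) \<in> M" by (simp add: pdm)
  have peq: "\<sigma>N ** p ** mpow W (-1) + cscale (of_real l) p = xi"
    unfolding p_def by (rule N.resolv_eq) (simp_all add: pdm l)
  have qeq: "\<sigma> ** q ** mpow Om (-1) + cscale (of_real l) q = a0"
    unfolding q_def by (rule resolv_eq) (simp_all add: pdm l)
  \<comment> \<open>D + l applied to p v0.\<close>
  define T where "T = \<sigma> ** (p ** v0) ** mpow Om (-1) + cscale (of_real l) (p ** v0)"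
  have TM: "T \<in> M" using pM Oi by (simp add: T_def)
  have Dw: "\<sigma> ** w ** mpow Om (-1) + cscale (of_real l) w = T - a0"
    unfolding T_def qeq[symmetric] w_def by (simp add: mm_distribs cscale_diff)
  have e1: "ip w (\<sigma> ** w ** mpow Om (-1)) = of_real ((n2 (mpow \<sigma> (1/2) ** w ** mpow Om (-1/2)))\<^sup>2)"
  proof -
    let ?u = "mpow \<sigma> (1/2) ** w ** mpow Om (-1/2)"
    have uM: "?u \<in> M" using wM by (simp add: pdm)
    have "of_real ((n2 ?u)\<^sup>2) = \<tau> (madj ?u ** ?u)" using ip_self(1)[OF uM] by (simp add: ip_def)
    also have "madj ?u ** ?u = mpow Om (-1/2) ** (madj w ** (\<sigma> ** w ** mpow Om (-1/2)))"
      by (simp add: alg pdm)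
    also have "\<tau> \<dots> = \<tau> ((madj w ** (\<sigma> ** w ** mpow Om (-1/2))) ** mpow Om (-1/2))"
      using wM by (intro tau_comm) (simp_all add: pdm)
    also have "(madj w ** (\<sigma> ** w ** mpow Om (-1/2))) ** mpow Om (-1/2) = madj w ** (\<sigma> ** w ** mpow Om (-1))"
      by (simp add: alg pdm)
    finally show ?thesis by (simp add: ip_def)
  qed
  \<comment> \<open>The compression property: v0 Om^(-1) v0^* = W^(-1) and E \<sigma> =
    \<open>\<sigma>N\<close> turn the form on M at p v0 into the form on N at p, where the resolvent
    equation applies.\<close>
  have i1: "ip (p ** v0) T = ip p xi"
  proof -
    have "ip (p ** v0) (\<sigma> ** (p ** v0) ** mpow Om (-1)) = \<tau> ((madj v0 ** (madj p ** \<sigma> ** p ** v0 ** mpow Om (-1))))"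
      by (simp add: ip_def mmult_assoc)
    also have "\<dots> = \<tau> ((madj p ** \<sigma> ** p ** v0 ** mpow Om (-1)) ** madj v0)"
      using pM Oi by (intro tau_comm) simp_all
    also have "(madj p ** \<sigma> ** p ** v0 ** mpow Om (-1)) ** madj v0 = madj p ** (\<sigma> ** p ** (v0 ** mpow Om (-1) ** madj v0))"
      by (simp add: mmult_assoc)
    also have "\<tau> \<dots> = \<tau> ((\<sigma> ** p ** mpow W (-1)) ** madj p)"
      unfolding v0_Om_v0 using pM by (intro tau_comm) (simp_all add: pdm)
    also have "\<dots> = \<tau> (\<sigma> ** (p ** mpow W (-1) ** madj p))" by (simp add: mmult_assoc)
    also have "\<dots> = \<tau> (\<sigma>N ** (p ** mpow W (-1) ** madj p))"
      using pN by (intro tau_sigma_N) (simp add: pdm)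
    also have "\<dots> = \<tau> ((\<sigma>N ** p ** mpow W (-1)) ** madj p)" by (simp add: mmult_assoc)
    also have "\<dots> = \<tau> (madj p ** (\<sigma>N ** p ** mpow W (-1)))"
      using pM by (intro tau_comm) (simp_all add: pdm)
    finally have t1: "ip (p ** v0) (\<sigma> ** (p ** v0) ** mpow Om (-1)) = ip p (\<sigma>N ** p ** mpow W (-1))" by (simp add: ip_def)
    have t2: "ip (p ** v0) (p ** v0) = ip p p"
      using tau_v0[of "madj p ** p"] pN by (simp add: ip_def mmult_assoc)
    have mm: "\<sigma> ** (p ** v0) ** mpow Om (-1) \<in> M" "cscale (of_real l) (p ** v0) \<in> M"
       "\<sigma>N ** p ** mpow W (-1) \<in> M" "cscale (of_real l) p \<in> M" using pM Oi by (simp_all add: pdm)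
    have "ip (p ** v0) T = ip (p ** v0) (\<sigma> ** (p ** v0) ** mpow Om (-1)) + of_real l * ip (p ** v0) (p ** v0)"
      unfolding T_def by (simp only: ip_add pM mm)
    also have "\<dots> = ip p (\<sigma>N ** p ** mpow W (-1) + cscale (of_real l) p)"
      unfolding t1 t2 by (simp only: ip_add pM mm)
    finally show ?thesis unfolding peq .
  qed
  have i2: "ip (p ** v0) a0 = ip p xi"
    using tau_v0[of "madj p ** xi"] pN a0_xi by (simp add: ip_def mmult_assoc)
  have i3: "ip q T = ip a0 (p ** v0)"
  proof -
    have "madj a0 = mpow Om (-1) ** madj q ** \<sigma> + cscale (of_real l) (madj q)"
      unfolding qeq[symmetric] using pd_madj[OF pd_sigma] by (simp add: madj_mpow pd_Om mmult_assoc)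
    hence "ip a0 (p ** v0) = \<tau> (mpow Om (-1) ** (madj q ** \<sigma> ** (p ** v0)) + cscale (of_real l) (madj q ** (p ** v0)))"
      by (simp add: ip_def mm_distribs mmult_assoc)
    also have "\<dots> = \<tau> (mpow Om (-1) ** (madj q ** \<sigma> ** (p ** v0))) + of_real l * \<tau> (madj q ** (p ** v0))"
      using pM qM Oi by (subst tau_add) (simp_all add: tau_cscale)
    also have "\<tau> (mpow Om (-1) ** (madj q ** \<sigma> ** (p ** v0))) = \<tau> ((madj q ** \<sigma> ** (p ** v0)) ** mpow Om (-1))"
      using pM qM Oi by (intro tau_comm) simp_all
    also have "\<tau> ((madj q ** \<sigma> ** (p ** v0)) ** mpow Om (-1)) + of_real l * \<tau> (madj q ** (p ** v0)) = ip q T"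
      unfolding ip_def T_def mm.add_right using pM qM Oi
      by (subst tau_add) (simp_all add: tau_cscale mmult_assoc)
    finally show ?thesis by simp
  qed
  have r1: "ip a0 (p ** v0) = cnj (ip p xi)" using ip_cnj[OF pM(2) a0_xi(1)] i2 by simp
  have s1: "ip p xi = cnj (ip xi p)" using ip_cnj[of xi p] pM a0_xi by simp
  have s2: "ip q a0 = cnj (ip a0 q)" using ip_cnj[of a0 q] qM a0_xi by simp
  have "ip w (T - a0) = ip (p ** v0) T - ip (p ** v0) a0 - (ip q T - ip q a0)"
    unfolding w_def using pM qM TM a0_xi(1) by (simp only: ip_add mem_intros) (simp add: algebra_simps)
  also have "\<dots> = cnj (ip a0 q) - ip xi p" unfolding i1 i2 i3 r1 s2 s1 by simp
  finally have "Re (ip w (T - a0)) = Re (ip a0 q) - Re (ip xi p)" by simp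
  moreover have "ip w (T - a0) = ip w (\<sigma> ** w ** mpow Om (-1)) + of_real l * ip w w"
    unfolding Dw[symmetric] using wM Oi by (simp add: ip_add)
  moreover have "Re (of_real l * ip w w) \<ge> 0" using ip_self_nonneg[OF wM] l by simp
  ultimately have "(n2 (mpow \<sigma> (1/2) ** w ** mpow Om (-1/2)))\<^sup>2 \<le> Re (ip a0 q) - Re (ip xi p)"
    unfolding e1 by simp
  thus ?thesis unfolding w_def .
qed

lemma gap_locale:
  "spectral_gap (eigs \<sigma> \<times> eigs Om) (eigs \<sigma>N \<times> eigs W) (\<lambda>p. fst p / snd p) (wt \<sigma> Om a0) (\<lambda>p. fst p / snd p) (wt \<sigma>N W xi)"
proof
  show "finite (eigs \<sigma> \<times> eigs Om)" "finite (eigs \<sigma>N \<times> eigs W)"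
    by (simp_all add: finite_eigs[OF pd_madj] pdm)
  show "i \<in> eigs \<sigma> \<times> eigs Om \<Longrightarrow> 0 < fst i / snd i" for i
    using pd_eigs[OF pd_sigma] pd_eigs[OF pd_Om] by (auto simp: mem_Times_iff)
  show "i \<in> eigs \<sigma>N \<times> eigs W \<Longrightarrow> 0 < fst i / snd i" for i
    using pd_eigs[OF pd_sigmaN] pd_eigs[OF pdW] by (auto simp: mem_Times_iff)
  show "sum (wt \<sigma> Om a0) (eigs \<sigma> \<times> eigs Om) = 1" using sum_wt[of \<sigma> Om a0] a0_xi by (simp add: pdm)
  show "sum (wt \<sigma>N W xi) (eigs \<sigma>N \<times> eigs W) = 1" using N.sum_wt[of \<sigma>N W xi] a0_xi by (simp add: pdm WN)
qed (simp_all add: wt_nonneg)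

interpretation G: spectral_gap "eigs \<sigma> \<times> eigs Om" "eigs \<sigma>N \<times> eigs W" "\<lambda>p. fst p / snd p" "wt \<sigma> Om a0"
  "\<lambda>p. fst p / snd p" "wt \<sigma>N W xi"
  by (rule gap_locale)

lemma h_eq: "G.h l = Re (ip a0 (resolv \<sigma> Om a0 l)) - Re (ip xi (N.resolv \<sigma>N W xi l))"
  using tau_resolv_self[of \<sigma> Om a0 l] N.tau_resolv_self[of \<sigma>N W xi l] WN
  by (simp add: G.h_def pdm del: of_real_sum)

lemma h_nonneg: "l > 0 \<Longrightarrow> G.h l \<ge> 0"
  unfolding h_eq using resolvent_gap_bound[of l] by (meson order_trans zero_le_power2)

definition "bvec t = mpow \<sigma> (1/2) ** (mpow \<sigma>N (-1/2 + \<i> * of_real t) ** xi ** mpow W (- (-1/2 + \<i> * of_real t)) ** v0) ** mpow Om (-1/2)"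
definition "avec t = mpow \<sigma> (\<i> * of_real t) ** a0 ** mpow Om (- (\<i> * of_real t))"

lemma vec_M: "bvec t \<in> M" "avec t \<in> M" by (simp_all add: bvec_def avec_def pdm)

text \<open>Up to the unitary \<open>\<sigma>^(i t)\<close>, \<open>avec t\<close> and \<open>bvec t\<close> are square roots of \<open>\<rho>\<close> and of
  \<open>R\<^sup>t(\<rho>N)\<close>.\<close>

lemma dvec_bound:
  fixes \<beta> D t q r C :: real
  assumes "-1 < \<beta>" "\<beta> < 1" "\<beta> \<noteq> 0" "0 < D" "D < 1" "G.gap \<beta> \<le> D" "r > 0"
    and "\<And>l. l > 0 \<Longrightarrow> G.h l \<le> q" "\<And>l. l > 0 \<Longrightarrow> G.h l \<le> C\<^sup>2 * l powr (- 1 - 2 * r)" "C \<ge> 0"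
  shows "n2 (bvec t - avec t) \<le> cosh (pi * t) / pi * (2 * sqrt q * sqrt D + C / r * D powr r
         + sqrt (2 * ln (1 / D) * (pi / sin (pi * \<bar>\<beta>\<bar>)) * D powr (1 - \<bar>\<beta>\<bar>)))"
proof -
  \<comment> \<open>The scalar estimate is applied to the pairing with the difference vector
    \<open>d\<close> itself, whose norm plays the role of \<open>N\<close>; one factor
    \<open>n2 d\<close> cancels at the end.\<close>
  define d where "d = bvec t - avec t"
  have dM: "d \<in> M" using vec_M by (simp add: d_def)
  \<comment> \<open>\<open>Y1\<close> represents x -> <d, \<sigma>^(1/2) x Om^(-1/2)> through the
    trace, and \<open>Y2\<close> the same functional at x v0.\<close>
  define Y1 where "Y1 = mpow Om (-1/2) ** madj d ** mpow \<sigma> (1/2)"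
  define Y2 where "Y2 = v0 ** Y1"
  have YM: "Y1 \<in> M" "Y2 \<in> M" using dM by (simp_all add: Y1_def Y2_def pdm)
  let ?B = "2 * sqrt q * sqrt D + C / r * D powr r + sqrt (2 * ln (1 / D) * (pi / sin (pi * \<bar>\<beta>\<bar>)) * D powr (1 - \<bar>\<beta>\<bar>))"
  let ?b = "\<lambda>p. \<tau> (Y2 ** eproj \<sigma>N (fst p) ** xi ** eproj W (snd p))"
  let ?a = "\<lambda>p. \<tau> (Y1 ** eproj \<sigma> (fst p) ** a0 ** eproj Om (snd p))"
  have cyc: "\<tau> (Y1 ** x) = \<tau> (madj d ** (mpow \<sigma> (1/2) ** x ** mpow Om (-1/2)))" if "x \<in> M" for x
    using tau_comm[of "mpow Om (-1/2)" "madj d ** (mpow \<sigma> (1/2) ** x)"] that dM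
    by (simp add: Y1_def mmult_assoc pdm)
  have cyc2: "\<tau> (Y2 ** x) = \<tau> (Y1 ** (x ** v0))" if "x \<in> M" for x
    using tau_comm[of v0 "Y1 ** x"] that YM by (simp add: Y2_def mmult_assoc)
  have "norm ((\<Sum>p\<in>eigs \<sigma>N \<times> eigs W. ?b p * of_real (fst p / snd p) powr (-1/2 + \<i> * t)) - (\<Sum>p\<in>eigs \<sigma> \<times> eigs Om. ?a p * of_real (fst p / snd p) powr (-1/2 + \<i> * t)))
    \<le> cosh (pi * t) / pi * n2 d * ?B"
  proof (rule G.resolvent_transfer_bound[OF assms(1-7) h_nonneg assms(8-10)])
    show "n2 d \<ge> 0" using dM by simp
    fix l :: real assume l: "l > 0"
    let ?p = "N.resolv \<sigma>N W xi l" and ?q = "resolv \<sigma> Om a0 l"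
    have pM: "?p \<in> M" using N.resolv_mem[of \<sigma>N W xi l] by (simp add: pdm WN a0_xi)
    have qM: "?q \<in> M" by (intro resolv_mem) (simp_all add: pdm)
    have "(\<Sum>p\<in>eigs \<sigma>N \<times> eigs W. ?b p / of_real (fst p / snd p + l)) = \<tau> (Y2 ** ?p)"
      by (subst tau_resolv) (simp_all add: pdm YM)
    moreover have "(\<Sum>p\<in>eigs \<sigma> \<times> eigs Om. ?a p / of_real (fst p / snd p + l)) = \<tau> (Y1 ** ?q)"
      by (subst tau_resolv) (simp_all add: pdm YM)
    moreover have "\<tau> (Y2 ** ?p) - \<tau> (Y1 ** ?q) = ip d (mpow \<sigma> (1/2) ** (?p ** v0 - ?q) ** mpow Om (-1/2))"
    proof -
      have m: "?p ** v0 \<in> M" "?p ** v0 - ?q \<in> M" using pM qM by simp_all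
      have "\<tau> (Y2 ** ?p) - \<tau> (Y1 ** ?q) = \<tau> (Y1 ** (?p ** v0 - ?q))"
        unfolding cyc2[OF pM] mm.diff_right using YM m qM by (simp add: tau_diff)
      thus ?thesis unfolding cyc[OF m(2)] ip_def .
    qed
    moreover have "norm (ip d (mpow \<sigma> (1/2) ** (?p ** v0 - ?q) ** mpow Om (-1/2))) \<le> n2 d * sqrt (G.h l)"
    proof -
      have uM: "mpow \<sigma> (1/2) ** (?p ** v0 - ?q) ** mpow Om (-1/2) \<in> M" using pM qM by (simp add: pdm)
      have "n2 (mpow \<sigma> (1/2) ** (?p ** v0 - ?q) ** mpow Om (-1/2)) \<le> sqrt (G.h l)"
        using resolvent_gap_bound[OF l] unfolding h_eq by (rule real_le_rsqrt)
      thus ?thesis using cauchy_schwarz[OF dM uM] mult_left_mono[OF _ n2_nonneg[OF dM]] by (meson order_trans)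
    qed
    ultimately show "norm ((\<Sum>p\<in>eigs \<sigma>N \<times> eigs W. ?b p / of_real (fst p / snd p + l)) - (\<Sum>p\<in>eigs \<sigma> \<times> eigs Om. ?a p / of_real (fst p / snd p + l))) \<le> n2 d * sqrt (G.h l)"
      by simp
  qed
  also have "(\<Sum>p\<in>eigs \<sigma>N \<times> eigs W. ?b p * of_real (fst p / snd p) powr (-1/2 + \<i> * t)) = \<tau> (madj d ** bvec t)"
  proof -
    have "(\<Sum>p\<in>eigs \<sigma>N \<times> eigs W. ?b p * of_real (fst p / snd p) powr (-1/2 + \<i> * t)) = \<tau> (Y2 ** (mpow \<sigma>N (-1/2 + \<i> * t) ** xi ** mpow W (- (-1/2 + \<i> * t))))"
      using tau_ratio_power[of \<sigma>N W xi Y2 "-1/2 + \<i> * t"] YM by (simp add: pdm mmult_assoc)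
    also have "\<dots> = \<tau> (Y1 ** ((mpow \<sigma>N (-1/2 + \<i> * t) ** xi ** mpow W (- (-1/2 + \<i> * t))) ** v0))"
      by (rule cyc2) (simp add: pdm)
    also have "\<dots> = \<tau> (madj d ** bvec t)"
      by (subst cyc) (simp_all add: pdm mmult_assoc bvec_def)
    finally show ?thesis .
  qed
  also have "(\<Sum>p\<in>eigs \<sigma> \<times> eigs Om. ?a p * of_real (fst p / snd p) powr (-1/2 + \<i> * t)) = \<tau> (madj d ** avec t)"
  proof -
    have "(\<Sum>p\<in>eigs \<sigma> \<times> eigs Om. ?a p * of_real (fst p / snd p) powr (-1/2 + \<i> * t)) = \<tau> (Y1 ** (mpow \<sigma> (-1/2 + \<i> * t) ** a0 ** mpow Om (- (-1/2 + \<i> * t))))"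
      using tau_ratio_power[of \<sigma> Om a0 Y1 "-1/2 + \<i> * t"] YM by (simp add: pdm mmult_assoc)
    also have "\<dots> = \<tau> (madj d ** avec t)"
      by (subst cyc) (simp_all add: pdm alg avec_def)
    finally show ?thesis .
  qed
  finally have "norm (\<tau> (madj d ** bvec t) - \<tau> (madj d ** avec t)) \<le> cosh (pi * t) / pi * n2 d * ?B" .
  moreover have "\<tau> (madj d ** bvec t) - \<tau> (madj d ** avec t) = of_real ((n2 d)\<^sup>2)"
    using ip_self(1)[OF dM] vec_M dM by (simp add: ip_def tau_diff[symmetric] mm.diff_right[symmetric] d_def[symmetric])
  ultimately have "n2 d * n2 d \<le> n2 d * (cosh (pi * t) / pi * ?B)" 
    by (simp add: power2_eq_square mult_ac norm_mult)
  moreover have "?B \<ge> 0"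
  proof -
    have "G.h 1 \<ge> 0" "G.h 1 \<le> q" using h_nonneg assms(8) by auto
    hence "q \<ge> 0" by linarith
    thus ?thesis using assms by (intro add_nonneg_nonneg mult_nonneg_nonneg divide_nonneg_nonneg real_sqrt_ge_zero sin_ge_zero) auto
  qed
  hence B0: "0 \<le> cosh (pi * t) / pi * ?B" by (intro mult_nonneg_nonneg) auto
  ultimately have "n2 d \<le> cosh (pi * t) / pi * ?B"
  proof (cases "n2 d = 0")
    case False
    hence "n2 d > 0" using n2_nonneg[OF dM] by simp
    thus ?thesis using \<open>n2 d * n2 d \<le> _\<close> by (rule mult_left_le_imp_le[rotated])
  qed (use B0 in simp)
  thus ?thesis by (simp add: d_def)
qed

text \<open>The powers of W cancel against v0 Om^(-1) v0^* = W^(-1). Therefore the recovered state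
  does not depend on the auxiliary density.\<close>

lemma bvec_sq: "bvec t ** madj (bvec t) = mpow \<sigma> (1/2) ** mpow \<sigma>N (-1/2 + \<i> * of_real t) ** \<rho>N ** mpow \<sigma>N (-1/2 - \<i> * of_real t) ** mpow \<sigma> (1/2)"
proof -
  have "bvec t ** madj (bvec t) = mpow \<sigma> (1/2) ** mpow \<sigma>N (-1/2 + \<i> * of_real t) ** xi ** mpow W (- (-1/2 + \<i> * of_real t))
     ** (v0 ** mpow Om (-1) ** madj v0) ** mpow W (- (-1/2 - \<i> * of_real t)) ** xi ** mpow \<sigma>N (-1/2 - \<i> * of_real t) ** mpow \<sigma> (1/2)"
    by (simp add: bvec_def alg pdm a0_xi algebra_simps minus_it)
  also have "\<dots> = mpow \<sigma> (1/2) ** mpow \<sigma>N (-1/2 + \<i> * of_real t) ** (xi ** xi) ** mpow \<sigma>N (-1/2 - \<i> * of_real t) ** mpow \<sigma> (1/2)"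
    unfolding v0_Om_v0 by (simp add: alg pdm)
  also have "xi ** xi = \<rho>N" by (simp add: xi_def alg pdm)
  finally show ?thesis .
qed

lemma avec_sq: "avec t ** madj (avec t) = mpow \<sigma> (\<i> * of_real t) ** \<rho> ** mpow \<sigma> (- \<i> * of_real t)"
proof -
  have "avec t ** madj (avec t) = mpow \<sigma> (\<i> * of_real t) ** (a0 ** a0) ** mpow \<sigma> (- \<i> * of_real t)"
    by (simp add: avec_def alg pdm a0_xi)
  also have "a0 ** a0 = \<rho>" by (simp add: a0_def alg pdm)
  finally show ?thesis .
qed

lemma n2_vec: "n2 (avec t) = 1" "n2 (bvec t) = 1"
proof -
  have "\<tau> (avec t ** madj (avec t)) = \<tau> (\<rho> ** (mpow \<sigma> (- \<i> * of_real t) ** mpow \<sigma> (\<i> * of_real t)))"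
    unfolding avec_sq using tau_comm[of "mpow \<sigma> (\<i> * of_real t)" "\<rho> ** mpow \<sigma> (- \<i> * of_real t)"] by (simp add: pdm mmult_assoc)
  also have "\<dots> = 1" by (simp add: alg pdm tau_rho)
  finally have "n2 (madj (avec t)) = 1" by (intro n2_eq_1I) (simp_all add: vec_M)
  thus "n2 (avec t) = 1" using n2_madj[OF vec_M(2)] by simp
  let ?z = "-1/2 + \<i> * complex_of_real t" and ?z' = "-1/2 - \<i> * complex_of_real t"
  have "\<tau> (bvec t ** madj (bvec t)) = \<tau> (mpow \<sigma> (1/2) ** (mpow \<sigma>N ?z ** \<rho>N ** mpow \<sigma>N ?z' ** mpow \<sigma> (1/2)))"
    unfolding bvec_sq by (simp add: mmult_assoc)
  also have "\<dots> = \<tau> ((mpow \<sigma>N ?z ** \<rho>N ** mpow \<sigma>N ?z' ** mpow \<sigma> (1/2)) ** mpow \<sigma> (1/2))"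
    by (rule tau_comm) (simp_all add: pdm)
  also have "\<dots> = \<tau> ((mpow \<sigma>N ?z ** \<rho>N ** mpow \<sigma>N ?z') ** \<sigma>)" by (simp add: alg pdm)
  also have "\<dots> = \<tau> (\<sigma> ** (mpow \<sigma>N ?z ** \<rho>N ** mpow \<sigma>N ?z'))" by (rule tau_comm) (simp_all add: pdm)
  also have "\<dots> = \<tau> (\<sigma>N ** (mpow \<sigma>N ?z ** \<rho>N ** mpow \<sigma>N ?z'))" by (rule tau_sigma_N) (simp add: pdm)
  also have "\<dots> = \<tau> (mpow \<sigma>N 1 ** mpow \<sigma>N ?z ** \<rho>N ** mpow \<sigma>N ?z')" by (simp add: mmult_assoc mpow_1 pdm)
  also have "\<dots> = \<tau> (mpow \<sigma>N (1 + ?z) ** (\<rho>N ** mpow \<sigma>N ?z'))" by (simp add: mmult_assoc mpow_mult_assoc pdm)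
  also have "\<dots> = \<tau> ((\<rho>N ** mpow \<sigma>N ?z') ** mpow \<sigma>N (1 + ?z))" by (rule tau_comm) (simp_all add: pdm)
  also have "\<dots> = 1" by (simp add: mmult_assoc mpow_mult pdm tau_rhoN)
  finally have "n2 (madj (bvec t)) = 1" by (intro n2_eq_1I) (simp_all add: vec_M)
  thus "n2 (bvec t) = 1" using n2_madj[OF vec_M(1)] by simp
qed

lemma petz_bvec: "petz_rot E \<sigma> t \<rho>N = mpow \<sigma> (- \<i> * of_real t) ** (bvec t ** madj (bvec t)) ** mpow \<sigma> (\<i> * of_real t)"
proof -
  have e: "E \<sigma> = \<sigma>N" by (simp add: \<sigma>N_def)
  show ?thesis unfolding petz_rot_def bvec_sq e by (simp add: alg pdm algebra_simps)
qed

lemma rho_avec: "\<rho> = mpow \<sigma> (- \<i> * of_real t) ** (avec t ** madj (avec t)) ** mpow \<sigma> (\<i> * of_real t)"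
  unfolding avec_sq by (simp add: alg pdm)

text \<open>Conjugation by \<sigma>^(i t) replaces X by Z and the two states by a a^* and b b^*. As
  Z is self-adjoint, the real part of the difference is that of -(b - a)(a + b)^*, and a, b have
  norm 1. The second bound holds since each state pairs with Z to at most 1.\<close>

lemma recovery_trace:
  assumes X: "X \<in> M" "madj X = X" "X ** X = mat 1"
  shows "Re (\<tau> (X ** (\<rho> - petz_rot E \<sigma> t \<rho>N))) \<le> 2 * n2 (bvec t - avec t)"
    and "Re (\<tau> (X ** (\<rho> - petz_rot E \<sigma> t \<rho>N))) \<le> 2"
proof -
  define a b where "a = avec t" and "b = bvec t"
  have ab: "a \<in> M" "b \<in> M" "n2 a = 1" "n2 b = 1" using vec_M n2_vec by (auto simp: a_def b_def)
  define Z where "Z = mpow \<sigma> (\<i> * of_real t) ** X ** mpow \<sigma> (- \<i> * of_real t)"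
  have Z: "Z \<in> M" "madj Z = Z" using X by (simp_all add: Z_def pdm alg)
  have "Z ** Z = mpow \<sigma> (\<i> * of_real t) ** (X ** X) ** mpow \<sigma> (- \<i> * of_real t)" by (simp add: Z_def alg pdm)
  hence ZZ: "madj Z ** Z = mat 1" unfolding X(3) Z(2) by (simp add: alg pdm)
  have conj: "\<tau> (X ** (mpow \<sigma> (- \<i> * of_real t) ** Y ** mpow \<sigma> (\<i> * of_real t))) = \<tau> (Z ** Y)" if "Y \<in> M" for Y
    using tau_comm[of "X ** (mpow \<sigma> (- \<i> * of_real t) ** Y)" "mpow \<sigma> (\<i> * of_real t)"] that X
    by (simp add: Z_def mmult_assoc pdm)
  have diff: "\<tau> (X ** (\<rho> - petz_rot E \<sigma> t \<rho>N)) = \<tau> (Z ** (a ** madj a)) - \<tau> (Z ** (b ** madj b))"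
  proof -
    have pM: "petz_rot E \<sigma> t \<rho>N \<in> M" unfolding petz_bvec using vec_M by (simp add: pdm)
    have "\<tau> (X ** (\<rho> - petz_rot E \<sigma> t \<rho>N)) = \<tau> (X ** \<rho>) - \<tau> (X ** petz_rot E \<sigma> t \<rho>N)"
      using X pM by (simp add: mm_distribs tau_diff)
    thus ?thesis unfolding petz_bvec
      using rho_avec[of t] conj[of "a ** madj a"] conj[of "b ** madj b"] ab by (simp add: a_def b_def)
  qed
  have n: "norm (\<tau> (Z ** (x ** madj y))) \<le> n2 x * n2 y" if "x \<in> M" "y \<in> M" for x y
    using tau_mult_bound[of "Z ** x" "madj y"] that Z n2_left_isometry[OF ZZ, of x] by (simp add: mmult_assoc n2_madj)
  have "Re (\<tau> (Z ** (a ** madj a)) - \<tau> (Z ** (b ** madj b))) \<le> norm (\<tau> (Z ** (a ** madj a))) + norm (\<tau> (Z ** (b ** madj b)))"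
    by (metis complex_Re_le_cmod norm_triangle_ineq4 order_trans)
  also have "\<dots> \<le> 2" using n[OF ab(1,1)] n[OF ab(2,2)] ab by simp
  finally show "Re (\<tau> (X ** (\<rho> - petz_rot E \<sigma> t \<rho>N))) \<le> 2" unfolding diff .
  have "Re (\<tau> (Z ** (a ** madj b))) = Re (\<tau> (Z ** (b ** madj a)))"
  proof -
    have "\<tau> (Z ** (a ** madj b)) = cnj (\<tau> (madj (Z ** (a ** madj b))))"
      using tau_madj[of "madj (Z ** (a ** madj b))"] Z(1) ab by simp
    also have "madj (Z ** (a ** madj b)) = (b ** madj a) ** Z" using Z by (simp add: mmult_assoc)
    also have "\<tau> \<dots> = \<tau> (Z ** (b ** madj a))" using Z(1) ab by (intro tau_comm) auto
    finally show ?thesis by simp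
  qed
  hence "Re (\<tau> (Z ** (a ** madj a)) - \<tau> (Z ** (b ** madj b))) = - Re (\<tau> (Z ** ((b - a) ** madj (a + b))))"
    using Z(1) ab by (simp add: mm_distribs tau_add tau_diff)
  also have "\<dots> \<le> norm (\<tau> (Z ** ((b - a) ** madj (a + b))))"
    using abs_Re_le_cmod[of "\<tau> (Z ** ((b - a) ** madj (a + b)))"] by linarith
  also have "\<dots> \<le> n2 (b - a) * n2 (a + b)" using ab by (intro n) auto
  also have "\<dots> \<le> n2 (b - a) * 2" using n2_triangle[of a b] ab by (intro mult_left_mono) auto
  finally show "Re (\<tau> (X ** (\<rho> - petz_rot E \<sigma> t \<rho>N))) \<le> 2 * n2 (bvec t - avec t)"
    unfolding diff by (simp add: a_def b_def)
qed

end

end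

section \<open>The sandwiched quantities as moments, and the case of exponents up to 2\<close>

context recovery
begin

definition "Aop b = a0 ** mpow \<sigma> (of_real b) ** a0"
definition "AN b = xi ** mpow \<sigma>N (of_real b) ** xi"

lemma pd_Aop: "pd (Aop b)" and pd_AN: "pd (AN b)"
  and Aop_M [simp]: "Aop b \<in> M" and AN_N [simp]: "AN b \<in> N"
proof -
  have "(mpow \<rho> (-1/2) ** mpow \<sigma> (of_real (- b/2))) ** (mpow \<sigma> (of_real (b/2)) ** a0) = mat 1"
    by (simp add: a0_def alg pds)
  from pd_madj_mult[OF this] show "pd (Aop b)" by (simp add: a0_def Aop_def alg pds)
  have "(mpow \<rho>N (-1/2) ** mpow \<sigma>N (of_real (- b/2))) ** (mpow \<sigma>N (of_real (b/2)) ** xi) = mat 1"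
    by (simp add: xi_def alg pds)
  from pd_madj_mult[OF this] show "pd (AN b)" by (simp add: xi_def AN_def alg pds)
qed (use a0_xi in \<open>simp_all add: Aop_def AN_def pds\<close>)

text \<open>These are the \<alpha>-th powers of the two sandwiched quantities, since -1/\<alpha>' =
  1/\<alpha> - 1.\<close>

definition "PM \<alpha> = Re (\<tau> (mpow (Aop (1/\<alpha> - 1)) (of_real \<alpha>)))"
definition "PN \<alpha> = Re (\<tau> (mpow (AN (1/\<alpha> - 1)) (of_real \<alpha>)))"

lemma PM_pos: "PM \<alpha> > 0" and PN_pos: "PN \<alpha> > 0"
  using tau_mpow_pos[OF pd_Aop, of "1/\<alpha>-1" \<alpha>] N.tau_mpow_pos[OF pd_AN, of "1/\<alpha>-1" \<alpha>] by (simp_all add: PM_def PN_def)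

definition "WN \<alpha> = cscale (of_real (1 / PN \<alpha>)) (mpow (AN (1/\<alpha> - 1)) (of_real \<alpha>))"

lemma WN_N [simp]: "WN \<alpha> \<in> N" and pd_WN: "pd (WN \<alpha>)" and tau_WN: "\<tau> (WN \<alpha>) = 1"
  and mpow_WN: "mpow (WN \<alpha>) (of_real z) = cscale (of_real (PN \<alpha> powr (- z))) (mpow (AN (1/\<alpha> - 1)) (of_real (\<alpha> * z)))"
  unfolding WN_def PN_def by (rule N.normalized_mpow[OF pd_AN AN_N])+

text \<open>The first identity is the equality case of Hoelder's inequality. In the second, W^(-(1 +
  \<beta>)) is proportional to the inverse of \<open>AN \<beta>\<close>, which cancels and leaves
  the trace of \<open>\<sigma>N\<close>; this moment later supplies the tail constant.\<close>

lemma moments_N: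
  fixes \<alpha> :: real
  assumes \<alpha>: "\<alpha> > 0"
  defines "W \<equiv> WN \<alpha>" and "\<beta> \<equiv> 1/\<alpha> - 1"
  shows "(\<Sum>p\<in>eigs \<sigma>N \<times> eigs W. wt \<sigma>N W xi p * (fst p / snd p) powr \<beta>) = PN \<alpha> powr (1/\<alpha>)"
    and "(\<Sum>p\<in>eigs \<sigma>N \<times> eigs W. wt \<sigma>N W xi p * (fst p / snd p) powr (1 + \<beta>)) = PN \<alpha> powr (1/\<alpha>)"
proof -
  have m: "Re (\<tau> (xi ** mpow \<sigma>N (of_real b) ** xi ** mpow W (of_real (- b)))) = (\<Sum>p\<in>eigs \<sigma>N \<times> eigs W. wt \<sigma>N W xi p * (fst p / snd p) powr b)" for b
    using N.moment_ratio[of \<sigma>N W xi b] a0_xi by (simp add: pds W_def pd_WN)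
  have ab: "\<alpha> * - \<beta> = \<alpha> - 1" "\<alpha> * - (1 + \<beta>) = -1" using \<alpha> by (simp_all add: \<beta>_def field_simps)
  have AN1: "xi ** mpow \<sigma>N (of_real \<beta>) ** xi = mpow (AN \<beta>) 1" by (simp add: AN_def[symmetric] mpow_1 pd_AN)
  have "xi ** mpow \<sigma>N (of_real \<beta>) ** xi ** mpow W (of_real (- \<beta>)) = cscale (of_real (PN \<alpha> powr \<beta>)) (mpow (AN \<beta>) (of_real \<alpha>))"
    unfolding AN1 W_def mpow_WN ab \<beta>_def[symmetric] by (simp add: mpow_mult pd_AN)
  hence "Re (\<tau> (xi ** mpow \<sigma>N (of_real \<beta>) ** xi ** mpow W (of_real (- \<beta>)))) = PN \<alpha> powr \<beta> * PN \<alpha>"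
    unfolding PN_def[of \<alpha>] \<beta>_def using N.tau_cscale[of "mpow (AN (1/\<alpha> - 1)) (of_real \<alpha>)"] by (simp add: pd_AN)
  also have "\<dots> = PN \<alpha> powr (1/\<alpha>)"
    using PN_pos[of \<alpha>] powr_add[of "PN \<alpha>" \<beta> 1] by (simp add: \<beta>_def)
  finally show "(\<Sum>p\<in>eigs \<sigma>N \<times> eigs W. wt \<sigma>N W xi p * (fst p / snd p) powr \<beta>) = PN \<alpha> powr (1/\<alpha>)"
    unfolding m .
  have inv: "mpow (AN \<beta>) (-1) = mpow \<rho>N (-1/2) ** mpow \<sigma>N (of_real (- \<beta>)) ** mpow \<rho>N (-1/2)" (is "_ = ?Z")
  proof -
    have "AN \<beta> ** ?Z = mat 1" by (simp add: AN_def xi_def alg pds)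
    hence "mpow (AN \<beta>) (-1) ** (mpow (AN \<beta>) 1 ** ?Z) = mpow (AN \<beta>) (-1)" by (simp add: mpow_1 pd_AN)
    thus ?thesis by (simp add: mpow_mult_assoc pd_AN)
  qed
  have "xi ** mpow \<sigma>N (of_real (1 + \<beta>)) ** xi ** mpow W (of_real (- (1 + \<beta>)))
     = cscale (of_real (PN \<alpha> powr (1 + \<beta>))) (xi ** mpow \<sigma>N (of_real (1 + \<beta>)) ** xi ** mpow (AN \<beta>) (-1))"
    unfolding W_def mpow_WN ab \<beta>_def[symmetric] by (simp add: mmult_assoc add.commute)
  also have "xi ** mpow \<sigma>N (of_real (1 + \<beta>)) ** xi ** mpow (AN \<beta>) (-1) = xi ** (\<sigma>N ** mpow \<rho>N (-1/2))"
    unfolding inv by (simp add: xi_def alg pds)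
  finally have "\<tau> (xi ** mpow \<sigma>N (of_real (1 + \<beta>)) ** xi ** mpow W (of_real (- (1 + \<beta>)))) = of_real (PN \<alpha> powr (1 + \<beta>)) * \<tau> (xi ** (\<sigma>N ** mpow \<rho>N (-1/2)))"
    using a0_xi by (simp add: N.tau_cscale pds)
  also have "\<tau> (xi ** (\<sigma>N ** mpow \<rho>N (-1/2))) = \<tau> ((\<sigma>N ** mpow \<rho>N (-1/2)) ** xi)"
    using a0_xi by (intro N.tau_comm) (simp_all add: pds)
  also have "\<dots> = 1" by (simp add: xi_def alg pds tau_sigmaN)
  finally show "(\<Sum>p\<in>eigs \<sigma>N \<times> eigs W. wt \<sigma>N W xi p * (fst p / snd p) powr (1 + \<beta>)) = PN \<alpha> powr (1/\<alpha>)"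
    unfolding m[symmetric] by (simp add: \<beta>_def)
qed

lemma moment_M:
  assumes W: "W \<in> N" "pd W" "\<tau> W = 1"
  shows "(\<Sum>p\<in>eigs \<sigma> \<times> eigs (Om W). wt \<sigma> (Om W) a0 p * (fst p / snd p) powr b) = Re (\<tau> (Aop b ** mpow (Om W) (of_real (- b))))"
  using moment_ratio[of \<sigma> "Om W" a0 b] a0_xi W pd_Om[OF W] Om_M[OF W] by (simp add: pds Aop_def)

text \<open>\<open>q\<close> plays the role of \<open>Q_inf \<rho> \<sigma>\<close>; only this consequence of the operator norm is needed.\<close>

definition max_bound :: "real \<Rightarrow> bool" where
  "max_bound q \<longleftrightarrow> (\<forall>y\<in>M. Re (\<tau> (madj y ** Aop (-1) ** y)) \<le> q * Re (\<tau> (madj y ** y)))"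

text \<open>Cauchy-Schwarz for 1 = tr \<rho> = <\<sigma>^(1/2), \<sigma>^(-1/2) \<rho>>, followed by
  the assumption at y = \<open>a0\<close>, since a0 \<open>Aop (-1)\<close> a0 = \<rho>
  \<sigma>^(-1) \<rho>.\<close>

lemma max_bound_ge_1: assumes q: "max_bound q" shows "q \<ge> 1"
proof -
  let ?x = "mpow \<sigma> (1/2)" and ?y = "mpow \<sigma> (-1/2) ** \<rho>"
  have m: "?x \<in> M" "?y \<in> M" by (simp_all add: pds)
  have "n2 ?x = 1" by (intro n2_mpow_half pds) (simp_all add: tau_sigma)
  moreover have "?x ** ?y = \<rho>" by (simp add: alg pds)
  ultimately have "1 \<le> n2 ?y" using tau_mult_bound[OF m] by (simp add: tau_rho)
  hence "1 \<le> (n2 ?y)\<^sup>2" by simp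
  also have "\<dots> = Re (\<tau> (\<rho> ** (mpow \<sigma> (-1) ** \<rho>)))" unfolding n2_sq[OF m(2)] by (simp add: alg pds pd_madj)
  also have "\<rho> ** (mpow \<sigma> (-1) ** \<rho>) = madj a0 ** Aop (-1) ** a0"
  proof -
    have "a0 ** a0 = \<rho>" by (simp add: a0_def alg pds)
    thus ?thesis using a0_xi(4) by (simp add: Aop_def) (metis matrix_mul_assoc)
  qed
  also have "Re (\<tau> \<dots>) \<le> q * Re (\<tau> (madj a0 ** a0))" using q a0_xi unfolding max_bound_def by blast
  finally show ?thesis using a0_xi by simp
qed

text \<open>The moment is the trace of \<open>Aop (-1)\<close> against W, and the assumption is
  applied to y = W^(1/2).\<close>

lemma max_bound_moment:
  assumes q: "max_bound q" and W: "pd W" "W \<in> M" "\<tau> W = 1"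
  shows "(\<Sum>p\<in>eigs \<sigma> \<times> eigs W. wt \<sigma> W a0 p * (fst p / snd p) powr (-1)) \<le> q"
proof -
  let ?y = "mpow W (1/2)"
  have yM: "?y \<in> M" using W by simp
  have "complex_of_real (\<Sum>p\<in>eigs \<sigma> \<times> eigs W. wt \<sigma> W a0 p * (fst p / snd p) powr (-1)) = \<tau> (Aop (-1) ** W)"
    using moment_ratio[of \<sigma> W a0 "-1"] a0_xi W by (simp add: pds Aop_def mpow_1)
  hence "(\<Sum>p\<in>eigs \<sigma> \<times> eigs W. wt \<sigma> W a0 p * (fst p / snd p) powr (-1)) = Re (\<tau> (Aop (-1) ** W))"
    by (metis Re_complex_of_real)
  also have "\<dots> = Re (\<tau> (?y ** (Aop (-1) ** ?y)))"
    using tau_comm[of ?y "Aop (-1) ** ?y"] yM W by (simp add: mmult_assoc mpow_mult mpow_1)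
  also have "\<dots> = Re (\<tau> (madj ?y ** Aop (-1) ** ?y))" using W by (simp add: madj_mpow mmult_assoc)
  also have "\<dots> \<le> q * Re (\<tau> (madj ?y ** ?y))" using q yM unfolding max_bound_def by blast
  also have "madj ?y ** ?y = W" using W by (simp add: alg)
  finally show ?thesis using W by simp
qed

lemma resolvent_case:
  fixes \<alpha> \<epsilon> D q t :: real
  defines "s \<equiv> \<bar>1 - 1/\<alpha>\<bar>"
  assumes \<alpha>: "1/2 < \<alpha>" "\<alpha> \<noteq> 1" "\<alpha> \<le> 2" and q: "max_bound q"
    and D: "0 < D" "D < 1" "\<bar>PM \<alpha> powr (1/\<alpha>) - PN \<alpha> powr (1/\<alpha>)\<bar> \<le> D"
    and eps: "0 < \<epsilon>" "\<epsilon> < (1 - s) / 2"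
    and X: "X \<in> M" "madj X = X" "X ** X = mat 1"
  shows "pi / (2 * cosh (pi * t)) * Re (\<tau> (X ** (\<rho> - petz_rot E \<sigma> t \<rho>N)))
    \<le> (4 * sqrt q + sqrt (pi / (exp 1 * \<epsilon> * sin (pi * s))) + 4) * D powr ((1 - s) / 2 - \<epsilon>)"
proof -
  define W where "W = WN \<alpha>"
  have W: "W \<in> N" "pd W" "\<tau> W = 1" by (auto simp: W_def pd_WN tau_WN)
  interpret G: spectral_gap "eigs \<sigma> \<times> eigs (Om W)" "eigs \<sigma>N \<times> eigs W" "\<lambda>p. fst p / snd p" "wt \<sigma> (Om W) a0"
     "\<lambda>p. fst p / snd p" "wt \<sigma>N W xi"
    by (rule gap_locale[OF W])
  note Om = pd_Om[OF W] Om_M[OF W]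
  define \<beta> where "\<beta> = 1/\<alpha> - 1"
  have sb: "s = \<bar>\<beta>\<bar>" by (simp add: s_def \<beta>_def)
  have \<alpha>0: "\<alpha> > 0" using \<alpha> by simp
  have b: "-1 < \<beta>" "\<beta> < 1" "\<beta> \<noteq> 0" using \<alpha> by (auto simp: \<beta>_def field_simps)
  have s: "0 < s" "s < 1" using b by (auto simp: sb)
  define Q where "Q = PM \<alpha> powr (1/\<alpha>)"
  define QN where "QN = PN \<alpha> powr (1/\<alpha>)"
  have QNp: "QN > 0" using PN_pos[of \<alpha>] by (simp add: QN_def)
  note mN = moments_N[OF \<alpha>0, folded W_def \<beta>_def QN_def]
  note mM = moment_M[OF W]
  note hnn = h_nonneg[OF W]
  \<comment> \<open>For \<beta> < 0 Hoelder's inequality with weight 1/\<alpha> bounds the moment on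
    M by the quantity; for \<beta> > 0, with weight \<alpha>, it bounds the quantity by the moment.
    \<open>gap\<close> subtracts in opposite orders in the two cases, so both inequalities point the
    right way.\<close>
  have gap: "G.gap \<beta> \<le> D"
  proof (cases "\<beta> < 0")
    case True
    have "Re (\<tau> (mpow (Aop \<beta>) (of_real 1) ** mpow (Om W) (of_real (- \<beta>))))
       \<le> Re (\<tau> (mpow (Aop \<beta>) (of_real \<alpha>) ** mpow (Om W) (of_real 0))) powr (1/\<alpha>) * Re (\<tau> (mpow (Aop \<beta>) (of_real 0) ** mpow (Om W) (of_real 1))) powr (1 - 1/\<alpha>)"
      using True \<alpha>0 by (intro trace_holder Om pd_Aop Aop_M) (auto simp: \<beta>_def field_simps)
    hence "(\<Sum>p\<in>eigs \<sigma> \<times> eigs (Om W). wt \<sigma> (Om W) a0 p * (fst p / snd p) powr \<beta>) \<le> Q"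
      using Om unfolding mM by (simp add: mpow_1 pd_Aop tau_Om[OF W] Q_def PM_def \<beta>_def)
    thus ?thesis using True D(3) mN(1) by (simp add: G.gap_def Q_def[symmetric] QN_def[symmetric])
  next
    case False
    hence b0: "\<beta> > 0" "\<alpha> < 1" using b \<alpha> by (auto simp: \<beta>_def field_simps)
    have "Re (\<tau> (mpow (Aop \<beta>) (of_real \<alpha>) ** mpow (Om W) (of_real 0)))
       \<le> Re (\<tau> (mpow (Aop \<beta>) (of_real 1) ** mpow (Om W) (of_real (- \<beta>)))) powr \<alpha> * Re (\<tau> (mpow (Aop \<beta>) (of_real 0) ** mpow (Om W) (of_real 1))) powr (1 - \<alpha>)"
      using b0 \<alpha>0 by (intro trace_holder Om pd_Aop Aop_M) (auto simp: \<beta>_def field_simps)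
    hence P: "PM \<alpha> \<le> (\<Sum>p\<in>eigs \<sigma> \<times> eigs (Om W). wt \<sigma> (Om W) a0 p * (fst p / snd p) powr \<beta>) powr \<alpha>"
      using Om unfolding mM by (simp add: mpow_1 pd_Aop tau_Om[OF W] PM_def \<beta>_def)
    have nn: "(\<Sum>p\<in>eigs \<sigma> \<times> eigs (Om W). wt \<sigma> (Om W) a0 p * (fst p / snd p) powr \<beta>) \<ge> 0"
      by (intro sum_nonneg mult_nonneg_nonneg) (auto simp: wt_nonneg)
    have "Q \<le> ((\<Sum>p\<in>eigs \<sigma> \<times> eigs (Om W). wt \<sigma> (Om W) a0 p * (fst p / snd p) powr \<beta>) powr \<alpha>) powr (1/\<alpha>)"
      unfolding Q_def using PM_pos[of \<alpha>] \<alpha>0 P by (intro powr_mono2) auto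
    also have "\<dots> = (\<Sum>p\<in>eigs \<sigma> \<times> eigs (Om W). wt \<sigma> (Om W) a0 p * (fst p / snd p) powr \<beta>)"
      using nn \<alpha>0 by (simp add: powr_powr)
    finally show ?thesis using False D(3) mN(1) by (simp add: G.gap_def Q_def[symmetric] QN_def[symmetric])
  qed
  note xinv = max_bound_moment[OF q Om tau_Om[OF W]]
  have hq: "G.h l \<le> q" if "l > 0" for l
    using G.h_le_moment[OF that] xinv by linarith
  have q1: "q \<ge> 1" by (rule max_bound_ge_1[OF q])
  \<comment> \<open>The tail order is p = 2 r. For \<beta> < 0 it is p = 1 + \<beta> = 1 - s with
    C^2 = \<open>QN\<close>; for \<beta> > 0 a bound 1 on the first moment allows p = 1.\<close>
  have "\<exists>r C. r > 0 \<and> C \<ge> 0 \<and> (\<forall>l>0. G.h l \<le> C\<^sup>2 * l powr (- 1 - 2 * r))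
     \<and> ((r = 1/2 \<and> C = 1) \<or> (s \<le> 1/2 \<and> r = (1 - s) / 2 \<and> 0 \<le> C \<and> C\<^sup>2 \<le> q powr s))"
  proof (cases "\<beta> < 0")
    case True
    have s': "s = - \<beta>" using True sb by simp
    \<comment> \<open>Nonnegativity of \<open>h\<close> makes the gap nonnegative, so
      \<open>QN\<close> is at most the moment on M of order -s, which the power mean inequality
      bounds through the moment of order -1.\<close>
    have "QN \<le> q powr s"
    proof -
      have "0 \<le> pi / sin (pi * \<bar>\<beta>\<bar>) * G.gap \<beta>"
        unfolding has_bochner_integral_integral_eq[OF G.gap_integral[OF b], symmetric]
          using hnn by (intro Bochner_Integration.integral_nonneg) simp
      moreover have "sin (pi * \<bar>\<beta>\<bar>) > 0" using s by (intro sin_gt_zero) (auto simp: sb)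
      ultimately have "G.gap \<beta> \<ge> 0"
        using pi_gt_zero by (simp add: zero_le_divide_iff zero_le_mult_iff del: pi_gt_zero)
      hence "QN \<le> (\<Sum>p\<in>eigs \<sigma> \<times> eigs (Om W). wt \<sigma> (Om W) a0 p * (fst p / snd p) powr \<beta>)"
        using True mN(1) by (simp add: G.gap_def)
      also have "\<dots> = (\<Sum>p\<in>eigs \<sigma> \<times> eigs (Om W). wt \<sigma> (Om W) a0 p * ((fst p / snd p) powr (-1)) powr s)"
        by (simp only: powr_powr s') simp
      also have "\<dots> \<le> (\<Sum>p\<in>eigs \<sigma> \<times> eigs (Om W). wt \<sigma> (Om W) a0 p * (fst p / snd p) powr (-1)) powr s"
        using G.fin G.mnn G.msum s less_imp_neq[OF G.xpos] by (intro power_mean_le) (simp_all only: powr_gt_zero, auto)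
      also have "\<dots> \<le> q powr s"
        using xinv s by (intro powr_mono2) (auto intro!: sum_nonneg mult_nonneg_nonneg simp: wt_nonneg)
      finally show ?thesis .
    qed
    moreover have "s \<le> 1/2" using \<alpha> True by (simp add: s' \<beta>_def field_simps)
    moreover have "G.h l \<le> (sqrt QN)\<^sup>2 * l powr (- 1 - 2 * ((1 - s) / 2))" if "l > 0" for l
    proof -
      have "- 1 - 2 * ((1 - s) / 2) = - 1 - (1 + \<beta>)" by (simp add: s' field_simps)
      thus ?thesis using G.h_le_tail[OF that, of "1 + \<beta>"] b True mN(2) QNp by (simp only:) simp
    qed
    ultimately show ?thesis using s QNp by (intro exI[of _ "(1 - s) / 2"] exI[of _ "sqrt QN"]) auto
  next
    case False
    hence b0: "\<beta> > 0" using b by auto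
    have pm: "(\<Sum>p\<in>eigs \<sigma>N \<times> eigs W. wt \<sigma>N W xi p * (fst p / snd p) powr (\<theta> * (1 + \<beta>))) \<le> QN powr \<theta>" if "0 \<le> \<theta>" "\<theta> \<le> 1" for \<theta>
    proof -
      have "(\<Sum>p\<in>eigs \<sigma>N \<times> eigs W. wt \<sigma>N W xi p * (fst p / snd p) powr (\<theta> * (1 + \<beta>)))
         = (\<Sum>p\<in>eigs \<sigma>N \<times> eigs W. wt \<sigma>N W xi p * ((fst p / snd p) powr (1 + \<beta>)) powr \<theta>)"
        by (simp add: powr_powr mult.commute)
      also have "\<dots> \<le> (\<Sum>p\<in>eigs \<sigma>N \<times> eigs W. wt \<sigma>N W xi p * (fst p / snd p) powr (1 + \<beta>)) powr \<theta>"
        using G.fin G.nnn G.nsum that less_imp_neq[OF G.ypos] by (intro power_mean_le) (simp_all only: powr_gt_zero, auto)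
      finally show ?thesis unfolding mN(2) .
    qed
    have "\<beta> / (1 + \<beta>) * (1 + \<beta>) = \<beta>" using b0 by simp
    \<comment> \<open>The moments of orders \<beta> and 1 + \<beta> coincide, so the power mean
      inequality bounds \<open>QN\<close> by a power of itself with exponent below 1, which forces
      \<open>QN\<close> <= 1.\<close>
    hence "QN \<le> QN powr (\<beta> / (1 + \<beta>))" using pm[of "\<beta> / (1 + \<beta>)"] b0 mN(1) by simp
    hence "QN powr 1 \<le> QN powr (\<beta> / (1 + \<beta>))" using QNp by simp
    hence QN1: "QN \<le> 1"
    proof (rule contrapos_pp)
      assume "\<not> QN \<le> 1"
      thus "\<not> QN powr 1 \<le> QN powr (\<beta> / (1 + \<beta>))" using b0 by (auto simp only: powr_le_cancel_iff not_le) (simp add: field_simps)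
    qed
    have "1 / (1 + \<beta>) * (1 + \<beta>) = 1" using b0 by simp
    hence "(\<Sum>p\<in>eigs \<sigma>N \<times> eigs W. wt \<sigma>N W xi p * (fst p / snd p) powr 1) \<le> QN powr (1 / (1 + \<beta>))"
      using pm[of "1 / (1 + \<beta>)"] b0 by (simp only:) simp
    also have "\<dots> \<le> 1 powr (1 / (1 + \<beta>))" using QN1 QNp b0 by (intro powr_mono2) auto
    finally have "(\<Sum>p\<in>eigs \<sigma>N \<times> eigs W. wt \<sigma>N W xi p * (fst p / snd p) powr 1) \<le> 1" by simp
    hence "G.h l \<le> 1\<^sup>2 * l powr (- 1 - 2 * (1/2))" if "l > 0" for l
      using G.h_le_tail[OF that, of 1] mult_right_mono[of _ 1 "l powr (-2)"] by (fastforce intro: order_trans)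
    thus ?thesis by (intro exI[of _ "1/2"] exI[of _ "1::real"]) auto
  qed
  then obtain r C where rC: "r > 0" "C \<ge> 0" "\<And>l. l > 0 \<Longrightarrow> G.h l \<le> C\<^sup>2 * l powr (- 1 - 2 * r)"
     "(r = 1/2 \<and> C = 1) \<or> (s \<le> 1/2 \<and> r = (1 - s) / 2 \<and> 0 \<le> C \<and> C\<^sup>2 \<le> q powr s)" by blast
  have db: "n2 (bvec W t - avec W t) \<le> cosh (pi * t) / pi * (2 * sqrt q * sqrt D + C / r * D powr r
         + sqrt (2 * ln (1 / D) * (pi / sin (pi * s)) * D powr (1 - s)))"
    unfolding sb by (rule dvec_bound[OF W b D(1,2) gap rC(1) hq rC(3,2)])
  have ch: "cosh (pi * t) > 0" by simp
  have "pi / (2 * cosh (pi * t)) * Re (\<tau> (X ** (\<rho> - petz_rot E \<sigma> t \<rho>N))) \<le> pi / (2 * cosh (pi * t)) * (2 * n2 (bvec W t - avec W t))"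
    using recovery_trace(1)[OF W X, of t] ch by (intro mult_left_mono) auto
  also have "\<dots> \<le> pi / (2 * cosh (pi * t)) * (2 * (cosh (pi * t) / pi * (2 * sqrt q * sqrt D + C / r * D powr r
         + sqrt (2 * ln (1 / D) * (pi / sin (pi * s)) * D powr (1 - s)))))"
    using db ch by (intro mult_left_mono) auto
  also have "\<dots> = 2 * sqrt q * sqrt D + C / r * D powr r + sqrt (2 * ln (1 / D) * (pi / sin (pi * s)) * D powr (1 - s))"
    using ch by simp
  also have "\<dots> \<le> (4 * sqrt q + sqrt (pi / (exp 1 * \<epsilon> * sin (pi * s))) + 4) * D powr ((1 - s) / 2 - \<epsilon>)"
    by (rule resolvent_bound_numeric[OF q1 D(1,2) s eps rC(4)])
  finally show ?thesis .
qed

end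

lemma has_bochner_integral_le:
  fixes f g :: "_ \<Rightarrow> real"
  assumes "has_bochner_integral M f a" "has_bochner_integral M g b" "\<And>x. f x \<le> g x"
  shows "a \<le> b"
  using integral_mono[of M f g] assms unfolding has_bochner_integral_iff by auto

subsection \<open>Exponential sums and interpolation for large exponents\<close>

text \<open>Nonempty sums of terms exp(b z) C with real b. The class is closed under products and
  linear maps, contains the complex powers with affine exponent, and reduces holomorphy, boundedness
  on vertical strips and the Poisson formula to single exponentials.\<close>

inductive expsum :: "'n::finite cmat set \<Rightarrow> (complex \<Rightarrow> 'n cmat) \<Rightarrow> bool" for M where
  expsum_exp: "C \<in> M \<Longrightarrow> expsum M (\<lambda>z. cscale (exp (of_real b * z)) C)"
| expsum_add: "expsum M F \<Longrightarrow> expsum M G \<Longrightarrow> expsum M (\<lambda>z. F z + G z)"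

lemma expsum_const: "C \<in> M \<Longrightarrow> expsum M (\<lambda>z. C)"
  using expsum_exp[of C M 0] by simp

lemma expsum_mem: "expsum M F \<Longrightarrow> star_subalg M \<Longrightarrow> F z \<in> M"
  by (induction rule: expsum.induct) (auto intro: star_subalgD)

lemma expsum_mult:
  assumes M: "star_subalg M" and F: "expsum M F" and G: "expsum M G"
  shows "expsum M (\<lambda>z. F z ** G z)"
  using F
proof induction
  case (expsum_exp C b)
  show ?case using G
  proof induction
    case (expsum_exp C' b')
    show ?case
      using expsum.expsum_exp[OF star_subalgD(3)[OF M \<open>C \<in> M\<close> expsum_exp], of "b + b'"]
      by (simp add: ring_distribs exp_add mult_ac)
  qed (simp add: mm.add_right expsum_add)
qed (simp add: mm.add_left expsum_add)

lemma expsum_sum: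
  assumes "finite I" "I \<noteq> {}" "\<And>i. i \<in> I \<Longrightarrow> expsum M (f i)"
  shows "expsum M (\<lambda>z. \<Sum>i\<in>I. f i z)"
  using assms by (induction rule: finite_ne_induct) (auto intro: expsum_add)

lemma expsum_mpow:
  assumes M: "star_subalg M" and A: "pd A" "A \<in> M"
  shows "expsum M (\<lambda>z. mpow A (of_real a + of_real b * z))"
proof -
  note h = pd_madj[OF A(1)]
  have "expsum M (\<lambda>z. \<Sum>c\<in>eigs A. cscale (exp (of_real (b * ln c) * z)) (cscale (exp (of_real (a * ln c))) (eproj A c)))"
    using finite_eigs[OF h] eigs_nonempty[OF h] eproj_mem[OF h M A(2)] M
    by (intro expsum_sum expsum_exp star_subalgD)
  also have "(\<lambda>z. \<Sum>c\<in>eigs A. cscale (exp (of_real (b * ln c) * z)) (cscale (exp (of_real (a * ln c))) (eproj A c)))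
     = (\<lambda>z. mpow A (of_real a + of_real b * z))"
  proof
    fix z
    show "(\<Sum>c\<in>eigs A. cscale (exp (of_real (b * ln c) * z)) (cscale (exp (of_real (a * ln c))) (eproj A c))) = mpow A (of_real a + of_real b * z)"
      unfolding mpow_eigs[OF A(1)] cscale_simps mult_exp_exp
    proof (intro sum.cong refl)
      fix c assume "c \<in> eigs A"
      hence "c > 0" by (rule pd_eigs[OF A(1)])
      hence "complex_of_real c powr (of_real a + of_real b * z) = exp (of_real (b * ln c) * z + of_real (a * ln c))"
        by (simp add: powr_def Ln_of_real algebra_simps)
      thus "cscale (exp (of_real (b * ln c) * z + of_real (a * ln c))) (eproj A c) = cscale (complex_of_real c powr (of_real a + of_real b * z)) (eproj A c)"
        by simp
    qed
  qed
  finally show ?thesis .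
qed

lemma expsum_linear:
  assumes F: "expsum M F" and M: "star_subalg M"
    and "\<And>x. x \<in> M \<Longrightarrow> L x \<in> M'" "\<And>x y. x \<in> M \<Longrightarrow> y \<in> M \<Longrightarrow> L (x + y) = L x + L y"
    "\<And>c x. x \<in> M \<Longrightarrow> L (cscale c x) = cscale c (L x)"
  shows "expsum M' (\<lambda>z. L (F z))"
  using F
proof induction
  case (expsum_exp C b)
  thus ?case using expsum.expsum_exp[of "L C" M' b] assms by simp
qed (use expsum_mem[OF _ M] in \<open>simp add: assms expsum_add\<close>)

lemma expsum_diff:
  assumes M: "star_subalg M" and F: "expsum M F" and G: "expsum M G"
  shows "expsum M (\<lambda>z. F z - G z)"
proof -
  have "expsum M (\<lambda>z. cscale (-1) (G z))"
    by (rule expsum_linear[OF G M]) (auto simp: cscale_add mult_ac intro: star_subalgD[OF M])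
  from expsum_add[OF F this] show ?thesis by (simp add: cscale_minus)
qed

section \<open>Traces of exponential sums\<close>

context traced_algebra
begin

lemma tau_expsum_holomorphic: "expsum M F \<Longrightarrow> (\<lambda>z. \<tau> (F z)) holomorphic_on UNIV"
proof (induction rule: expsum.induct)
  case (expsum_exp C b)
  thus ?case by (simp add: tau_cscale) (intro holomorphic_intros)
next
  case (expsum_add F G)
  thus ?case using expsum_mem[OF _ M] by (simp add: tau_add holomorphic_on_add)
qed

lemma tau_expsum_bounded: "expsum M F \<Longrightarrow> \<exists>B. \<forall>z. \<bar>Re z\<bar> \<le> r \<longrightarrow> norm (\<tau> (F z)) \<le> B"
proof (induction rule: expsum.induct)
  case (expsum_exp C b)
  have "norm (\<tau> (cscale (exp (of_real b * z)) C)) \<le> exp (\<bar>b\<bar> * r) * norm (\<tau> C)" if "\<bar>Re z\<bar> \<le> r" for z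
  proof -
    have "b * Re z \<le> \<bar>b\<bar> * r" using mult_left_mono[OF that, of "\<bar>b\<bar>"] abs_le_D1[of "b * Re z" "\<bar>b\<bar> * r"] by (simp add: abs_mult)
    thus ?thesis using expsum_exp by (simp add: tau_cscale norm_mult mult_right_mono)
  qed
  thus ?case by blast
next
  case (expsum_add F G)
  then obtain B B' where "\<And>z. \<bar>Re z\<bar> \<le> r \<Longrightarrow> norm (\<tau> (F z)) \<le> B" "\<And>z. \<bar>Re z\<bar> \<le> r \<Longrightarrow> norm (\<tau> (G z)) \<le> B'" by blast
  hence "norm (\<tau> (F z + G z)) \<le> B + B'" if "\<bar>Re z\<bar> \<le> r" for z
    using that expsum_mem[OF expsum_add(1) M] expsum_mem[OF expsum_add(2) M] by (auto simp: tau_add intro: norm_triangle_mono)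
  thus ?case by blast
qed

lemma tau_expsum_poisson:
  "expsum M F \<Longrightarrow> has_bochner_integral lborel
     (\<lambda>v. (\<tau> (F (1/4 + \<i> * of_real v)) + \<tau> (F (- 1/4 + \<i> * of_real v))) / of_real (cosh (2 * pi * (v - t))))
     (\<tau> (F (\<i> * of_real t)))"
proof (induction rule: expsum.induct)
  case (expsum_exp C b)
  show ?case
    using has_bochner_integral_mult_left[OF poisson_quarter_strip[of b t], of "\<tau> C"]
    by (simp add: tau_cscale[OF expsum_exp] distrib_right add_divide_distrib)
next
  case (expsum_add F G)
  show ?case
    using has_bochner_integral_add[OF expsum_add(3,4)] expsum_mem[OF expsum_add(1) M] expsum_mem[OF expsum_add(2) M]
    by (simp add: tau_add add_divide_distrib add_ac)
qed

end

section \<open>An L2 contraction with remainder\<close>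

context recovery
begin

text \<open>\<open>f\<close> has constant norm on both lines \<open>Re w = \<plusminus> 1/4\<close>, so the Poisson formula turns \<open>f (\<i> t) - f 0\<close> into a variance.\<close>

lemma L2_contraction:
  fixes t :: real
  assumes h: "h \<in> M"
  defines "Y \<equiv> mpow \<sigma> (1/4) ** h ** mpow \<sigma> (1/4)"
  defines "k \<equiv> mpow \<sigma>N (-1/2) ** E Y ** mpow \<sigma>N (-1/2)"
  defines "f \<equiv> \<lambda>w. mpow \<sigma> (1/4 - w) ** mpow \<sigma>N w ** k ** mpow \<sigma>N (- w) ** mpow \<sigma> (1/4 + w)"
  shows "(1 + exp (2 * pi * \<bar>t\<bar>)) * ((n2 (mpow \<sigma>N (1/4) ** k ** mpow \<sigma>N (1/4)))\<^sup>2 - (n2 h)\<^sup>2) + (n2 (h - f (\<i> * of_real t)))\<^sup>2 \<le> 0"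
proof -
  have YM: "Y \<in> M" using h by (simp add: Y_def pds)
  have kN: "k \<in> N" using YM by (simp add: k_def pds)
  have kM: "k \<in> M" using kN by simp
  have fM: "f w \<in> M" for w using kM by (simp add: f_def pds)
  have EY: "E Y = mpow \<sigma>N (1/2) ** k ** mpow \<sigma>N (1/2)" by (simp add: k_def alg pds)
  define \<Lambda> where "\<Lambda> = exp (2 * pi * \<bar>t\<bar>)"
  define K where "K = (n2 (mpow \<sigma>N (1/4) ** k ** mpow \<sigma>N (1/4)))\<^sup>2"
  have K: "K = Re (\<tau> (madj k ** (mpow \<sigma>N (1/2) ** (k ** mpow \<sigma>N (1/2)))))"
  proof -
    have "\<tau> (madj (mpow \<sigma>N (1/4) ** k ** mpow \<sigma>N (1/4)) ** (mpow \<sigma>N (1/4) ** k ** mpow \<sigma>N (1/4)))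
      = \<tau> (mpow \<sigma>N (1/4) ** (madj k ** mpow \<sigma>N (1/2) ** k ** mpow \<sigma>N (1/4)))" by (simp add: alg pds)
    also have "\<dots> = \<tau> ((madj k ** mpow \<sigma>N (1/2) ** k ** mpow \<sigma>N (1/4)) ** mpow \<sigma>N (1/4))"
      using kM by (intro tau_comm) (simp_all add: pds)
    also have "\<dots> = \<tau> (madj k ** (mpow \<sigma>N (1/2) ** (k ** mpow \<sigma>N (1/2))))" by (simp add: alg pds)
    finally show ?thesis unfolding K_def using kM by (subst n2_sq) (simp_all add: pds)
  qed
  \<comment> \<open>On each line one outer power of \<sigma> becomes unitary and the other has
    modulus \<sigma>^(1/2). Under the trace the latter meets its adjoint as \<sigma>, which E
    replaces by \<open>\<sigma>N\<close>.\<close>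
  have bdry: "(n2 (f (1/4 + \<i> * of_real v)))\<^sup>2 = K" "(n2 (f (- 1/4 + \<i> * of_real v)))\<^sup>2 = K" for v :: real
  proof -
    let ?i = "\<i> * complex_of_real v"
    have "\<tau> (madj (f (1/4 + ?i)) ** f (1/4 + ?i))
       = \<tau> (mpow \<sigma> (1/2 - ?i) ** (mpow \<sigma>N (- (1/4) + ?i) ** madj k ** mpow \<sigma>N (1/2) ** k ** mpow \<sigma>N (- (1/4) - ?i) ** mpow \<sigma> (1/2 + ?i)))"
      by (simp add: f_def alg pds)
    also have "\<dots> = \<tau> ((mpow \<sigma>N (- (1/4) + ?i) ** madj k ** mpow \<sigma>N (1/2) ** k ** mpow \<sigma>N (- (1/4) - ?i) ** mpow \<sigma> (1/2 + ?i)) ** mpow \<sigma> (1/2 - ?i))"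
      using kM by (intro tau_comm) (simp_all add: pds)
    also have "\<dots> = \<tau> ((mpow \<sigma>N (- (1/4) + ?i) ** madj k ** mpow \<sigma>N (1/2) ** k ** mpow \<sigma>N (- (1/4) - ?i)) ** \<sigma>)" by (simp add: alg pds)
    also have "\<dots> = \<tau> (\<sigma> ** (mpow \<sigma>N (- (1/4) + ?i) ** madj k ** mpow \<sigma>N (1/2) ** k ** mpow \<sigma>N (- (1/4) - ?i)))"
      using kM by (intro tau_comm) (simp_all add: pds)
    also have "\<dots> = \<tau> (mpow \<sigma>N 1 ** (mpow \<sigma>N (- (1/4) + ?i) ** madj k ** mpow \<sigma>N (1/2) ** k ** mpow \<sigma>N (- (1/4) - ?i)))"
      unfolding mpow_1[OF pd_sigmaN] using kN by (intro tau_sigma_N) (simp add: pds)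
    also have "\<dots> = \<tau> (mpow \<sigma>N (3/4 + ?i) ** (madj k ** mpow \<sigma>N (1/2) ** k ** mpow \<sigma>N (- (1/4) - ?i)))"
      by (simp add: mmult_assoc mpow_mult_assoc pds)
    also have "\<dots> = \<tau> ((madj k ** mpow \<sigma>N (1/2) ** k ** mpow \<sigma>N (- (1/4) - ?i)) ** mpow \<sigma>N (3/4 + ?i))"
      using kM by (intro tau_comm) (simp_all add: pds)
    also have "\<dots> = \<tau> (madj k ** (mpow \<sigma>N (1/2) ** (k ** mpow \<sigma>N (1/2))))" by (simp add: alg pds)
    finally show "(n2 (f (1/4 + ?i)))\<^sup>2 = K" unfolding K by (simp add: n2_sq fM)
    have mi: "- ?i - 1/4 = - (1/4) - ?i" by simp
    have "\<tau> (madj (f (- 1/4 + ?i)) ** f (- 1/4 + ?i))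
       = \<tau> (mpow \<sigma> (- ?i) ** (mpow \<sigma>N (1/4 + ?i) ** madj k ** mpow \<sigma>N (- (1/4) - ?i) ** \<sigma> ** mpow \<sigma>N (- (1/4) + ?i) ** k ** mpow \<sigma>N (1/4 - ?i) ** mpow \<sigma> ?i))"
      by (simp add: f_def alg pds mi)
    also have "\<dots> = \<tau> ((mpow \<sigma>N (1/4 + ?i) ** madj k ** mpow \<sigma>N (- (1/4) - ?i) ** \<sigma> ** mpow \<sigma>N (- (1/4) + ?i) ** k ** mpow \<sigma>N (1/4 - ?i) ** mpow \<sigma> ?i) ** mpow \<sigma> (- ?i))"
      using kM by (intro tau_comm) (simp_all add: pds)
    also have "\<dots> = \<tau> ((mpow \<sigma>N (1/4 + ?i) ** madj k ** mpow \<sigma>N (- (1/4) - ?i)) ** (\<sigma> ** mpow \<sigma>N (- (1/4) + ?i) ** k ** mpow \<sigma>N (1/4 - ?i)))" by (simp add: alg pds)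
    also have "\<dots> = \<tau> ((\<sigma> ** mpow \<sigma>N (- (1/4) + ?i) ** k ** mpow \<sigma>N (1/4 - ?i)) ** (mpow \<sigma>N (1/4 + ?i) ** madj k ** mpow \<sigma>N (- (1/4) - ?i)))"
      using kM by (intro tau_comm) (simp_all add: pds)
    also have "\<dots> = \<tau> (\<sigma> ** (mpow \<sigma>N (- (1/4) + ?i) ** k ** mpow \<sigma>N (1/2) ** madj k ** mpow \<sigma>N (- (1/4) - ?i)))" by (simp add: alg pds)
    also have "\<dots> = \<tau> (mpow \<sigma>N 1 ** (mpow \<sigma>N (- (1/4) + ?i) ** k ** mpow \<sigma>N (1/2) ** madj k ** mpow \<sigma>N (- (1/4) - ?i)))"
      unfolding mpow_1[OF pd_sigmaN] using kN by (intro tau_sigma_N) (simp add: pds)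
    also have "\<dots> = \<tau> ((mpow \<sigma>N (3/4 + ?i) ** (k ** mpow \<sigma>N (1/2))) ** (madj k ** mpow \<sigma>N (- (1/4) - ?i)))"
      by (simp add: mmult_assoc mpow_mult_assoc pds)
    also have "\<dots> = \<tau> ((madj k ** mpow \<sigma>N (- (1/4) - ?i)) ** (mpow \<sigma>N (3/4 + ?i) ** (k ** mpow \<sigma>N (1/2))))"
      using kM by (intro tau_comm) (simp_all add: pds)
    also have "\<dots> = \<tau> (madj k ** (mpow \<sigma>N (1/2) ** (k ** mpow \<sigma>N (1/2))))" by (simp add: alg pds)
    finally show "(n2 (f (- 1/4 + ?i)))\<^sup>2 = K" unfolding K by (simp add: n2_sq fM)
  qed
  have pois: "has_bochner_integral lborel
      (\<lambda>v. Re (ip y (f (1/4 + \<i> * of_real v)) + ip y (f (- 1/4 + \<i> * of_real v))) / cosh (2 * pi * (v - u)))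
      (Re (ip y (f (\<i> * of_real u))))" if y: "y \<in> M" for y u
  proof -
    have "expsum M (\<lambda>w. madj y ** (mpow \<sigma> (of_real (1/4) + of_real (-1) * w) ** mpow \<sigma>N (of_real 0 + of_real 1 * w) ** k ** mpow \<sigma>N (of_real 0 + of_real (-1) * w) ** mpow \<sigma> (of_real (1/4) + of_real 1 * w)))"
      using kM y by (intro expsum_mult[OF M] expsum_mpow[OF M] expsum_const) (simp_all add: pds)
    hence "expsum M (\<lambda>w. madj y ** f w)" by (simp add: f_def)
    from has_bochner_integral_Re[OF tau_expsum_poisson[OF this, of u]] show ?thesis
      by (simp only: ip_def Re_divide_of_real)
  qed
  define f0 where "f0 = f 0"
  define d where "d = f (\<i> * of_real t) - f0"
  have f0M: "f0 \<in> M" "d \<in> M" using fM by (auto simp: f0_def d_def)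
  have expand: "(n2 (x - y))\<^sup>2 = (n2 x)\<^sup>2 + (n2 y)\<^sup>2 - 2 * Re (ip y x)" if "x \<in> M" "y \<in> M" for x y
  proof -
    have "complex_of_real ((n2 (x - y))\<^sup>2) = ip (x - y) (x - y)" using that by (simp only: ip_self(1) mem_intros)
    also have "\<dots> = ip x x - ip x y - (ip y x - ip y y)" using that by (simp add: ip_add)
    finally have "(n2 (x - y))\<^sup>2 = Re (ip x x - ip x y - (ip y x - ip y y))" by (metis Re_complex_of_real)
    thus ?thesis unfolding ip_cnj[OF that(2,1)] using that ip_self(1)[of x] ip_self(1)[of y] by (simp del: of_real_power)
  qed
  define g where "g = (\<lambda>v::real. (f (1/4 + \<i> * of_real v), f (- 1/4 + \<i> * of_real v)))"
  have gM: "fst (g v) \<in> M" "snd (g v) \<in> M" and gK: "(n2 (fst (g v)))\<^sup>2 = K" "(n2 (snd (g v)))\<^sup>2 = K" for v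
    using bdry fM by (auto simp: g_def)
  have pois': "has_bochner_integral lborel (\<lambda>v. Re (ip y (fst (g v)) + ip y (snd (g v))) / cosh (2 * pi * (v - u))) (Re (ip y (f (\<i> * of_real u))))" if "y \<in> M" for y u
    using pois[OF that, of u] by (simp add: g_def)
  define F0 where "F0 = (n2 f0)\<^sup>2"
  define dd where "dd = (n2 d)\<^sup>2"
  have ip_sq: "Re (ip x x) = (n2 x)\<^sup>2" if "x \<in> M" for x using ip_self(1)[OF that] by (simp del: of_real_power)
  \<comment> \<open>Sum of the squared distances of the two boundary values from \<open>f0\<close>,
    in expanded form. As the boundary norms are constant, its integral against the kernel at 0 is K
    - F0.\<close>
  define w where "w = (\<lambda>v. 2 * K + 2 * F0 - 2 * Re (ip f0 (fst (g v)) + ip f0 (snd (g v))))"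
  have w_eq: "w v = (n2 (fst (g v) - f0))\<^sup>2 + (n2 (snd (g v) - f0))\<^sup>2" for v
    unfolding w_def using expand[OF gM(1) f0M(1), of v] expand[OF gM(2) f0M(1), of v] by (simp add: gK F0_def)
  have sech: "has_bochner_integral lborel (\<lambda>v. c * (1 / cosh (2 * pi * (v - u)))) (c * (1 / 2))" for c u
    by (intro has_bochner_integral_mult_right) (rule sech_integral)
  have Iw: "has_bochner_integral lborel (\<lambda>v. (\<Lambda> / 2) * (w v / cosh (2 * pi * v))) (\<Lambda> / 2 * (K - F0))"
  proof (rule has_bochner_integral_mult_right)
    have "has_bochner_integral lborel (\<lambda>v. (2 * K + 2 * F0) * (1 / cosh (2 * pi * (v - 0))) - 2 * (Re (ip f0 (fst (g v)) + ip f0 (snd (g v))) / cosh (2 * pi * (v - 0))))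
       ((2 * K + 2 * F0) * (1 / 2) - 2 * Re (ip f0 (f (\<i> * of_real 0))))"
      by (intro has_bochner_integral_diff sech has_bochner_integral_mult_right pois' f0M)
    moreover have "Re (ip f0 (f (\<i> * of_real 0))) = F0" using ip_sq[OF f0M(1)] by (simp add: f0_def F0_def)
    ultimately show "has_bochner_integral lborel (\<lambda>v. w v / cosh (2 * pi * v)) (K - F0)"
      by (simp add: w_def diff_divide_distrib)
  qed
  have Iu: "has_bochner_integral lborel (\<lambda>v. dd * (1 / cosh (2 * pi * (v - t))) + (\<Lambda> / 2) * (w v / cosh (2 * pi * v))) (dd * (1/2) + \<Lambda> / 2 * (K - F0))"
    by (intro has_bochner_integral_add sech Iw)
  have Il: "has_bochner_integral lborel (\<lambda>v. Re (ip d (fst (g v)) + ip d (snd (g v))) / cosh (2 * pi * (v - t)) - 2 * Re (ip d f0) * (1 / cosh (2 * pi * (v - t))))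
     (Re (ip d (f (\<i> * of_real t))) - 2 * Re (ip d f0) * (1/2))"
    by (intro has_bochner_integral_diff sech pois' f0M)
  \<comment> \<open>On both lines <d, y - f0> <= dd/2 + |y - f0|^2/2. Each line has kernel mass 1/2,
    so the dd terms integrate to dd/2 and can be absorbed on the left; Harnack's inequality moves
    the kernel from t to 0.\<close>
  have "Re (ip d (f (\<i> * of_real t))) - 2 * Re (ip d f0) * (1/2) \<le> dd * (1/2) + \<Lambda> / 2 * (K - F0)"
  proof (rule has_bochner_integral_le[OF Il Iu])
    fix v
    have am: "Re (ip d y) - Re (ip d f0) \<le> dd / 2 + (n2 (y - f0))\<^sup>2 / 2" if "y \<in> M" for y
    proof -
      have "Re (ip d y) - Re (ip d f0) = Re (ip d (y - f0))" using that f0M by (simp add: ip_add)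
      also have "\<dots> \<le> n2 d * n2 (y - f0)"
        using complex_Re_le_cmod cauchy_schwarz[OF f0M(2), of "y - f0"] that f0M by (meson mem_intros order_trans)
      also have "\<dots> \<le> dd / 2 + (n2 (y - f0))\<^sup>2 / 2"
        using zero_le_power2[of "n2 d - n2 (y - f0)"] by (simp add: dd_def power2_eq_square algebra_simps)
      finally show ?thesis .
    qed
    have c: "cosh (2 * pi * (v - t)) > 0" "cosh (2 * pi * v) > 0" by simp_all
    have "Re (ip d (fst (g v)) + ip d (snd (g v))) - 2 * Re (ip d f0) \<le> dd + w v / 2"
      using am[OF gM(1)[of v]] am[OF gM(2)[of v]] unfolding w_eq plus_complex.sel add_divide_distrib by linarith
    hence "(Re (ip d (fst (g v)) + ip d (snd (g v))) - 2 * Re (ip d f0)) / cosh (2 * pi * (v - t)) \<le> (dd + w v / 2) / cosh (2 * pi * (v - t))"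
      using c by (intro divide_right_mono) auto
    also have "\<dots> = dd * (1 / cosh (2 * pi * (v - t))) + (w v / 2) * (1 / cosh (2 * pi * (v - t)))"
      by (simp add: add_divide_distrib)
    also have "\<dots> \<le> dd * (1 / cosh (2 * pi * (v - t))) + (w v / 2) * (\<Lambda> / cosh (2 * pi * v))"
      using cosh_shift_le[of v t] by (intro add_left_mono mult_left_mono) (auto simp: \<Lambda>_def w_eq)
    finally show "Re (ip d (fst (g v)) + ip d (snd (g v))) / cosh (2 * pi * (v - t)) - 2 * Re (ip d f0) * (1 / cosh (2 * pi * (v - t)))
        \<le> dd * (1 / cosh (2 * pi * (v - t))) + (\<Lambda> / 2) * (w v / cosh (2 * pi * v))"
      by (simp add: diff_divide_distrib mult_ac)
  qed
  moreover have "Re (ip d (f (\<i> * of_real t))) - 2 * Re (ip d f0) * (1/2) = dd"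
  proof -
    have "dd = Re (ip d (f (\<i> * of_real t) - f0))" unfolding dd_def d_def[symmetric] by (rule ip_sq[OF f0M(2), symmetric])
    thus ?thesis using f0M fM by (simp add: ip_add)
  qed
  ultimately have key: "dd \<le> \<Lambda> * (K - F0)" by simp
  \<comment> \<open>One factor \<sigma>^(1/4) of \<open>f0\<close> moves over to h and produces Y,
    and E Y is expressed by k. Hence |h|^2 - K = |h - f0|^2 + (K - F0), a sum of two controlled
    terms.\<close>
  have "ip f0 h = \<tau> (mpow \<sigma> (1/4) ** (madj k ** mpow \<sigma> (1/4) ** h))"
    by (simp add: ip_def f0_def f_def alg pds)
  also have "\<dots> = \<tau> ((madj k ** mpow \<sigma> (1/4) ** h) ** mpow \<sigma> (1/4))"
    using kM h by (intro tau_comm) (simp_all add: pds)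
  also have "\<dots> = \<tau> (madj k ** Y)" by (simp add: Y_def mmult_assoc)
  also have "\<dots> = \<tau> (madj k ** E Y)" using kN YM by (simp add: tau_E_left)
  finally have "Re (ip f0 h) = K" unfolding K EY by (simp add: mmult_assoc)
  hence hf: "(n2 (h - f0))\<^sup>2 = (n2 h)\<^sup>2 + F0 - 2 * K" using expand[OF h f0M(1)] by (simp add: F0_def)
  define p where "p = n2 (h - f0)"
  have L: "\<Lambda> > 0" by (simp add: \<Lambda>_def)
  have "n2 (h - f (\<i> * of_real t)) \<le> p + n2 d"
  proof -
    have "h - f (\<i> * of_real t) = (h - f0) + - d" by (simp add: d_def)
    also have "n2 \<dots> \<le> n2 (h - f0) + n2 (- d)" using h f0M by (intro n2_triangle) auto
    finally show ?thesis using f0M(2) by (simp add: p_def n2_minus)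
  qed
  hence "(n2 (h - f (\<i> * of_real t)))\<^sup>2 \<le> (p + n2 d)\<^sup>2" using h fM by (intro power_mono) auto
  \<comment> \<open>Cauchy-Schwarz with weights 1 and \<Lambda>, matched to dd <= \<Lambda> (K -
    F0).\<close>
  also have "\<dots> \<le> (1 + \<Lambda>) * (p\<^sup>2 + dd / \<Lambda>)"
  proof -
    have "0 \<le> (\<Lambda> * p - n2 d)\<^sup>2 / \<Lambda>" using L by simp
    also have "\<dots> = (1 + \<Lambda>) * (p\<^sup>2 + dd / \<Lambda>) - (p + n2 d)\<^sup>2"
      using L by (simp add: dd_def power2_eq_square field_simps)
    finally show ?thesis by simp
  qed
  also have "\<dots> \<le> (1 + \<Lambda>) * (p\<^sup>2 + (K - F0))"
    using key L by (intro mult_left_mono add_left_mono) (auto simp: field_simps)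
  finally show ?thesis using hf unfolding p_def K_def[symmetric] \<Lambda>_def[symmetric] by (simp add: algebra_simps)
qed

end

section \<open>Norms and traces of matrix powers\<close>

context traced_algebra
begin

lemma n2_right_isometry: "u \<in> M \<Longrightarrow> x \<in> M \<Longrightarrow> u ** madj u = mat 1 \<Longrightarrow> n2 (x ** u) = n2 x"
  using n2_left_isometry[of "madj u" "madj x"] n2_madj[of "x ** u"] n2_madj[of x] by simp

lemma n2_mpow_phase:
  assumes "pd A" "A \<in> M" "x \<in> M" "Re z = 0"
  shows "n2 (mpow A z ** x) = n2 x" "n2 (x ** mpow A z) = n2 x"
proof -
  have "cnj z = - z" using assms by (simp add: complex_eq_iff)
  thus "n2 (mpow A z ** x) = n2 x" "n2 (x ** mpow A z) = n2 x"
    using assms by (auto intro!: n2_left_isometry n2_right_isometry simp: madj_mpow mpow_mult)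
qed

lemma n2_mpow_sq:
  assumes "pd A" "A \<in> M"
  shows "(n2 (mpow A z))\<^sup>2 = Re (\<tau> (mpow A (of_real (2 * Re z))))"
proof -
  have "cnj z + z = of_real (2 * Re z)" by (simp add: complex_eq_iff)
  thus ?thesis using assms by (simp add: n2_sq madj_mpow mpow_mult del: of_real_mult)
qed

text \<open>With B = r^(1/2) s^b these are G = B^* B and A = B B^*. They are similar through the
  invertible B, so all their powers have the same trace.\<close>

lemma gram_powers:
  fixes r s :: "'n cmat" and b :: real
  assumes r: "pd r" "r \<in> M" and s: "pd s" "s \<in> M"
  defines "G \<equiv> mpow s (of_real b) ** r ** mpow s (of_real b)"
    and "A \<equiv> mpow r (1/2) ** mpow s (of_real (2 * b)) ** mpow r (1/2)"
  shows "pd G" and "G \<in> M" and "\<tau> (mpow G z) = \<tau> (mpow A z)"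
proof -
  let ?B = "mpow r (1/2) ** mpow s (of_real b)" and ?C = "mpow s (of_real (- b)) ** mpow r (-1/2)"
  have inv: "?C ** ?B = mat 1" "?B ** ?C = mat 1" using r s by (simp_all add: mmult_assoc mpow_mult mpow_mult_assoc)
  have "madj ?B ** ?B = G" using r s by (simp add: G_def mmult_assoc mpow_mult mpow_mult_assoc mpow_1 madj_mpow)
  thus "pd G" using pd_madj_mult[OF inv(1)] by simp
  show "G \<in> M" using r s by (simp add: G_def)
  have "madj (madj ?B) ** madj ?B = A" using r s by (simp add: A_def mmult_assoc mpow_mult mpow_mult_assoc madj_mpow)
  moreover have "madj ?C ** madj ?B = mat 1" using inv by (metis madj_simps(1,3))
  ultimately have A: "pd A" using pd_madj_mult by metis
  have AM: "A \<in> M" using r s by (simp add: A_def)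
  have "?C ** A ** ?B = G" using r s by (simp add: A_def G_def mmult_assoc mpow_mult mpow_mult_assoc mpow_1)
  hence "mpow G z = ?C ** mpow A z ** ?B" using mpow_similar[OF A inv] by simp
  hence "\<tau> (mpow G z) = \<tau> (?C ** (mpow A z ** ?B))" by (simp add: mmult_assoc)
  also have "\<dots> = \<tau> ((mpow A z ** ?B) ** ?C)" using r s A AM by (intro tau_comm) auto
  also have "\<dots> = \<tau> (mpow A z ** (?B ** ?C))" by (simp add: mmult_assoc)
  also have "\<dots> = \<tau> (mpow A z)" by (simp only: inv matrix_mul_rid)
  finally show "\<tau> (mpow G z) = \<tau> (mpow A z)" .
qed

end

section \<open>Isometries and duality for the rotated Petz map\<close>

context recovery
begin

text \<open>On N the functional given by \<sigma> is the one given by \<open>\<sigma>N\<close>; the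
  modulus 1/2 of one power and -1/2 of the other then cancel, while imaginary parts contribute only
  unitaries.\<close>

lemma n2_recovery_isometry:
  fixes z w :: complex
  assumes y: "y \<in> N" and z: "Re z = 1/2" and w: "Re w = -1/2"
  shows "n2 (mpow \<sigma> z ** mpow \<sigma>N w ** y) = n2 y" "n2 (y ** mpow \<sigma>N w ** mpow \<sigma> z) = n2 y"
proof -
  have e: "n2 (mpow \<sigma> z ** mpow \<sigma>N w ** y) = n2 y" if z: "Re z = 1/2" and w: "Re w = -1/2" and y: "y \<in> N" for z w y
  proof -
    have cz: "cnj z + z = 1" "cnj w + w = - 1" using z w by (simp_all add: complex_eq_iff)
    have "\<tau> (madj (mpow \<sigma> z ** mpow \<sigma>N w ** y) ** (mpow \<sigma> z ** mpow \<sigma>N w ** y))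
       = \<tau> ((madj y ** mpow \<sigma>N (cnj w)) ** (\<sigma> ** (mpow \<sigma>N w ** y)))"
      by (simp add: alg pds cz)
    also have "\<dots> = \<tau> ((\<sigma> ** (mpow \<sigma>N w ** y)) ** (madj y ** mpow \<sigma>N (cnj w)))"
      using y by (intro tau_comm) (simp_all add: pds)
    also have "\<dots> = \<tau> (\<sigma> ** (mpow \<sigma>N w ** y ** madj y ** mpow \<sigma>N (cnj w)))" by (simp add: mmult_assoc)
    also have "\<dots> = \<tau> (mpow \<sigma>N 1 ** (mpow \<sigma>N w ** y ** madj y ** mpow \<sigma>N (cnj w)))"
      unfolding mpow_1[OF pd_sigmaN] using y by (intro tau_sigma_N) (simp add: pds)
    also have "\<dots> = \<tau> ((mpow \<sigma>N (1 + w) ** y) ** (madj y ** mpow \<sigma>N (cnj w)))" by (simp add: mmult_assoc mpow_mult_assoc pds)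
    also have "\<dots> = \<tau> ((madj y ** mpow \<sigma>N (cnj w)) ** (mpow \<sigma>N (1 + w) ** y))"
      using y by (intro tau_comm) (simp_all add: pds)
    also have "\<dots> = \<tau> (madj y ** (mpow \<sigma>N (cnj w + (1 + w)) ** y))" by (simp add: mmult_assoc mpow_mult_assoc pds)
    also have "cnj w + (1 + w) = 0" using cz by (simp add: add_ac)
    finally show ?thesis using pd_sigmaN by (simp add: n2_def ip_def)
  qed
  show "n2 (mpow \<sigma> z ** mpow \<sigma>N w ** y) = n2 y" by (rule e[OF z w y])
  have "n2 (y ** mpow \<sigma>N w ** mpow \<sigma> z) = n2 (madj (y ** mpow \<sigma>N w ** mpow \<sigma> z))"
    using y by (intro n2_madj[symmetric]) (simp add: pds)
  also have "\<dots> = n2 (mpow \<sigma> (cnj z) ** mpow \<sigma>N (cnj w) ** madj y)" by (simp add: alg pds)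
  also have "\<dots> = n2 (madj y)" using y z w by (intro e) auto
  finally show "n2 (y ** mpow \<sigma>N w ** mpow \<sigma> z) = n2 y" using y by (simp add: n2_madj)
qed

lemma n2_mpow_sigma_half: "Re z = 1/2 \<Longrightarrow> n2 (mpow \<sigma> z) = 1"
proof -
  assume "Re z = 1/2"
  hence "complex_of_real (2 * Re z) = 1" by (simp only: of_real_eq_1_iff)
  hence "(n2 (mpow \<sigma> z))\<^sup>2 = 1"
    unfolding n2_mpow_sq[OF pd_sigma sigma_M] by (simp only: mpow_1 pd_sigma tau_sigma one_complex.sel)
  moreover have "n2 (mpow \<sigma> z) \<ge> 0" by (intro n2_nonneg) (simp add: pds)
  ultimately show ?thesis by (auto simp: power2_eq_1_iff)
qed

text \<open>The order bounds say -1 <= Z <= 1. For each spectral projection P of Z, Cauchy-Schwarz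
  bounds the trace of P against \<sigma>^z u \<sigma>^z by that of P \<sigma>, and these sum to tr
  \<sigma> = 1.\<close>

lemma contraction_trace_bound:
  assumes Z: "Z \<in> M" "madj Z = Z" "psd (mat 1 - Z)" "psd (mat 1 + Z)"
    and u: "u \<in> M" "madj u ** u = mat 1" and z: "Re z = 1/2"
  shows "norm (\<tau> (Z ** (mpow \<sigma> z ** u ** mpow \<sigma> z))) \<le> 1"
proof -
  have ab: "\<bar>c\<bar> \<le> 1" if c: "c \<in> eigs Z" for c
  proof -
    obtain w where w: "w \<noteq> 0" "Z *v w = of_real c *s w" using eproj_eigenvector[OF Z(2) c] .
    have v: "(mat 1 - Z) *v w = of_real (1 - c) *s w" "(mat 1 + Z) *v w = of_real (1 + c) *s w"
      by (simp_all add: matrix_vector_mult_diff_rdistrib matrix_vector_mult_add_rdistrib w vector_sub_rdistrib vector_sadd_rdistrib)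
    have "0 \<le> Re (cip w ((mat 1 - Z) *v w))" "0 \<le> Re (cip w ((mat 1 + Z) *v w))" using Z by (simp_all add: psd_iff)
    hence "0 \<le> (1 - c) * (norm w)\<^sup>2" "0 \<le> (1 + c) * (norm w)\<^sup>2"
      unfolding v cip_scale cip_self by (simp_all only: of_real_mult[symmetric] Re_complex_of_real)
    thus ?thesis using w(1) by (auto simp: zero_le_mult_iff)
  qed
  have pm: "eproj Z c \<in> M" "madj (eproj Z c) = eproj Z c" "eproj Z c ** eproj Z c = eproj Z c" if "c \<in> eigs Z" for c
    using that eproj_mem[OF Z(2) M Z(1)] madj_eproj[OF Z(2)] eproj_mult[OF Z(2)] by auto
  let ?L = "mpow \<sigma> z"
  have Lm: "?L \<in> M" by (simp add: pds)
  have cz: "cnj z + z = 1" "z + cnj z = 1" using z by (simp_all add: complex_eq_iff)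
  have summand: "norm (\<tau> (eproj Z c ** (?L ** u ** ?L))) \<le> Re (\<tau> (eproj Z c ** \<sigma>))" if c: "c \<in> eigs Z" for c
  proof -
    let ?P = "eproj Z c"
    have "\<tau> (?P ** (?L ** u ** ?L)) = \<tau> (?P ** (?P ** (?L ** u ** ?L)))"
      using pm(3)[OF c] by (simp add: matrix_mul_assoc)
    also have "\<dots> = \<tau> ((?P ** ?L) ** (u ** (?L ** ?P)))"
      using tau_comm[of ?P "?P ** (?L ** u ** ?L)"] pm[OF c] u Lm by (simp add: mmult_assoc)
    finally have bnd: "norm (\<tau> (?P ** (?L ** u ** ?L))) \<le> n2 (?P ** ?L) * n2 (?L ** ?P)"
      using tau_mult_bound[of "?P ** ?L" "u ** (?L ** ?P)"] pm[OF c] u Lm by (simp add: n2_left_isometry[OF u(2)])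
    have "(n2 (?P ** ?L))\<^sup>2 = Re (\<tau> (?P ** \<sigma>))"
    proof -
      have "\<tau> (madj (?P ** ?L) ** (?P ** ?L)) = \<tau> (mpow \<sigma> (cnj z) ** ((?P ** ?P) ** ?L))" by (simp add: alg pds pm(2)[OF c])
      also have "\<dots> = \<tau> ((?P ** ?L) ** mpow \<sigma> (cnj z))" unfolding pm(3)[OF c] using pm(1)[OF c] by (intro tau_comm) (simp_all add: pds)
      also have "\<dots> = \<tau> (?P ** \<sigma>)" by (simp add: alg pds cz)
      finally show ?thesis using pm(1)[OF c] Lm by (simp add: n2_sq)
    qed
    hence n1: "n2 (?P ** ?L) = sqrt (Re (\<tau> (?P ** \<sigma>)))" using pm(1)[OF c] Lm by (metis mem_intros(4) n2_nonneg real_sqrt_unique)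
    have "(n2 (?L ** ?P))\<^sup>2 = Re (\<tau> (?P ** \<sigma>))"
    proof -
      have "\<tau> (madj (?L ** ?P) ** (?L ** ?P)) = \<tau> (?P ** (\<sigma> ** ?P))" by (simp add: alg pds pm[OF c] cz)
      also have "\<dots> = \<tau> ((\<sigma> ** ?P) ** ?P)" using pm(1)[OF c] by (intro tau_comm) simp_all
      also have "\<dots> = \<tau> (\<sigma> ** (?P ** ?P))" by (simp add: mmult_assoc)
      also have "\<dots> = \<tau> (?P ** \<sigma>)" unfolding pm(3)[OF c] using pm(1)[OF c] by (intro tau_comm) simp_all
      finally show ?thesis using pm(1)[OF c] Lm by (simp add: n2_sq)
    qed
    hence n2': "n2 (?L ** ?P) = sqrt (Re (\<tau> (?P ** \<sigma>)))" and nn: "Re (\<tau> (?P ** \<sigma>)) \<ge> 0"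
      using pm(1)[OF c] Lm by (metis mem_intros(4) n2_nonneg real_sqrt_unique, metis zero_le_power2)
    show ?thesis using bnd nn unfolding n1 n2' by simp
  qed
  have "Z ** (?L ** u ** ?L) = (\<Sum>c\<in>eigs Z. cscale (of_real c) (eproj Z c ** (?L ** u ** ?L)))"
    using eigs_decomp[OF Z(2)] mm.sum_left[of "\<lambda>c. cscale (of_real c) (eproj Z c)" "eigs Z" "?L ** u ** ?L"] by simp
  hence "\<tau> (Z ** (?L ** u ** ?L)) = (\<Sum>c\<in>eigs Z. of_real c * \<tau> (eproj Z c ** (?L ** u ** ?L)))"
    using pm u Lm by (simp add: tau_sum tau_cscale)
  also have "norm \<dots> \<le> (\<Sum>c\<in>eigs Z. \<bar>c\<bar> * norm (\<tau> (eproj Z c ** (?L ** u ** ?L))))"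
    by (rule order_trans[OF norm_sum]) (simp add: norm_mult)
  also have "\<dots> \<le> (\<Sum>c\<in>eigs Z. 1 * Re (\<tau> (eproj Z c ** \<sigma>)))"
    using ab summand by (intro sum_mono mult_mono) auto
  also have "\<dots> = Re (\<tau> (\<Sum>c\<in>eigs Z. eproj Z c ** \<sigma>))" using pm by (subst tau_sum) auto
  also have "(\<Sum>c\<in>eigs Z. eproj Z c ** \<sigma>) = \<sigma>" using eproj_sum[OF Z(2)] by (simp flip: mm.sum_left)
  finally show ?thesis by (simp add: tau_sigma)
qed

lemma petz_rot_mem: "y \<in> N \<Longrightarrow> petz_rot E \<sigma> t y \<in> M"
  unfolding petz_rot_def \<sigma>N_def[symmetric] by (simp add: pds)

text \<open>Z is the image of X under the trace adjoint of Y -> R^t(E Y). This adjoint is positive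
  and sends 1 to 1, so it preserves -1 <= X <= 1.\<close>

lemma petz_dual:
  fixes t :: real
  assumes X: "X \<in> M" "madj X = X" "X ** X = mat 1"
  defines "Z \<equiv> E (mpow \<sigma>N (- 1/2 - \<i> * of_real t) ** mpow \<sigma> (1/2 + \<i> * of_real t) ** X ** mpow \<sigma> (1/2 - \<i> * of_real t) ** mpow \<sigma>N (- 1/2 + \<i> * of_real t))"
  shows "Z \<in> N" "madj Z = Z" "psd (mat 1 - Z)" "psd (mat 1 + Z)"
    and "Y \<in> M \<Longrightarrow> \<tau> (X ** petz_rot E \<sigma> t (E Y)) = \<tau> (Z ** Y)"
proof -
  define r where "r = mpow \<sigma>N (- 1/2 - \<i> * of_real t) ** mpow \<sigma> (1/2 + \<i> * of_real t)"
  define r' where "r' = mpow \<sigma> (1/2 - \<i> * of_real t) ** mpow \<sigma>N (- 1/2 + \<i> * of_real t)"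
  have rM: "r \<in> M" "r' \<in> M" by (simp_all add: r_def r'_def pds)
  have adj: "madj r = r'" "madj r' = r" by (simp_all add: r_def r'_def alg pds minus_it)
  have Zr: "Z = E (r ** X ** r')" by (simp add: Z_def r_def r'_def mmult_assoc)
  show "Z \<in> N" using X rM by (simp add: Zr)
  show "madj Z = Z" unfolding Zr using X rM by (subst E_madj[symmetric]) (simp_all add: adj mmult_assoc)
  have "E (r ** r') = mat 1"
  proof -
    have "r ** r' = mpow \<sigma>N (- 1/2 - \<i> * of_real t) ** \<sigma> ** mpow \<sigma>N (- 1/2 + \<i> * of_real t)" by (simp add: r_def r'_def alg pds)
    hence "E (r ** r') = mpow \<sigma>N (- 1/2 - \<i> * of_real t) ** \<sigma>N ** mpow \<sigma>N (- 1/2 + \<i> * of_real t)"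
      unfolding \<sigma>N_def using pd_sigmaN by (simp add: E_bimod \<sigma>N_def)
    also have "\<dots> = mpow \<sigma>N (- 1/2 - \<i> * of_real t) ** (mpow \<sigma>N 1 ** mpow \<sigma>N (- 1/2 + \<i> * of_real t))" by (simp add: mpow_1 pds mmult_assoc)
    also have "\<dots> = mat 1" by (simp add: mpow_mult pds)
    finally show ?thesis .
  qed
  hence ps: "psd (mat 1 - E (r ** V ** r'))" if V: "V \<in> M" "madj V = V" "V ** V = mat 1" for V
  proof -
    \<comment> \<open>For V V = 1 one has (1 - V)^2 = 2 (1 - V), so the factor 1 / sqrt 2 makes B^*
      B equal to r (1 - V) r', manifestly positive.\<close>
    let ?B = "cscale (of_real (1 / sqrt 2)) ((mat 1 - V) ** r')"
    have "madj ?B ** ?B = cscale (of_real (1/2)) (r ** ((mat 1 - V) ** (mat 1 - V)) ** r')"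
      by (simp add: adj V mmult_assoc flip: of_real_mult)
    also have "(mat 1 - V) ** (mat 1 - V) = cscale 2 (mat 1 - V)"
      using V cscale_add_left[of 1 1 "mat 1 - V"] by (simp add: mm_distribs)
    finally have e: "madj ?B ** ?B = r ** r' - r ** V ** r'" by (simp add: mm_distribs)
    have "psd (E (madj ?B ** ?B))" using rM V by (intro E_psd psd_madj_mult) simp
    thus ?thesis unfolding e using \<open>E (r ** r') = mat 1\<close> rM V by (simp add: E_diff)
  qed
  show "psd (mat 1 - Z)" unfolding Zr by (rule ps[OF X])
  have "E (r ** (- X) ** r') = - E (r ** X ** r')"
    using E_diff[of 0 "r ** X ** r'"] E_cscale[of 0 0] X rM by (simp add: mm_distribs)
  moreover have "psd (mat 1 - E (r ** (- X) ** r'))" using X by (intro ps) (simp_all add: mm_distribs)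
  ultimately show "psd (mat 1 + Z)" unfolding Zr by simp
  show "\<tau> (X ** petz_rot E \<sigma> t (E Y)) = \<tau> (Z ** Y)" if Y: "Y \<in> M"
  proof -
    have "petz_rot E \<sigma> t (E Y) = r' ** (E Y ** r)" by (simp add: petz_rot_def r_def r'_def \<sigma>N_def mmult_assoc)
    hence "\<tau> (X ** petz_rot E \<sigma> t (E Y)) = \<tau> ((X ** r' ** E Y) ** r)" by (simp add: mmult_assoc)
    also have "\<dots> = \<tau> (r ** (X ** r' ** E Y))" using X rM Y by (intro tau_comm) auto
    also have "\<dots> = \<tau> ((r ** X ** r') ** E Y)" by (simp add: mmult_assoc)
    also have "\<dots> = \<tau> (E (r ** X ** r') ** E Y)" using X rM Y by (simp add: tau_E_right)
    also have "\<dots> = \<tau> (Z ** Y)" unfolding Zr using X rM Y by (simp add: tau_E_left)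
    finally show ?thesis .
  qed
qed

end

lemma (in traced_algebra) n2_mpow_eq:
  assumes "pd A" "A \<in> M"
  shows "n2 (mpow A z) = sqrt (Re (\<tau> (mpow A (of_real (2 * Re z)))))"
  using n2_mpow_sq[OF assms, of z] n2_nonneg[of "mpow A z"] assms by (metis mem_intros(10) real_sqrt_unique)

section \<open>Analytic families for exponents at least 2\<close>

context recovery
begin

context
  fixes \<alpha> :: real assumes \<alpha>: "\<alpha> \<ge> 2"
begin

text \<open>Traces of powers agree with those of \<open>Aop (1/\<alpha> - 1)\<close> by
  \<open>gram_powers\<close>; with the powers of \<sigma> on the outside, multiplying them off
  returns \<rho>.\<close>

definition "GM = mpow \<sigma> (of_real ((1/\<alpha> - 1) / 2)) ** \<rho> ** mpow \<sigma> (of_real ((1/\<alpha> - 1) / 2))"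
definition "GN = mpow \<sigma>N (of_real ((1/\<alpha> - 1) / 2)) ** \<rho>N ** mpow \<sigma>N (of_real ((1/\<alpha> - 1) / 2))"

lemma pd_G: "pd GM" "pd GN" and G_mem [simp]: "GM \<in> M" "GN \<in> N"
  and tau_G: "\<tau> (mpow GM (of_real \<alpha>)) = of_real (PM \<alpha>)" "\<tau> (mpow GN (of_real \<alpha>)) = of_real (PN \<alpha>)"
proof -
  have A: "Aop (1/\<alpha> - 1) = mpow \<rho> (1/2) ** mpow \<sigma> (of_real (2 * ((1/\<alpha> - 1) / 2))) ** mpow \<rho> (1/2)"
     "AN (1/\<alpha> - 1) = mpow \<rho>N (1/2) ** mpow \<sigma>N (of_real (2 * ((1/\<alpha> - 1) / 2))) ** mpow \<rho>N (1/2)"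
    unfolding Aop_def AN_def a0_def xi_def by (simp_all only: nonzero_mult_div_cancel_left times_divide_eq_right zero_neq_numeral not_False_eq_True)
  show "pd GM" "pd GN" unfolding GM_def GN_def by (intro gram_powers(1) N.gram_powers(1); simp add: pds)+
  show "GM \<in> M" "GN \<in> N" unfolding GM_def GN_def by (intro gram_powers(2) N.gram_powers(2); simp add: pds)+
  have "\<tau> (mpow GM (of_real \<alpha>)) = \<tau> (mpow (Aop (1/\<alpha> - 1)) (of_real \<alpha>))"
    unfolding GM_def A by (rule gram_powers(3)) (simp_all add: pds)
  thus "\<tau> (mpow GM (of_real \<alpha>)) = of_real (PM \<alpha>)" unfolding PM_def using tau_mpow_real[OF pd_Aop Aop_M] by metis
  have "\<tau> (mpow GN (of_real \<alpha>)) = \<tau> (mpow (AN (1/\<alpha> - 1)) (of_real \<alpha>))"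
    unfolding GN_def A by (rule N.gram_powers(3)) (simp_all add: pds)
  thus "\<tau> (mpow GN (of_real \<alpha>)) = of_real (PN \<alpha>)" unfolding PN_def using N.tau_mpow_real[OF pd_AN AN_N] by metis
qed

lemmas pdg = pd_G pds

text \<open>\<open>Yz\<close> passes through \<open>\<rho>\<close> at \<open>z = 1/\<alpha>\<close>, where pairing with \<open>\<phi>z\<close> gives \<open>PN \<alpha>\<close>; on the lines \<open>Re z = 0\<close>
  and \<open>Re z = 1/2\<close> the two families are controlled by unitaries and in the \<open>L\<^sup>2\<close> norm.\<close>

definition "Yz z = mpow \<sigma> ((1 - z) / 2) ** mpow GM (of_real \<alpha> * z) ** mpow \<sigma> ((1 - z) / 2)"
definition "\<phi>z z = mpow \<sigma>N (- ((1 - z) / 2)) ** mpow GN (of_real \<alpha> * (1 - z)) ** mpow \<sigma>N (- ((1 - z) / 2))"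

lemma Yz_M [simp]: "Yz z \<in> M" and \<phi>z_N [simp]: "\<phi>z z \<in> N"
  by (simp_all add: Yz_def \<phi>z_def pdg)

lemma expsum_Yz: "expsum M Yz" and expsum_\<phi>z: "expsum M \<phi>z"
proof -
  have "expsum M (\<lambda>z. mpow \<sigma> (of_real (1/2) + of_real (-1/2) * z) ** mpow GM (of_real 0 + of_real \<alpha> * z) ** mpow \<sigma> (of_real (1/2) + of_real (-1/2) * z))"
    by (intro expsum_mult[OF M] expsum_mpow[OF M]) (simp_all add: pdg)
  moreover have "of_real (1/2) + of_real (-1/2) * z = (1 - z) / 2" for z :: complex by (simp add: diff_divide_distrib)
  ultimately show "expsum M Yz" unfolding Yz_def[abs_def] by (simp only: of_real_0 add_0)
  have "expsum M (\<lambda>z. mpow \<sigma>N (of_real (-1/2) + of_real (1/2) * z) ** mpow GN (of_real \<alpha> + of_real (-\<alpha>) * z) ** mpow \<sigma>N (of_real (-1/2) + of_real (1/2) * z))"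
    by (intro expsum_mult[OF M] expsum_mpow[OF M]) (simp_all add: pdg)
  moreover have "of_real (-1/2) + of_real (1/2) * z = - ((1 - z) / 2)" "of_real \<alpha> + of_real (-\<alpha>) * z = of_real \<alpha> * (1 - z)" for z :: complex
    by (simp_all add: diff_divide_distrib right_diff_distrib)
  ultimately show "expsum M \<phi>z" unfolding \<phi>z_def[abs_def] by (simp only:)
qed

lemma n2_GN: "Re y = \<alpha> / 2 \<Longrightarrow> n2 (mpow GN y) = sqrt (PN \<alpha>)"
proof -
  assume "Re y = \<alpha> / 2"
  hence e: "2 * Re y = \<alpha>" by simp
  show ?thesis using n2_mpow_eq[OF pd_G(2) N_sub[OF G_mem(2)], of y] unfolding e by (simp add: tau_G)
qed

lemma edge_zero:
  assumes z: "Re z = 0" and X: "X \<in> M" "madj X = X" "X ** X = mat 1"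
  shows "norm (\<tau> (\<phi>z z ** Yz z)) \<le> PN \<alpha>"
    and "norm (\<tau> (X ** (Yz z - petz_rot E \<sigma> t (E (Yz z))))) \<le> 2"
proof -
  let ?w = "(1 - z) / 2" and ?u = "mpow GM (of_real \<alpha> * z)"
  have w: "Re ?w = 1/2" "Re (- ?w) = - 1/2" using z by simp_all
  have cz: "cnj z = - z" using z by (simp add: complex_eq_iff)
  have u: "?u \<in> M" "madj ?u ** ?u = mat 1" by (simp_all add: alg pdg cz)
  let ?a = "mpow GN (of_real \<alpha> * (1/2 - z)) ** mpow \<sigma>N (- ?w) ** mpow \<sigma> ?w"
  let ?b = "mpow \<sigma> ?w ** mpow \<sigma>N (- ?w) ** mpow GN (of_real (\<alpha> / 2))"
  have ab: "?a \<in> M" "?b \<in> M" by (simp_all add: pdg)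
  have "\<phi>z z ** Yz z = mpow \<sigma>N (- ?w) ** (mpow GN (of_real (\<alpha> / 2)) ** ?a ** ?u ** mpow \<sigma> ?w)"
    by (simp add: \<phi>z_def Yz_def alg pdg right_diff_distrib)
  hence "\<tau> (\<phi>z z ** Yz z) = \<tau> ((mpow GN (of_real (\<alpha> / 2)) ** ?a ** ?u ** mpow \<sigma> ?w) ** mpow \<sigma>N (- ?w))"
    using u ab by (simp only:) (intro tau_comm; simp add: pdg)
  also have "\<dots> = \<tau> (mpow GN (of_real (\<alpha> / 2)) ** (?a ** ?u ** mpow \<sigma> ?w ** mpow \<sigma>N (- ?w)))" by (simp add: mmult_assoc)
  also have "\<dots> = \<tau> ((?a ** ?u ** mpow \<sigma> ?w ** mpow \<sigma>N (- ?w)) ** mpow GN (of_real (\<alpha> / 2)))"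
    using u ab by (intro tau_comm; simp add: pdg)
  also have "\<dots> = \<tau> (?a ** (?u ** ?b))" by (simp add: mmult_assoc)
  finally have "norm (\<tau> (\<phi>z z ** Yz z)) \<le> n2 ?a * n2 (?u ** ?b)"
    using tau_mult_bound[OF ab(1), of "?u ** ?b"] u ab by simp
  also have "n2 (?u ** ?b) = n2 ?b" by (rule n2_left_isometry[OF u(2)])
  also have "n2 ?b = sqrt (PN \<alpha>)" using w by (subst n2_recovery_isometry(1)) (simp_all add: pdg n2_GN)
  also have "n2 ?a = sqrt (PN \<alpha>)" using w z by (subst n2_recovery_isometry(2)) (simp_all add: pdg n2_GN)
  finally show "norm (\<tau> (\<phi>z z ** Yz z)) \<le> PN \<alpha>" using PN_pos[of \<alpha>] by simp
  have XX: "madj X ** X = mat 1" using X by simp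
  have Y: "Yz z = mpow \<sigma> ?w ** ?u ** mpow \<sigma> ?w" by (simp add: Yz_def)
  have "norm (\<tau> (X ** Yz z)) \<le> 1"
  proof -
    have sM: "mpow \<sigma> ?w \<in> M" by (simp add: pds)
    have "\<tau> (X ** Yz z) = \<tau> ((X ** mpow \<sigma> ?w) ** (?u ** mpow \<sigma> ?w))" by (simp add: Y mmult_assoc)
    also have "norm \<dots> \<le> n2 (X ** mpow \<sigma> ?w) * n2 (?u ** mpow \<sigma> ?w)" using X u sM by (intro tau_mult_bound) auto
    also have "\<dots> = 1" by (simp only: n2_left_isometry[OF u(2)] n2_left_isometry[OF XX] n2_mpow_sigma_half[OF w(1)])
    finally show ?thesis .
  qed
  moreover have "norm (\<tau> (X ** petz_rot E \<sigma> t (E (Yz z)))) \<le> 1"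
    unfolding petz_dual(5)[OF X Yz_M] unfolding Y
    by (rule contraction_trace_bound[OF N_sub petz_dual(2-4)[OF X] u w(1)]) (rule petz_dual(1)[OF X])
  moreover have "\<tau> (X ** (Yz z - petz_rot E \<sigma> t (E (Yz z)))) = \<tau> (X ** Yz z) - \<tau> (X ** petz_rot E \<sigma> t (E (Yz z)))"
    using X petz_rot_mem[of "E (Yz z)" t] by (simp add: mm_distribs tau_diff)
  ultimately show "norm (\<tau> (X ** (Yz z - petz_rot E \<sigma> t (E (Yz z))))) \<le> 2"
    using norm_triangle_ineq4[of "\<tau> (X ** Yz z)" "\<tau> (X ** petz_rot E \<sigma> t (E (Yz z)))"] by simp
qed

text \<open>Here Y = \<sigma>^(1/4) h \<sigma>^(1/4) with |h|^2 = \<open>PM \<alpha>\<close>, and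
  \<open>L2_contraction\<close> applies to h. The number \<open>a\<close> is the L2 size of the part
  seen by N, and \<open>b\<close> the distance of h from its recovered version.\<close>

lemma edge_half:
  fixes t :: real
  assumes z: "Re z = 1/2" and X: "X \<in> M" "madj X = X" "X ** X = mat 1"
  obtains a b where "0 \<le> a" "0 \<le> b" "(1 + exp (2 * pi * \<bar>t\<bar>)) * (a\<^sup>2 - PM \<alpha>) + b\<^sup>2 \<le> 0"
    "norm (\<tau> (\<phi>z z ** Yz z)) \<le> sqrt (PN \<alpha>) * a"
    "norm (\<tau> (X ** (Yz z - petz_rot E \<sigma> t (E (Yz z))))) \<le> b"
proof -
  let ?w = "1/4 - z/2" 
  have w: "Re ?w = 0" "Re (- ?w) = 0" using z by simp_all
  define h where "h = mpow \<sigma> ?w ** mpow GM (of_real \<alpha> * z) ** mpow \<sigma> ?w"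
  have hM: "h \<in> M" by (simp add: h_def pdg)
  have zz: "(1 - z) / 2 = 1/4 + ?w" by (simp add: field_simps)
  have Yh: "Yz z = mpow \<sigma> (1/4) ** h ** mpow \<sigma> (1/4)"
    by (simp add: Yz_def zz h_def alg pdg)
  define k where "k = mpow \<sigma>N (-1/2) ** E (Yz z) ** mpow \<sigma>N (-1/2)"
  define f where "f = mpow \<sigma> (1/4 - \<i> * of_real t) ** mpow \<sigma>N (\<i> * of_real t) ** k ** mpow \<sigma>N (- (\<i> * of_real t)) ** mpow \<sigma> (1/4 + \<i> * of_real t)"
  have kN: "k \<in> N" by (simp add: k_def pds)
  have fM: "f \<in> M" using kN by (simp add: f_def pds)
  have EY: "E (Yz z) = mpow \<sigma>N (1/2) ** k ** mpow \<sigma>N (1/2)" by (simp add: k_def alg pds)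
  define a where "a = n2 (mpow \<sigma>N (1/4) ** k ** mpow \<sigma>N (1/4))"
  have aM: "mpow \<sigma>N (1/4) ** k ** mpow \<sigma>N (1/4) \<in> M" using kN by (simp add: pds)
  define b where "b = n2 (h - f)"
  have nh: "(n2 h)\<^sup>2 = PM \<alpha>"
  proof -
    have "n2 h = n2 (mpow GM (of_real \<alpha> * z))"
      unfolding h_def using w by (subst n2_mpow_phase; simp add: pdg n2_mpow_phase)
    moreover have "2 * Re (of_real \<alpha> * z) = \<alpha>" using z by simp
    ultimately show ?thesis unfolding n2_mpow_sq[OF pd_G(1) G_mem(1)] by (simp only: n2_mpow_sq[OF pd_G(1) G_mem(1)] tau_G Re_complex_of_real)
  qed
  have c1: "(1 + exp (2 * pi * \<bar>t\<bar>)) * (a\<^sup>2 - PM \<alpha>) + b\<^sup>2 \<le> 0"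
    using L2_contraction[OF hM, of t] unfolding Yh[symmetric] k_def[symmetric] f_def[symmetric] a_def[symmetric] b_def[symmetric] nh .
  have c2: "norm (\<tau> (\<phi>z z ** Yz z)) \<le> sqrt (PN \<alpha>) * a"
  proof -
    let ?g = "mpow \<sigma>N (- ?w) ** mpow GN (of_real \<alpha> * (1 - z)) ** mpow \<sigma>N (- ?w)"
    have gM: "?g \<in> M" by (simp add: pdg)
    have "n2 ?g = n2 (mpow GN (of_real \<alpha> * (1 - z)))"
      using w by (subst n2_mpow_phase; simp add: pdg n2_mpow_phase)
    also have "\<dots> = sqrt (PN \<alpha>)" using z by (intro n2_GN) simp
    finally have ng: "n2 ?g = sqrt (PN \<alpha>)" .
    have "\<tau> (\<phi>z z ** Yz z) = \<tau> (\<phi>z z ** E (Yz z))" by (simp add: tau_E_left)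
    also have "\<dots> = \<tau> ((mpow \<sigma>N (- (1/4)) ** ?g ** (mpow \<sigma>N (1/4) ** k ** mpow \<sigma>N (1/4))) ** mpow \<sigma>N (1/4))"
      unfolding EY by (simp add: \<phi>z_def zz alg pdg)
    also have "\<dots> = \<tau> (mpow \<sigma>N (1/4) ** (mpow \<sigma>N (- (1/4)) ** ?g ** (mpow \<sigma>N (1/4) ** k ** mpow \<sigma>N (1/4))))"
      using gM aM by (intro tau_comm) (simp_all add: pds)
    also have "\<dots> = \<tau> (?g ** (mpow \<sigma>N (1/4) ** k ** mpow \<sigma>N (1/4)))" by (simp add: alg pdg)
    finally show ?thesis using tau_mult_bound[OF gM aM] unfolding ng a_def by simp
  qed
  have c3: "norm (\<tau> (X ** (Yz z - petz_rot E \<sigma> t (E (Yz z))))) \<le> b"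
  proof -
    let ?S = "mpow \<sigma> (1/4)"
    have SM: "?S \<in> M" by (simp add: pds)
    have XX: "madj X ** X = mat 1" using X by simp
    have "petz_rot E \<sigma> t (E (Yz z)) = ?S ** f ** ?S"
      unfolding EY petz_rot_def \<sigma>N_def[symmetric] f_def by (simp add: alg pds)
    hence "Yz z - petz_rot E \<sigma> t (E (Yz z)) = ?S ** (h - f) ** ?S" by (simp add: Yh mm_distribs)
    hence "\<tau> (X ** (Yz z - petz_rot E \<sigma> t (E (Yz z)))) = \<tau> ((X ** ?S ** (h - f)) ** ?S)" by (simp add: mmult_assoc)
    also have "\<dots> = \<tau> (?S ** (X ** ?S ** (h - f)))" using X SM hM fM by (intro tau_comm) auto
    also have "\<dots> = \<tau> ((?S ** X ** ?S) ** (h - f))" by (simp add: mmult_assoc)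
    finally have e: "norm (\<tau> (X ** (Yz z - petz_rot E \<sigma> t (E (Yz z))))) \<le> n2 (?S ** X ** ?S) * b"
      using tau_mult_bound[of "?S ** X ** ?S" "h - f"] X SM hM fM unfolding b_def by simp
    let ?H = "mpow \<sigma> (1/2)"
    have HM: "?H \<in> M" by (simp add: pds)
    \<comment> \<open>Passage from L2 to the pairing with X: |\<sigma>^(1/4) X \<sigma>^(1/4)|^2 is
      the trace of (X \<sigma>^(1/2))^2, at most |X \<sigma>^(1/2)|^2 = 1.\<close>
    have "(n2 (?S ** X ** ?S))\<^sup>2 = Re (\<tau> (?S ** (X ** ?H ** X ** ?S)))"
      using X SM by (simp add: n2_sq alg pds)
    also have "\<tau> (?S ** (X ** ?H ** X ** ?S)) = \<tau> ((X ** ?H ** X ** ?S) ** ?S)" using X SM HM by (intro tau_comm) auto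
    also have "\<dots> = \<tau> ((X ** ?H) ** (X ** ?H))" by (simp add: alg pds)
    also have "Re \<dots> \<le> norm (\<tau> ((X ** ?H) ** (X ** ?H)))" by (rule complex_Re_le_cmod)
    also have "\<dots> \<le> n2 (X ** ?H) * n2 (X ** ?H)" using X HM by (intro tau_mult_bound) auto
    also have "n2 (X ** ?H) = 1" using n2_mpow_sigma_half[of "1/2"] by (simp add: n2_left_isometry[OF XX])
    finally have "(n2 (?S ** X ** ?S))\<^sup>2 \<le> 1\<^sup>2" by simp
    hence "n2 (?S ** X ** ?S) \<le> 1" by (rule power2_le_imp_le) simp
    moreover have "b \<ge> 0" using hM fM by (simp add: b_def)
    ultimately have "n2 (?S ** X ** ?S) * b \<le> 1 * b" by (intro mult_right_mono)
    thus ?thesis using e by simp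
  qed
  show ?thesis using c1 c2 c3 hM fM aM by (intro that[of a b]) (simp_all add: a_def b_def)
qed

lemma interior_point:
  shows "Yz (of_real (1/\<alpha>)) = \<rho>" "\<tau> (\<phi>z (of_real (1/\<alpha>)) ** \<rho>) = of_real (PN \<alpha>)"
proof -
  let ?z = "complex_of_real (1/\<alpha>)"
  have e: "(1 - ?z) / 2 = - of_real ((1/\<alpha> - 1) / 2)" "complex_of_real \<alpha> * ?z = 1" "of_real \<alpha> * (1 - ?z) = of_real (\<alpha> - 1)"
    using \<alpha> by (simp_all add: field_simps)
  show "Yz ?z = \<rho>" unfolding Yz_def e mpow_1[OF pd_G(1)] unfolding GM_def by (simp add: alg pds del: of_real_divide of_real_diff)
  let ?s = "mpow \<sigma>N (of_real ((1/\<alpha> - 1) / 2))"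
  have "\<tau> (\<phi>z ?z ** \<rho>) = \<tau> (\<phi>z ?z ** \<rho>N)" unfolding \<rho>N_def by (simp add: tau_E_left)
  also have "\<phi>z ?z ** \<rho>N = ?s ** (mpow GN (of_real (\<alpha> - 1)) ** ?s ** \<rho>N)"
    unfolding \<phi>z_def e by (simp add: mmult_assoc del: of_real_divide of_real_diff)
  also have "\<tau> \<dots> = \<tau> ((mpow GN (of_real (\<alpha> - 1)) ** ?s ** \<rho>N) ** ?s)" by (intro tau_comm) (simp_all add: pdg)
  also have "(mpow GN (of_real (\<alpha> - 1)) ** ?s ** \<rho>N) ** ?s = mpow GN (of_real (\<alpha> - 1)) ** mpow GN 1"
    unfolding mpow_1[OF pd_G(2)] by (simp add: GN_def mmult_assoc del: of_real_divide of_real_diff)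
  also have "\<dots> = mpow GN (of_real \<alpha>)" by (simp add: mpow_mult pd_G)
  finally show "\<tau> (\<phi>z ?z ** \<rho>) = of_real (PN \<alpha>)" by (simp add: tau_G)
qed

end

end

section \<open>The gain from interpolation\<close>

context recovery
begin

lemma petz_rot_linear:
  assumes "x \<in> M" "y \<in> M"
  shows "petz_rot E \<sigma> t (x + y) = petz_rot E \<sigma> t x + petz_rot E \<sigma> t y"
    "petz_rot E \<sigma> t (cscale c x) = cscale c (petz_rot E \<sigma> t x)"
  by (simp_all add: petz_rot_def mm_distribs)

text \<open>\<open>F\<close> adds to the pairing for N a multiple of the recovery error. The three
  lines theorem yields S <= S^(1 - 1/\<alpha>) \<open>PM \<alpha>\<close>^(1/\<alpha>) for S =
  \<open>PN \<alpha>\<close> plus the wanted gain, and this self-referential bound forces S <=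
  \<open>PM \<alpha>\<close>.\<close>

lemma interpolation_gain:
  fixes t :: real
  assumes \<alpha>: "\<alpha> \<ge> 2" and X: "X \<in> M" "madj X = X" "X ** X = mat 1"
  defines "x \<equiv> Re (\<tau> (X ** (\<rho> - petz_rot E \<sigma> t \<rho>N)))"
  assumes x: "x > 0"
  shows "(x / (2 * cosh (pi * t))) powr \<alpha> \<le> PM \<alpha> - PN \<alpha>"
proof -
  note Y = Yz_M[OF \<alpha>] and \<phi> = \<phi>z_N[OF \<alpha>]
  define \<Lambda> where "\<Lambda> = exp (2 * pi * \<bar>t\<bar>)"
  \<comment> \<open>The weight for which the remainder in \<open>L2_contraction\<close> reads a^2 +
    (c b)^2 <= \<open>PM \<alpha>\<close>.\<close>
  define c where "c = 1 / sqrt (1 + \<Lambda>)"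
  have L0: "\<Lambda> > 0" by (simp add: \<Lambda>_def)
  have c0: "c > 0" and c2: "c\<^sup>2 = 1 / (1 + \<Lambda>)" using L0 by (simp_all add: c_def power_divide)
  \<comment> \<open>\<open>q0\<close> and the exponential factor of \<open>F\<close> are chosen so that the boundary bounds are \<open>S\<close> and \<open>sqrt (S * PM \<alpha>)\<close>
    and the value at \<open>1/\<alpha>\<close> is at least \<open>S\<close>.\<close>
  define lc where "lc = - (1 - 2 / \<alpha>) * ln 2 + 2 / \<alpha> * ln c"
  define q0 where "q0 = exp lc * x"
  have q0: "q0 > 0" using x by (simp add: q0_def)
  define L where "L = ln q0"
  define S where "S = PN \<alpha> + exp (\<alpha> * L)"
  have S: "S > 0" using PN_pos[of \<alpha>] by (simp add: S_def add_pos_pos)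
  define \<kappa>0 where "\<kappa>0 = \<alpha> * L - ln 2"
  define \<kappa> where "\<kappa> = - \<alpha> * L + 2 * ln 2 + 2 * ln c"
  define V where "V = (\<lambda>z. X ** (Yz \<alpha> z - petz_rot E \<sigma> t (E (Yz \<alpha> z))))"
  define F where "F = (\<lambda>z. \<tau> (\<phi>z \<alpha> z ** Yz \<alpha> z) + exp (of_real \<kappa>0 + of_real \<kappa> * z) * \<tau> (V z))"
  have VM: "V z \<in> M" for z using X Y petz_rot_mem by (simp add: V_def)
  have ex: "expsum M (\<lambda>z. \<phi>z \<alpha> z ** Yz \<alpha> z + cscale (exp (of_real \<kappa> * z)) (mat 1) ** (cscale (exp (of_real \<kappa>0)) (X ** (Yz \<alpha> z - petz_rot E \<sigma> t (E (Yz \<alpha> z))))))"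
  proof (intro expsum_add expsum_mult[OF M] expsum_Yz[OF \<alpha>] expsum_\<phi>z[OF \<alpha>] expsum_exp)
    have "expsum M (\<lambda>z. petz_rot E \<sigma> t (E (Yz \<alpha> z)))"
      using expsum_Yz[OF \<alpha>] M by (rule expsum_linear) (simp_all add: E_add E_cscale petz_rot_mem petz_rot_linear)
    hence "expsum M (\<lambda>z. X ** (Yz \<alpha> z - petz_rot E \<sigma> t (E (Yz \<alpha> z))))"
      using X by (intro expsum_mult[OF M] expsum_diff[OF M] expsum_const expsum_Yz[OF \<alpha>])
    thus "expsum M (\<lambda>z. cscale (exp (of_real \<kappa>0)) (X ** (Yz \<alpha> z - petz_rot E \<sigma> t (E (Yz \<alpha> z)))))"
      using M by (rule expsum_linear) (auto simp: cscale_add mult_ac)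
  qed simp
  have F_eq: "F = (\<lambda>z. \<tau> (\<phi>z \<alpha> z ** Yz \<alpha> z + cscale (exp (of_real \<kappa> * z)) (mat 1) ** (cscale (exp (of_real \<kappa>0)) (X ** (Yz \<alpha> z - petz_rot E \<sigma> t (E (Yz \<alpha> z)))))))"
    using VM Y \<phi> unfolding F_def V_def by (auto simp: tau_add tau_cscale exp_add mult_ac)
  have nF: "norm (F z) \<le> norm (\<tau> (\<phi>z \<alpha> z ** Yz \<alpha> z)) + exp (\<kappa>0 + \<kappa> * Re z) * norm (\<tau> (V z))" for z
    unfolding F_def by (rule order_trans[OF norm_triangle_ineq]) (simp add: norm_mult)
  have "norm (F (of_real (1 / \<alpha>))) \<le> S powr (1 - 2 * (1/\<alpha>)) * (sqrt S * sqrt (PM \<alpha>)) powr (2 * (1/\<alpha>))"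
  proof -
    obtain B where B: "\<And>z. \<bar>Re z\<bar> \<le> 1/2 \<Longrightarrow> norm (F z) \<le> B" using tau_expsum_bounded[OF ex, of "1/2"] unfolding F_eq by blast
    show ?thesis
    proof (rule three_lines_half_strip[of F S _ B])
      show "F holomorphic_on UNIV" unfolding F_eq by (rule tau_expsum_holomorphic[OF ex])
      show "norm (F z) \<le> B" if "0 \<le> Re z" "Re z \<le> 1/2" for z using B[of z] that by simp
      show "norm (F (\<i> * of_real v)) \<le> S" for v
      proof -
        let ?z = "\<i> * complex_of_real v"
        have "norm (F ?z) \<le> PN \<alpha> + exp \<kappa>0 * 2"
        proof -
          have "exp \<kappa>0 * norm (\<tau> (V ?z)) \<le> exp \<kappa>0 * 2"
            using edge_zero(2)[OF \<alpha> _ X, of ?z t] by (intro mult_left_mono) (simp_all add: V_def)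
          moreover have "norm (F ?z) \<le> norm (\<tau> (\<phi>z \<alpha> ?z ** Yz \<alpha> ?z)) + exp \<kappa>0 * norm (\<tau> (V ?z))" using nF[of ?z] by simp
          moreover have "norm (\<tau> (\<phi>z \<alpha> ?z ** Yz \<alpha> ?z)) \<le> PN \<alpha>" by (rule edge_zero(1)[OF \<alpha> _ X]) simp
          ultimately show ?thesis by linarith
        qed
        also have "exp \<kappa>0 * 2 = exp (\<alpha> * L)" by (simp add: \<kappa>0_def exp_diff)
        finally show ?thesis by (simp add: S_def)
      qed
      show "norm (F (1/2 + \<i> * of_real v)) \<le> sqrt S * sqrt (PM \<alpha>)" for v
      proof -
        let ?z = "1/2 + \<i> * complex_of_real v"
        have "Re ?z = 1/2" by simp
        then obtain a b where ab: "0 \<le> a" "0 \<le> b" "(1 + exp (2 * pi * \<bar>t\<bar>)) * (a\<^sup>2 - PM \<alpha>) + b\<^sup>2 \<le> 0"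
            "norm (\<tau> (\<phi>z \<alpha> ?z ** Yz \<alpha> ?z)) \<le> sqrt (PN \<alpha>) * a" "norm (\<tau> (V ?z)) \<le> b"
          unfolding V_def using edge_half[OF \<alpha> _ X, of ?z t] by blast
        define g where "g = exp (\<alpha> * L / 2)"
        have g2: "g\<^sup>2 = exp (\<alpha> * L)" by (simp add: g_def power2_eq_square mult_exp_exp)
        have "\<kappa>0 + \<kappa> * Re ?z = \<alpha> * L / 2 + ln c" by (simp add: \<kappa>0_def \<kappa>_def field_simps)
        hence e: "exp (\<kappa>0 + \<kappa> * Re ?z) = g * c" using c0 by (simp add: g_def exp_add)
        have "norm (F ?z) \<le> sqrt (PN \<alpha>) * a + g * c * b"
        proof -
          have "g * c * norm (\<tau> (V ?z)) \<le> g * c * b" using ab(5) c0 by (intro mult_left_mono) (simp_all add: g_def)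
          thus ?thesis using nF[of ?z] ab(4) unfolding e by linarith
        qed
        also have "\<dots> \<le> sqrt S * sqrt (PM \<alpha>)"
        proof (rule power2_le_imp_le)
          \<comment> \<open>Cauchy-Schwarz in the plane: the vector (sqrt(PN), g) has squared length
            S, and (a, c b) has squared length at most PM.\<close>
          have "(sqrt (PN \<alpha>) * a + g * c * b)\<^sup>2 \<le> ((sqrt (PN \<alpha>))\<^sup>2 + g\<^sup>2) * (a\<^sup>2 + (c * b)\<^sup>2)"
            using zero_le_power2[of "sqrt (PN \<alpha>) * (c * b) - g * a"] by (simp add: power2_eq_square algebra_simps)
          also have "(sqrt (PN \<alpha>))\<^sup>2 + g\<^sup>2 = S" using PN_pos[of \<alpha>] by (simp add: S_def g2)
          also have "S * (a\<^sup>2 + (c * b)\<^sup>2) \<le> S * PM \<alpha>"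
          proof (intro mult_left_mono)
            have "(1 + \<Lambda>) * a\<^sup>2 + b\<^sup>2 \<le> (1 + \<Lambda>) * PM \<alpha>" using ab(3) by (simp add: \<Lambda>_def algebra_simps)
            thus "a\<^sup>2 + (c * b)\<^sup>2 \<le> PM \<alpha>" using L0 by (simp add: power_mult_distrib c2 field_simps)
          qed (use S in simp)
          also have "S * PM \<alpha> = (sqrt S * sqrt (PM \<alpha>))\<^sup>2" using S PM_pos[of \<alpha>] by (simp add: power_mult_distrib)
          finally show "(sqrt (PN \<alpha>) * a + g * c * b)\<^sup>2 \<le> (sqrt S * sqrt (PM \<alpha>))\<^sup>2" .
        qed (use S PM_pos[of \<alpha>] in simp)
        finally show ?thesis .
      qed
    qed (use S PM_pos[of \<alpha>] \<alpha> in auto)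
  qed
  also have "S powr (1 - 2 * (1/\<alpha>)) * (sqrt S * sqrt (PM \<alpha>)) powr (2 * (1/\<alpha>)) = S powr (1 - 1/\<alpha>) * PM \<alpha> powr (1/\<alpha>)"
  proof -
    have "(sqrt S * sqrt (PM \<alpha>)) powr (2 * (1/\<alpha>)) = S powr (1/\<alpha>) * PM \<alpha> powr (1/\<alpha>)"
      using S PM_pos[of \<alpha>] by (simp add: powr_mult powr_powr flip: powr_half_sqrt)
    thus ?thesis using S by (simp add: powr_add[symmetric])
  qed
  also have "S \<le> norm (F (of_real (1 / \<alpha>)))"
  proof -
    have V: "\<tau> (V (of_real (1/\<alpha>))) = \<tau> (X ** (\<rho> - petz_rot E \<sigma> t \<rho>N))"
      unfolding V_def interior_point(1)[OF \<alpha>] by (simp add: \<rho>N_def)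
    have "\<kappa>0 + \<kappa> * (1/\<alpha>) = (\<alpha> - 1) * L + lc" using \<alpha> by (simp add: \<kappa>0_def \<kappa>_def lc_def field_simps)
    hence "exp (of_real \<kappa>0 + of_real \<kappa> * of_real (1/\<alpha>)) = complex_of_real (exp ((\<alpha> - 1) * L + lc))"
      by (simp only: of_real_mult[symmetric] of_real_add[symmetric] exp_of_real)
    hence "Re (F (of_real (1/\<alpha>))) = PN \<alpha> + exp ((\<alpha> - 1) * L + lc) * x"
      unfolding F_def V interior_point[OF \<alpha>] by (simp add: x_def)
    also have "exp ((\<alpha> - 1) * L + lc) * x = exp ((\<alpha> - 1) * L) * q0" by (simp add: exp_add q0_def)
    also have "\<dots> = exp ((\<alpha> - 1) * L) * exp L" using q0 by (simp add: L_def)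
    also have "\<dots> = exp (\<alpha> * L)" by (simp add: mult_exp_exp left_diff_distrib)
    finally show ?thesis using complex_Re_le_cmod[of "F (of_real (1/\<alpha>))"] unfolding S_def by linarith
  qed
  finally have "S powr (1 - 1/\<alpha>) * S powr (1/\<alpha>) \<le> S powr (1 - 1/\<alpha>) * PM \<alpha> powr (1/\<alpha>)" using S by (simp add: powr_add[symmetric])
  hence "S powr (1/\<alpha>) \<le> PM \<alpha> powr (1/\<alpha>)" using S by simp
  hence "S \<le> PM \<alpha>" using S PM_pos[of \<alpha>] \<alpha> by (metis powr_less_mono2 not_le less_imp_le zero_less_divide_1_iff order_less_le_trans zero_less_numeral)
  \<comment> \<open>\<open>lc\<close> is the average of ln(1/2) and ln c with weights 1 - 2/\<alpha>
    and 2/\<alpha>. Both are at least -ln(2 cosh(pi t)), the second because 1 + exp(2 pi |t|) <= (2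
    cosh(pi t))^2.\<close>
  moreover have "(x / (2 * cosh (pi * t))) powr \<alpha> \<le> exp (\<alpha> * L)"
  proof -
    have ch: "cosh (pi * t) \<ge> 1" by (rule cosh_real_ge_1)
    have "(exp (pi * \<bar>t\<bar>) + exp (- (pi * \<bar>t\<bar>)))\<^sup>2 = \<Lambda> + 2 + exp (- (pi * \<bar>t\<bar>)) ^ 2"
      by (simp add: power2_eq_square \<Lambda>_def algebra_simps mult_exp_exp)
    moreover have "2 * cosh (pi * \<bar>t\<bar>) = exp (pi * \<bar>t\<bar>) + exp (- (pi * \<bar>t\<bar>))" by (simp add: cosh_def)
    moreover have "(exp (- (pi * \<bar>t\<bar>)))\<^sup>2 \<ge> 0" by simp
    ultimately have "1 + \<Lambda> \<le> (2 * cosh (pi * \<bar>t\<bar>))\<^sup>2" by simp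
    also have "cosh (pi * \<bar>t\<bar>) = cosh (pi * t)" by (cases "t \<ge> 0") auto
    finally have "sqrt (1 + \<Lambda>) \<le> 2 * cosh (pi * t)" using ch by (intro real_le_lsqrt) auto
    hence "1 / (2 * cosh (pi * t)) \<le> c" unfolding c_def using L0 by (intro divide_left_mono) auto
    hence "ln (1 / (2 * cosh (pi * t))) \<le> ln c" using ch c0 by (subst ln_le_cancel_iff) auto
    hence l1: "- ln (2 * cosh (pi * t)) \<le> ln c" using ch by (simp add: ln_div)
    have l2: "- ln (2 * cosh (pi * t)) \<le> - ln 2" using ch by simp
    have "- ln (2 * cosh (pi * t)) = (1 - 2/\<alpha>) * (- ln (2 * cosh (pi * t))) + 2/\<alpha> * (- ln (2 * cosh (pi * t)))"
      by (simp add: left_diff_distrib)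
    also have "\<dots> \<le> (1 - 2/\<alpha>) * (- ln 2) + 2/\<alpha> * ln c"
      using l1 l2 \<alpha> by (intro add_mono mult_left_mono) auto
    finally have "- ln (2 * cosh (pi * t)) \<le> lc" unfolding lc_def by linarith
    hence "exp (- ln (2 * cosh (pi * t))) \<le> exp lc" by simp
    hence "x / (2 * cosh (pi * t)) \<le> q0" using x ch unfolding q0_def exp_minus by (simp add: field_simps)
    hence "(x / (2 * cosh (pi * t))) powr \<alpha> \<le> q0 powr \<alpha>" using x ch \<alpha> by (intro powr_mono2) auto
    thus ?thesis using q0 by (simp add: powr_def L_def)
  qed
  ultimately show ?thesis by (simp add: S_def)
qed

end

subsection \<open>Recovery bounds\<close>

text \<open>Tangent line inequality for the convex function powr p at the point a, derived here from
  Young's inequality for r = b / a.\<close>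

lemma powr_diff_le:
  fixes a b p :: real
  assumes "a > 0" "b > 0" "p \<ge> 1"
  shows "a powr p - b powr p \<le> p * a powr (p - 1) * (a - b)"
proof -
  define r where "r = b / a"
  have r: "r > 0" unfolding r_def using assms(1,2) by (rule divide_pos_pos[rotated])
  have b: "b = r * a" using assms(1) by (simp add: r_def)
  have "r = (r powr p) powr (1/p) * 1 powr (1 - 1/p)" using r assms(3) by (simp add: powr_powr)
  also have "\<dots> \<le> (1/p) * r powr p + (1 - 1/p) * 1" using assms r by (intro Youngs_inequality_0) auto
  finally have "p * r \<le> p * ((1/p) * r powr p + (1 - 1/p) * 1)" using assms(3) by (intro mult_left_mono) auto
  also have "\<dots> = r powr p + p - 1" using assms(3) by (simp add: distrib_left right_diff_distrib)
  finally have "p * r \<le> r powr p + p - 1" .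
  hence "(p * r) * a powr p \<le> (r powr p + p - 1) * a powr p" by (intro mult_right_mono) auto
  moreover have "p * a powr (p - 1) * (a - r * a) = p * (1 - r) * a powr p"
  proof -
    have "a powr (p - 1) * a = a powr p" using assms powr_add[of a "p - 1" 1] by simp
    moreover have "p * a powr (p - 1) * (a - r * a) = p * (1 - r) * (a powr (p - 1) * a)" by (simp add: algebra_simps)
    ultimately show ?thesis by simp
  qed
  ultimately show ?thesis unfolding b using assms r by (simp add: powr_mult algebra_simps)
qed

text \<open>The logarithmic estimate needs 0 < D < 1, while \<open>d\<close> may vanish, so D
  decreases to d. For d >= 1 the bound u <= 1 is enough.\<close>

lemma powr_inverse_le_limit:
  fixes u a d :: real
  assumes "\<And>D. 0 < D \<Longrightarrow> D < 1 \<Longrightarrow> d \<le> D \<Longrightarrow> u \<le> D powr a" "0 \<le> u" "u \<le> 1" "a > 0" "d \<ge> 0"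
  shows "u powr (1 / a) \<le> d"
proof (cases "d < 1")
  case True
  thus ?thesis
  proof (rule dense_ge_bounded)
    fix D assume D: "d < D" "D < 1"
    hence "u powr (1/a) \<le> (D powr a) powr (1/a)" using assms by (intro powr_mono2) auto
    thus "u powr (1/a) \<le> D" using D assms by (simp add: powr_powr)
  qed
next
  case False
  have "u powr (1/a) \<le> 1 powr (1/a)" using assms by (intro powr_mono2) auto
  thus ?thesis using False by simp
qed

lemma (in traced_algebra) tau_operator_bound:
  assumes B: "madj B = B" "B \<in> M" and y: "y \<in> M"
  shows "Re (\<tau> (madj y ** B ** y)) \<le> op_norm B * Re (\<tau> (madj y ** y))"
proof -
  have pm: "eproj B c \<in> M" "madj (eproj B c) = eproj B c" "eproj B c ** eproj B c = eproj B c" if "c \<in> eigs B" for c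
    using that eproj_mem[OF B(1) M B(2)] madj_eproj[OF B(1)] eproj_mult[OF B(1)] by auto
  have le: "c \<le> op_norm B" if c: "c \<in> eigs B" for c
  proof -
    obtain w where w: "w \<noteq> 0" "B *v w = of_real c *s w" using eproj_eigenvector[OF B(1) c] .
    have nw: "norm (of_real c *s w) = \<bar>c\<bar> * norm w"
      by (simp add: norm_vec_def norm_mult L2_set_right_distrib[symmetric])
    have "bounded_linear (\<lambda>v. B *v v)"
    proof -
      have "linear (\<lambda>v. B *v v)"
      proof (rule linearI)
        show "B *v (r *\<^sub>R v) = r *\<^sub>R (B *v v)" for r v
          by (simp add: matrix_vector_mult_def vec_eq_iff scaleR_sum_right)
      qed (rule matrix_vector_right_distrib)
      thus ?thesis by (simp add: linear_conv_bounded_linear)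
    qed
    from onorm[OF this, of w] have "\<bar>c\<bar> * norm w \<le> op_norm B * norm w" unfolding op_norm_def w(2) nw .
    hence "\<bar>c\<bar> \<le> op_norm B" using w(1) by simp
    thus ?thesis by simp
  qed
  have nn: "Re (\<tau> (madj y ** eproj B c ** y)) \<ge> 0" if c: "c \<in> eigs B" for c
  proof -
    have "madj y ** eproj B c ** y = madj (eproj B c ** y) ** (eproj B c ** y)"
    proof -
      have "madj (eproj B c ** y) ** (eproj B c ** y) = madj y ** (eproj B c ** eproj B c) ** y"
        by (simp only: madj_simps pm(2)[OF c] mmult_assoc)
      thus ?thesis using pm(3)[OF c] by simp
    qed
    thus ?thesis using ip_self_nonneg[of "eproj B c ** y"] pm(1)[OF c] y by (simp add: ip_def)
  qed
  have "madj y ** B ** y = (\<Sum>c\<in>eigs B. cscale (of_real c) (madj y ** eproj B c ** y))"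
    by (subst eigs_decomp[OF B(1)]) (simp add: mm.sum_left mm.sum_right)
  hence "\<tau> (madj y ** B ** y) = (\<Sum>c\<in>eigs B. of_real c * \<tau> (madj y ** eproj B c ** y))"
    using pm y by (simp add: tau_sum tau_cscale)
  hence "Re (\<tau> (madj y ** B ** y)) = (\<Sum>c\<in>eigs B. c * Re (\<tau> (madj y ** eproj B c ** y)))" by simp
  also have "\<dots> \<le> (\<Sum>c\<in>eigs B. op_norm B * Re (\<tau> (madj y ** eproj B c ** y)))"
    using le nn by (intro sum_mono mult_right_mono) auto
  also have "\<dots> = op_norm B * Re (\<tau> (\<Sum>c\<in>eigs B. madj y ** eproj B c ** y))"
    using pm y by (subst tau_sum) (auto simp: sum_distrib_left)
  also have "(\<Sum>c\<in>eigs B. madj y ** eproj B c ** y) = madj y ** y"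
    using eproj_sum[OF B(1)] mm.sum_left[of "\<lambda>c. madj y ** eproj B c" "eigs B" y] mm.sum_right[of "madj y" "eproj B" "eigs B"] by simp
  finally show ?thesis .
qed

text \<open>The averaged map is defined by a gauge integral of matrices, whereas the estimates are
  Bochner integrals of traces. For a single exponential both reduce to one scalar integral times C,
  so one element I serves for both.\<close>

lemma (in traced_algebra) expsum_integral:
  assumes "expsum M F"
  shows "\<exists>I\<in>M. ((\<lambda>t. (pi / 2 / (cosh (pi * t) + 1)) *\<^sub>R F (\<i> * of_real t)) has_integral I) UNIV
     \<and> (\<forall>X\<in>M. has_bochner_integral lborel (\<lambda>t. of_real (pi / 2 / (cosh (pi * t) + 1)) * \<tau> (X ** F (\<i> * of_real t))) (\<tau> (X ** I)))"
  using assms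
proof induction
  case (expsum_exp C b)
  define w where "w = (\<lambda>t::real. pi / 2 / (cosh (pi * t) + 1))"
  have w: "integrable lborel w" using has_bochner_integral_sech_sq unfolding w_def by (rule integrable.intros)
  have w0: "w t \<ge> 0" for t using cosh_real_pos[of "pi * t"] by (simp add: w_def)
  define z where "z = (LINT t|lborel. of_real (w t) * exp (of_real b * (\<i> * complex_of_real t)))"
  have "integrable lborel (\<lambda>t. of_real (w t) * exp (of_real b * (\<i> * complex_of_real t)))"
  proof (rule Bochner_Integration.integrable_bound[OF w])
    show "(\<lambda>t. complex_of_real (w t) * exp (of_real b * (\<i> * complex_of_real t))) \<in> borel_measurable lborel"
      using borel_measurable_integrable[OF w] by measurable
    show "AE t in lborel. norm (complex_of_real (w t) * exp (of_real b * (\<i> * complex_of_real t))) \<le> norm (w t)"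
      by (simp add: norm_mult)
  qed
  hence hb: "has_bochner_integral lborel (\<lambda>t. of_real (w t) * exp (of_real b * (\<i> * complex_of_real t))) z"
    unfolding z_def by (rule has_bochner_integral_integrable)
  have "has_bochner_integral lborel (\<lambda>t. cscale (of_real (w t) * exp (of_real b * (\<i> * complex_of_real t))) C) (cscale z C)"
    by (rule has_bochner_integral_bounded_linear[OF linear_cscale hb])
  hence "has_bochner_integral lborel (\<lambda>t. w t *\<^sub>R cscale (exp (of_real b * (\<i> * complex_of_real t))) C) (cscale z C)"
    by (simp add: scaleR_cscale)
  hence "((\<lambda>t. w t *\<^sub>R cscale (exp (of_real b * (\<i> * complex_of_real t))) C) has_integral (cscale z C)) UNIV"
    using has_integral_integral_lborel unfolding has_bochner_integral_iff by metis
  moreover have "has_bochner_integral lborel (\<lambda>t. of_real (w t) * \<tau> (X ** cscale (exp (of_real b * (\<i> * complex_of_real t))) C)) (\<tau> (X ** cscale z C))"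
    if X: "X \<in> M" for X
    using has_bochner_integral_mult_left[OF hb, of "\<tau> (X ** C)"] X expsum_exp by (simp add: tau_cscale mult_ac)
  ultimately show ?case using expsum_exp unfolding w_def by (intro bexI[of _ "cscale z C"]) auto
next
  case (expsum_add F G)
  then obtain I J where IJ: "I \<in> M" "J \<in> M"
    "((\<lambda>t. (pi / 2 / (cosh (pi * t) + 1)) *\<^sub>R F (\<i> * of_real t)) has_integral I) UNIV"
    "((\<lambda>t. (pi / 2 / (cosh (pi * t) + 1)) *\<^sub>R G (\<i> * of_real t)) has_integral J) UNIV"
    "\<And>X. X \<in> M \<Longrightarrow> has_bochner_integral lborel (\<lambda>t. of_real (pi / 2 / (cosh (pi * t) + 1)) * \<tau> (X ** F (\<i> * of_real t))) (\<tau> (X ** I))"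
    "\<And>X. X \<in> M \<Longrightarrow> has_bochner_integral lborel (\<lambda>t. of_real (pi / 2 / (cosh (pi * t) + 1)) * \<tau> (X ** G (\<i> * of_real t))) (\<tau> (X ** J))"
    by blast
  show ?case
  proof (intro bexI[of _ "I + J"] conjI ballI)
    show "((\<lambda>t. (pi / 2 / (cosh (pi * t) + 1)) *\<^sub>R (F (\<i> * of_real t) + G (\<i> * of_real t))) has_integral (I + J)) UNIV"
      using has_integral_add[OF IJ(3,4)] by (simp add: scaleR_add_right)
    fix X assume X: "X \<in> M"
    show "has_bochner_integral lborel (\<lambda>t. of_real (pi / 2 / (cosh (pi * t) + 1)) * \<tau> (X ** (F (\<i> * of_real t) + G (\<i> * of_real t)))) (\<tau> (X ** (I + J)))"
      using has_bochner_integral_add[OF IJ(5,6)[OF X]] X IJ(1,2) expsum_mem[OF expsum_add(1) M] expsum_mem[OF expsum_add(2) M]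
      by (simp add: mm.add_right tau_add distrib_left)
  qed (use IJ in simp)
qed

lemma half_sech_integral: "has_bochner_integral lborel (\<lambda>t. 1 / (2 * cosh (pi * (t / 2)))) 1"
proof -
  have "has_bochner_integral lborel (\<lambda>v. 1 / (2 * cosh (2 * pi * v))) (1/4)"
    using has_bochner_integral_mult_right[OF sech_integral[of 0], of "1/2"] by simp
  moreover have "2 * pi * (0 + (1/4) * t) = pi * (t / 2)" for t :: real by simp
  ultimately show ?thesis
    using lborel_has_bochner_integral_real_affine_iff[of "1/4" "\<lambda>v. 1 / (2 * cosh (2 * pi * v))" "1/4" 0] by (simp add: mult.commute)
qed

section \<open>Assembly for all exponents and averaging over t\<close>

context recovery
begin

text \<open>With W the normalised \<alpha>-th power on M, Hoelder's inequality is an equality, so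
  the left side is a moment of order -s; the power mean inequality compares it with the moment of
  order -1.\<close>

lemma PM_le_max_bound:
  assumes \<alpha>: "\<alpha> > 1" and q: "max_bound q"
  shows "PM \<alpha> powr (1/\<alpha>) \<le> q powr (1 - 1/\<alpha>)"
proof -
  let ?A = "Aop (1/\<alpha> - 1)"
  define W where "W = cscale (of_real (1 / PM \<alpha>)) (mpow ?A (of_real \<alpha>))"
  note nm = normalized_mpow[OF pd_Aop[of "1/\<alpha> - 1"] Aop_M, where \<alpha> = \<alpha>, folded PM_def W_def]
  note W = nm(2,1) and tW = nm(3)
  have PM: "\<tau> (mpow ?A (of_real \<alpha>)) = of_real (PM \<alpha>)" unfolding PM_def by (rule tau_mpow_real[OF pd_Aop Aop_M])
  define s where "s = 1 - 1/\<alpha>"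
  have s: "0 < s" "s < 1" "\<alpha> * s = \<alpha> - 1" using \<alpha> by (simp_all add: s_def field_simps)
  have mW: "mpow W (of_real s) = cscale (of_real (PM \<alpha> powr (- s))) (mpow ?A (of_real (\<alpha> * s)))" by (rule nm(4))
  have "complex_of_real (\<Sum>p\<in>eigs \<sigma> \<times> eigs W. wt \<sigma> W a0 p * (fst p / snd p) powr (- s)) = \<tau> (?A ** mpow W (of_real s))"
    using moment_ratio[of \<sigma> W a0 "- s"] a0_xi W by (simp add: pds Aop_def s_def)
  also have "?A ** mpow W (of_real s) = cscale (of_real (PM \<alpha> powr (- s))) (mpow ?A 1 ** mpow ?A (of_real (\<alpha> * s)))"
    unfolding mW by (simp add: mpow_1 pd_Aop)
  also have "mpow ?A 1 ** mpow ?A (of_real (\<alpha> * s)) = mpow ?A (of_real \<alpha>)" unfolding s(3) by (simp add: mpow_mult pd_Aop)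
  also have "\<tau> (cscale (of_real (PM \<alpha> powr (- s))) (mpow ?A (of_real \<alpha>))) = of_real (PM \<alpha> powr (- s) * PM \<alpha>)"
    using PM by (subst tau_cscale) (simp_all add: pd_Aop)
  also have "PM \<alpha> powr (- s) * PM \<alpha> = PM \<alpha> powr (1/\<alpha>)"
    using PM_pos[of \<alpha>] powr_add[of "PM \<alpha>" "- s" 1] by (simp add: s_def)
  finally have "PM \<alpha> powr (1/\<alpha>) = (\<Sum>p\<in>eigs \<sigma> \<times> eigs W. wt \<sigma> W a0 p * (fst p / snd p) powr (- s))"
    by (simp only: of_real_eq_iff)
  also have "\<dots> = (\<Sum>p\<in>eigs \<sigma> \<times> eigs W. wt \<sigma> W a0 p * ((fst p / snd p) powr (-1)) powr s)"
    by (simp only: powr_powr) simp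
  also have "\<dots> \<le> (\<Sum>p\<in>eigs \<sigma> \<times> eigs W. wt \<sigma> W a0 p * (fst p / snd p) powr (-1)) powr s"
  proof (rule power_mean_le)
    show "finite (eigs \<sigma> \<times> eigs W)" using finite_eigs[OF pd_madj[OF W(1)]] finite_eigs[OF pd_madj[OF pd_sigma]] by simp
    show "sum (wt \<sigma> W a0) (eigs \<sigma> \<times> eigs W) = 1" using sum_wt[OF pd_sigma sigma_M W a0_xi(1)] a0_xi by simp
    show "(fst p / snd p) powr - 1 > 0" if "p \<in> eigs \<sigma> \<times> eigs W" for p
      using that pd_eigs[OF pd_sigma, of "fst p"] pd_eigs[OF W(1), of "snd p"] by (auto simp: mem_Times_iff)
  qed (use s wt_nonneg in auto)
  also have "\<dots> \<le> q powr s"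
    using max_bound_moment[OF q W tW] s by (intro powr_mono2) (auto intro!: sum_nonneg mult_nonneg_nonneg simp: wt_nonneg)
  finally show ?thesis unfolding s_def .
qed

lemma trace_le_2:
  assumes X: "X \<in> M" "madj X = X" "X ** X = mat 1"
  shows "Re (\<tau> (X ** (\<rho> - petz_rot E \<sigma> t \<rho>N))) \<le> 2"
  by (rule recovery_trace(2)[OF WN_N pd_WN tau_WN X])

text \<open>For \<alpha> > 2 the interpolation controls a difference of \<alpha>-th powers. The
  tangent inequality together with Q <= q converts it into \<alpha> q^(\<alpha> - 1) D, the input of
  \<open>interpolation_bound_numeric\<close>.\<close>

lemma trace_recovery_bound:
  fixes \<alpha> \<epsilon> D q t :: real
  defines "s \<equiv> \<bar>1 - 1/\<alpha>\<bar>"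
  assumes \<alpha>: "1/2 < \<alpha>" "\<alpha> \<noteq> 1" and q: "max_bound q"
    and D: "0 < D" "D < 1" "\<bar>PM \<alpha> powr (1/\<alpha>) - PN \<alpha> powr (1/\<alpha>)\<bar> \<le> D"
    and eps: "0 < \<epsilon>" "\<epsilon> < (1 - s) / 2"
    and X: "X \<in> M" "madj X = X" "X ** X = mat 1"
  shows "pi / (2 * cosh (pi * t)) * Re (\<tau> (X ** (\<rho> - petz_rot E \<sigma> t \<rho>N)))
    \<le> (4 * sqrt q + sqrt (pi / (exp 1 * \<epsilon> * sin (pi * s))) + 4) * D powr ((1 - s) / 2 - \<epsilon>)"
proof (cases "\<alpha> \<le> 2")
  case True
  show ?thesis unfolding s_def by (rule resolvent_case[OF \<alpha> True q D eps[unfolded s_def] X])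
next
  case False
  define B where "B = 4 * sqrt q + sqrt (pi / (exp 1 * \<epsilon> * sin (pi * s))) + 4"
  define x where "x = Re (\<tau> (X ** (\<rho> - petz_rot E \<sigma> t \<rho>N)))"
  have q1: "q \<ge> 1" by (rule max_bound_ge_1[OF q])
  have s: "s = 1 - 1/\<alpha>" "0 < s" "s < 1" using False by (auto simp: s_def field_simps)
  have "sin (pi * s) > 0" using s by (intro sin_gt_zero) auto
  hence B: "B \<ge> 4 * sqrt q" "B > 0" using q1 eps(1) by (auto simp: B_def intro!: add_nonneg_pos add_nonneg_nonneg)
  show ?thesis
  proof (cases "x > 0")
    case x: True
    define y where "y = x / (2 * cosh (pi * t))"
    have ch: "cosh (pi * t) \<ge> 1" by (rule cosh_real_ge_1)
    have y: "0 \<le> y" "y \<le> 1" using x ch trace_le_2[OF X, of t] unfolding y_def x_def[symmetric] by (auto simp: field_simps)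
    have a: "0 < (1 - s) / 2 - \<epsilon>" "(1 - s) / 2 - \<epsilon> \<le> 1 / (2 * \<alpha>)" using eps by (auto simp: s(1))
    define Q where "Q = PM \<alpha> powr (1/\<alpha>)"
    define QN where "QN = PN \<alpha> powr (1/\<alpha>)"
    have Qp: "Q > 0" "QN > 0" using PM_pos[of \<alpha>] PN_pos[of \<alpha>] by (simp_all add: Q_def QN_def)
    have QP: "Q powr \<alpha> = PM \<alpha>" "QN powr \<alpha> = PN \<alpha>"
      using PM_pos[of \<alpha>] PN_pos[of \<alpha>] False by (simp_all add: Q_def QN_def powr_powr)
    have "y powr \<alpha> \<le> Q powr \<alpha> - QN powr \<alpha>"
      using interpolation_gain[OF _ X, of \<alpha> t] x False unfolding QP y_def x_def by simp
    also have "\<dots> \<le> \<alpha> * Q powr (\<alpha> - 1) * (Q - QN)" using Qp False by (intro powr_diff_le) auto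
    also have "\<dots> \<le> \<alpha> * Q powr (\<alpha> - 1) * D"
      using D(3) False by (intro mult_left_mono) (auto simp: Q_def QN_def)
    also have "\<dots> \<le> \<alpha> * q powr (\<alpha> - 1) * D"
    proof -
      have "Q \<le> q powr 1"
        using PM_le_max_bound[OF _ q, of \<alpha>] False powr_mono[of "1 - 1/\<alpha>" 1 q] q1 by (simp add: Q_def)
      hence "Q powr (\<alpha> - 1) \<le> q powr (\<alpha> - 1)" using False Qp q1 by (intro powr_mono2) auto
      thus ?thesis using False D by (intro mult_right_mono mult_left_mono) auto
    qed
    finally have "pi * y / B \<le> D powr ((1 - s) / 2 - \<epsilon>)"
      using interpolation_bound_numeric[OF q1 _ _ a y B(1)] D False by simp
    hence "pi * y \<le> B * D powr ((1 - s) / 2 - \<epsilon>)" using B by (simp add: field_simps)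
    thus ?thesis by (simp add: y_def B_def x_def)
  next
    case x: False
    have "cosh (pi * t) > 0" by simp
    hence "pi / (2 * cosh (pi * t)) * x \<le> 0" using x by (intro mult_nonneg_nonpos) auto
    moreover have "B * D powr ((1 - s) / 2 - \<epsilon>) \<ge> 0" using B by simp
    ultimately show ?thesis unfolding x_def B_def by linarith
  qed
qed

lemma Q_sand_eq: "\<alpha> \<noteq> 0 \<Longrightarrow> Q_sand \<tau> \<alpha> \<rho> \<sigma> = PM \<alpha> powr (1/\<alpha>)"
  and Q_sand_N_eq: "\<alpha> \<noteq> 0 \<Longrightarrow> Q_sand \<tau> \<alpha> (E \<rho>) (E \<sigma>) = PN \<alpha> powr (1/\<alpha>)"
proof -
  assume "\<alpha> \<noteq> 0"
  hence e: "- 1 / (\<alpha> / (\<alpha> - 1)) = 1/\<alpha> - 1" by (simp add: field_simps)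
  have sq: "mpow (madj A ** A) (of_real (\<alpha> / 2)) = mpow A (of_real \<alpha>)" if "pd A" for A :: "'n cmat"
    using mpow_square[OF that, of "of_real \<alpha>"] pd_madj[OF that] by simp
  show "Q_sand \<tau> \<alpha> \<rho> \<sigma> = PM \<alpha> powr (1/\<alpha>)"
    unfolding Q_sand_def schatten_norm_def e PM_def using sq[OF pd_Aop] unfolding Aop_def a0_def by metis
  show "Q_sand \<tau> \<alpha> (E \<rho>) (E \<sigma>) = PN \<alpha> powr (1/\<alpha>)"
    unfolding Q_sand_def schatten_norm_def e PN_def \<rho>N_def[symmetric] \<sigma>N_def[symmetric]
    using sq[OF pd_AN] unfolding AN_def xi_def by metis
qed

lemma max_bound_Q_inf: "max_bound (Q_inf \<rho> \<sigma>)"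
proof -
  have "Q_inf \<rho> \<sigma> = op_norm (Aop (-1))" by (simp add: Q_inf_def Aop_def a0_def)
  thus ?thesis unfolding max_bound_def using tau_operator_bound[OF pd_madj[OF pd_Aop] Aop_M] by simp
qed

lemma madj_petz_rot: "madj y = y \<Longrightarrow> madj (petz_rot E \<sigma> t y) = petz_rot E \<sigma> t y"
  unfolding petz_rot_def \<sigma>N_def[symmetric] by (simp add: alg pds minus_it)

text \<open>In z = i t the rotated map with parameter t/2 is an exponential sum, so
  \<open>expsum_integral\<close> applies; self-adjointness passes to the integral because its value
  is unique.\<close>

lemma petz_univ_trace:
  shows "petz_univ E \<sigma> \<rho>N \<in> M" "madj (petz_univ E \<sigma> \<rho>N) = petz_univ E \<sigma> \<rho>N"
    and "X \<in> M \<Longrightarrow> has_bochner_integral lborel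
      (\<lambda>t. (pi / 2 / (cosh (pi * t) + 1)) * Re (\<tau> (X ** (\<rho> - petz_rot E \<sigma> (t / 2) \<rho>N)))) (Re (\<tau> (X ** (\<rho> - petz_univ E \<sigma> \<rho>N))))"
proof -
  define F where "F = (\<lambda>z. mpow \<sigma> (of_real (1/2) + of_real (-1/2) * z) ** mpow \<sigma>N (of_real (-1/2) + of_real (1/2) * z) ** \<rho>N
     ** mpow \<sigma>N (of_real (-1/2) + of_real (-1/2) * z) ** mpow \<sigma> (of_real (1/2) + of_real (1/2) * z))"
  have F: "expsum M F" unfolding F_def
    by (intro expsum_mult[OF M] expsum_mpow[OF M] expsum_const) (simp_all add: pds)
  have petz: "petz_rot E \<sigma> (t / 2) \<rho>N = F (\<i> * of_real t)" for t
  proof -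
    have "1/2 - \<i> * complex_of_real (t / 2) = of_real (1/2) + of_real (-1/2) * (\<i> * of_real t)"
      "- 1/2 + \<i> * complex_of_real (t / 2) = of_real (-1/2) + of_real (1/2) * (\<i> * of_real t)"
      "- 1/2 - \<i> * complex_of_real (t / 2) = of_real (-1/2) + of_real (-1/2) * (\<i> * of_real t)"
      "1/2 + \<i> * complex_of_real (t / 2) = of_real (1/2) + of_real (1/2) * (\<i> * of_real t)" by simp_all
    thus ?thesis unfolding petz_rot_def F_def \<sigma>N_def[symmetric] by (simp only:)
  qed
  obtain I where I: "I \<in> M" "((\<lambda>t. (pi / 2 / (cosh (pi * t) + 1)) *\<^sub>R F (\<i> * of_real t)) has_integral I) UNIV"
    "\<And>X. X \<in> M \<Longrightarrow> has_bochner_integral lborel (\<lambda>t. of_real (pi / 2 / (cosh (pi * t) + 1)) * \<tau> (X ** F (\<i> * of_real t))) (\<tau> (X ** I))"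
    using expsum_integral[OF F] by blast
  have pI: "petz_univ E \<sigma> \<rho>N = I" unfolding petz_univ_def petz using I(2) by (rule integral_unique)
  show "petz_univ E \<sigma> \<rho>N \<in> M" unfolding pI by (rule I(1))
  have hF: "madj (F (\<i> * of_real t)) = F (\<i> * of_real t)" for t
    unfolding petz[symmetric] by (intro madj_petz_rot pd_madj pds)
  have "((\<lambda>t. madj ((pi / 2 / (cosh (pi * t) + 1)) *\<^sub>R F (\<i> * of_real t))) has_integral madj I) UNIV"
    using has_integral_linear[OF I(2) bounded_linear_madj] by (simp add: o_def)
  hence "((\<lambda>t. (pi / 2 / (cosh (pi * t) + 1)) *\<^sub>R F (\<i> * of_real t)) has_integral madj I) UNIV"
    by (simp add: scaleR_cscale hF)
  thus "madj (petz_univ E \<sigma> \<rho>N) = petz_univ E \<sigma> \<rho>N" unfolding pI using I(2) by (rule has_integral_unique)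
  assume X: "X \<in> M"
  have FM: "F z \<in> M" for z by (rule expsum_mem[OF F M])
  have "has_bochner_integral lborel (\<lambda>t. (pi / 2 / (cosh (pi * t) + 1)) * Re (\<tau> (X ** \<rho>)) - Re (of_real (pi / 2 / (cosh (pi * t) + 1)) * \<tau> (X ** F (\<i> * of_real t))))
     (1 * Re (\<tau> (X ** \<rho>)) - Re (\<tau> (X ** I)))"
    by (intro has_bochner_integral_diff has_bochner_integral_mult_left has_bochner_integral_sech_sq has_bochner_integral_Re I(3) X)
  thus "has_bochner_integral lborel (\<lambda>t. (pi / 2 / (cosh (pi * t) + 1)) * Re (\<tau> (X ** (\<rho> - petz_rot E \<sigma> (t / 2) \<rho>N)))) (Re (\<tau> (X ** (\<rho> - petz_univ E \<sigma> \<rho>N))))"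
    unfolding pI petz using X FM I(1) by (simp add: mm.diff_right tau_diff right_diff_distrib del: of_real_divide of_real_add)
qed

text \<open>The pointwise estimate carries a factor 2 cosh(pi t / 2) / pi. Multiplied by the density
  of the average it becomes another probability density, by cosh(2 x) + 1 = 2 cosh(x)^2, so
  averaging loses nothing.\<close>

lemma sech_weight: "pi / 2 / (cosh (pi * t) + 1) * (2 * cosh (pi * (t / 2)) / pi) = 1 / (2 * cosh (pi * (t / 2)))" for t :: real
proof -
  have "cosh (pi * t) = cosh (2 * (pi * (t / 2)))" by simp
  also have "\<dots> = 2 * (cosh (pi * (t / 2)))\<^sup>2 - 1" by (rule cosh_double_cosh)
  finally have "cosh (pi * t) + 1 = 2 * (cosh (pi * (t / 2)))\<^sup>2" by simp
  moreover have "cosh (pi * (t / 2)) > 0" by simp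
  ultimately show ?thesis by (simp add: power2_eq_square)
qed

theorem recovery_bounds:
  fixes \<alpha> \<epsilon> :: real
  defines "s \<equiv> \<bar>1 - 1/\<alpha>\<bar>" and "d \<equiv> \<bar>Q_sand \<tau> \<alpha> \<rho> \<sigma> - Q_sand \<tau> \<alpha> (E \<rho>) (E \<sigma>)\<bar>"
  defines "B \<equiv> 4 * sqrt (Q_inf \<rho> \<sigma>) + sqrt (pi / (exp 1 * \<epsilon> * sin (pi * s))) + 4"
  assumes \<alpha>: "1/2 < \<alpha>" "\<alpha> \<noteq> 1" and eps: "0 < \<epsilon>" "\<epsilon> < (1 - s) / 2"
  shows "(1 / B * (pi / (2 * cosh (pi * t))) * schatten_norm \<tau> 1 (\<rho> - petz_rot E \<sigma> t (E \<rho>))) powr (1 / ((1 - s) / 2 - \<epsilon>)) \<le> d"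
    and "(1 / B * (1 / 2) * schatten_norm \<tau> 1 (\<rho> - petz_univ E \<sigma> (E \<rho>))) powr (1 / ((1 - s) / 2 - \<epsilon>)) \<le> d"
proof -
  have \<alpha>0: "\<alpha> \<noteq> 0" using \<alpha> by simp
  have d: "d = \<bar>PM \<alpha> powr (1/\<alpha>) - PN \<alpha> powr (1/\<alpha>)\<bar>"
    unfolding d_def Q_sand_eq[OF \<alpha>0] Q_sand_N_eq[OF \<alpha>0] ..
  have d0: "d \<ge> 0" by (simp add: d_def)
  note q = max_bound_Q_inf
  have q1: "Q_inf \<rho> \<sigma> \<ge> 1" by (rule max_bound_ge_1[OF q])
  have s: "0 < s" "s < 1" using \<alpha> by (auto simp: s_def field_simps abs_if)
  have "sin (pi * s) > 0" using s by (intro sin_gt_zero) auto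
  hence "sqrt (pi / (exp 1 * \<epsilon> * sin (pi * s))) \<ge> 0" using eps(1) by simp
  moreover have "sqrt (Q_inf \<rho> \<sigma>) \<ge> 1" using q1 by simp
  ultimately have B: "B \<ge> 8" unfolding B_def by linarith
  define a where "a = (1 - s) / 2 - \<epsilon>"
  have a: "a > 0" using eps by (simp add: a_def)
  note bound = trace_recovery_bound[OF \<alpha> q, folded d s_def, OF _ _ _ eps, folded B_def a_def]
  have R: "E \<rho> = \<rho>N" by (simp add: \<rho>N_def)
  have mr: "madj \<rho> = \<rho>" "madj \<rho>N = \<rho>N" by (intro pd_madj pds)+
  show "(1 / B * (pi / (2 * cosh (pi * t))) * schatten_norm \<tau> 1 (\<rho> - petz_rot E \<sigma> t (E \<rho>))) powr (1 / ((1 - s) / 2 - \<epsilon>)) \<le> d"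
  proof -
    have y: "\<rho> - petz_rot E \<sigma> t \<rho>N \<in> M" "madj (\<rho> - petz_rot E \<sigma> t \<rho>N) = \<rho> - petz_rot E \<sigma> t \<rho>N"
      using petz_rot_mem[of \<rho>N t] by (simp_all add: mr madj_petz_rot)
    \<comment> \<open>X is fixed before D, as it depends only on the difference of the states; the
      same X serves for all D in the limit.\<close>
    obtain X where X: "X \<in> M" "madj X = X" "X ** X = mat 1"
      and n: "schatten_norm \<tau> 1 (\<rho> - petz_rot E \<sigma> t \<rho>N) = Re (\<tau> (X ** (\<rho> - petz_rot E \<sigma> t \<rho>N)))"
      using trace_norm_sign[OF y] by blast
    define x where "x = schatten_norm \<tau> 1 (\<rho> - petz_rot E \<sigma> t \<rho>N)"
    have x0: "x \<ge> 0" by (simp add: x_def schatten_norm_def)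
    have x2: "x \<le> 2" unfolding x_def n by (rule trace_le_2[OF X])
    have ch: "cosh (pi * t) \<ge> 1" by (rule cosh_real_ge_1)
    have "(1 / B * (pi / (2 * cosh (pi * t))) * x) powr (1 / a) \<le> d"
    proof (rule powr_inverse_le_limit[OF _ _ _ a d0])
      fix D :: real assume D: "0 < D" "D < 1" "d \<le> D"
      show "1 / B * (pi / (2 * cosh (pi * t))) * x \<le> D powr a"
        using bound[OF D X, of t] B unfolding x_def n by (simp add: field_simps)
    next
      show "0 \<le> 1 / B * (pi / (2 * cosh (pi * t))) * x" using B x0 by simp
      \<comment> \<open>B >= 8, pi < 4 and a trace norm of at most 2 give the bound u <= 1 that
        \<open>powr_inverse_le_limit\<close> requires.\<close>
      have "1 / B * (pi / (2 * cosh (pi * t))) * x \<le> 1 / 8 * (4 / 2) * 2"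
        using B x0 x2 ch pi_less_4 by (intro mult_mono frac_le) auto
      thus "1 / B * (pi / (2 * cosh (pi * t))) * x \<le> 1" by simp
    qed
    thus ?thesis unfolding R x_def a_def .
  qed
  show "(1 / B * (1 / 2) * schatten_norm \<tau> 1 (\<rho> - petz_univ E \<sigma> (E \<rho>))) powr (1 / ((1 - s) / 2 - \<epsilon>)) \<le> d"
  proof -
    note U = petz_univ_trace
    have y: "\<rho> - petz_univ E \<sigma> \<rho>N \<in> M" "madj (\<rho> - petz_univ E \<sigma> \<rho>N) = \<rho> - petz_univ E \<sigma> \<rho>N"
      using U(1,2) by (simp_all add: mr)
    obtain X where X: "X \<in> M" "madj X = X" "X ** X = mat 1"
      and n: "schatten_norm \<tau> 1 (\<rho> - petz_univ E \<sigma> \<rho>N) = Re (\<tau> (X ** (\<rho> - petz_univ E \<sigma> \<rho>N)))"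
      using trace_norm_sign[OF y] by blast
    define x where "x = schatten_norm \<tau> 1 (\<rho> - petz_univ E \<sigma> \<rho>N)"
    have x0: "x \<ge> 0" by (simp add: x_def schatten_norm_def)
    have w0: "pi / 2 / (cosh (pi * t) + 1) \<ge> 0" for t using cosh_real_pos[of "pi * t"] by simp
    have x2: "x \<le> 1 * 2" unfolding x_def n
    proof (rule has_bochner_integral_le[OF U(3)[OF X(1)] has_bochner_integral_mult_left[OF has_bochner_integral_sech_sq]])
      show "(pi / 2 / (cosh (pi * t) + 1)) * Re (\<tau> (X ** (\<rho> - petz_rot E \<sigma> (t / 2) \<rho>N))) \<le> (pi / 2 / (cosh (pi * t) + 1)) * 2" for t
        using trace_le_2[OF X] w0 by (intro mult_left_mono)
    qed
    have "(1 / B * (1 / 2) * x) powr (1 / a) \<le> d"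
    proof (rule powr_inverse_le_limit[OF _ _ _ a d0])
      fix D :: real assume D: "0 < D" "D < 1" "d \<le> D"
      have "x \<le> 1 * (B * D powr a)" unfolding x_def n
      proof (rule has_bochner_integral_le[OF U(3)[OF X(1)] has_bochner_integral_mult_left[OF half_sech_integral]])
        fix t :: real
        let ?c = "cosh (pi * (t / 2))"
        have c: "?c > 0" by simp
        have "Re (\<tau> (X ** (\<rho> - petz_rot E \<sigma> (t / 2) \<rho>N))) \<le> 2 * ?c / pi * (B * D powr a)"
          using bound[OF D X, of "t / 2"] c by (simp add: field_simps)
        hence "(pi / 2 / (cosh (pi * t) + 1)) * Re (\<tau> (X ** (\<rho> - petz_rot E \<sigma> (t / 2) \<rho>N)))
           \<le> (pi / 2 / (cosh (pi * t) + 1)) * (2 * ?c / pi * (B * D powr a))" using w0 by (rule mult_left_mono)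
        also have "\<dots> = 1 / (2 * ?c) * (B * D powr a)" unfolding sech_weight[symmetric] by (simp only: mult.assoc)
        finally show "(pi / 2 / (cosh (pi * t) + 1)) * Re (\<tau> (X ** (\<rho> - petz_rot E \<sigma> (t / 2) \<rho>N))) \<le> 1 / (2 * ?c) * (B * D powr a)" .
      qed
      hence "1 / B * x \<le> D powr a" using B by (simp add: field_simps)
      moreover have "0 \<le> 1 / B * x" using B x0 by simp
      ultimately show "1 / B * (1 / 2) * x \<le> D powr a" by simp
    next
      show "0 \<le> 1 / B * (1 / 2) * x" using B x0 by simp
      have "1 / B * (1 / 2) * x \<le> 1 / 8 * (1 / 2) * 2" using B x0 x2 by (intro mult_mono frac_le) auto
      thus "1 / B * (1 / 2) * x \<le> 1" by simp
    qed
    thus ?thesis unfolding R x_def a_def .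
  qed
qed

end

theorem theorem4p20:
  fixes M N :: "(complex^'n::finite^'n) set"
    and \<tau> :: "complex^'n^'n \<Rightarrow> complex"
    and E :: "complex^'n^'n \<Rightarrow> complex^'n^'n"
    and \<rho> \<sigma> :: "complex^'n^'n"
    and \<alpha> \<epsilon> :: real
  assumes M: "star_subalg M" and N: "star_subalg N" and NM: "N \<subseteq> M"
    and tr: "faithful_trace M \<tau>"
    and E: "cond_exp M N \<tau> E"
    and rho: "faithful_state M \<tau> \<rho>" and sigma: "faithful_state M \<tau> \<sigma>"
    and alpha: "\<alpha> \<in> {1/2<..<1} \<union> {1<..}"
    and eps: "0 < \<epsilon>" "\<epsilon> < (1 - 1 / \<bar>\<alpha> / (\<alpha> - 1)\<bar>) / 2"
  shows "let \<alpha>' = \<alpha> / (\<alpha> - 1);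
             \<gamma> = 1 / ((1 - 1 / \<bar>\<alpha>'\<bar>) / 2 - \<epsilon>);
             K = 1 / (4 * sqrt (Q_inf \<rho> \<sigma>) + sqrt (pi / (exp 1 * \<epsilon> * sin (pi / \<bar>\<alpha>'\<bar>))) + 4);
             D = \<bar>Q_sand \<tau> \<alpha> \<rho> \<sigma> - Q_sand \<tau> \<alpha> (E \<rho>) (E \<sigma>)\<bar>
         in D \<ge> (K * (pi / 2) * schatten_norm \<tau> 1 (\<rho> - petz_rot E \<sigma> 0 (E \<rho>))) powr \<gamma>
          \<and> (\<forall>t::real. D \<ge> (K * (pi / (2 * cosh (pi * t))) * schatten_norm \<tau> 1 (\<rho> - petz_rot E \<sigma> t (E \<rho>))) powr \<gamma>)
          \<and> D \<ge> (K * (1 / 2) * schatten_norm \<tau> 1 (\<rho> - petz_univ E \<sigma> (E \<rho>))) powr \<gamma>"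
proof -
  interpret recovery M \<tau> N E \<rho> \<sigma> by unfold_locales fact+
  have \<alpha>: "1/2 < \<alpha>" "\<alpha> \<noteq> 1" using alpha by auto
  \<comment> \<open>Identifies 1/|\<alpha>'| with the parameter s = |1 - 1/\<alpha>| of the internal
    bounds.\<close>
  have s: "1 / \<bar>\<alpha> / (\<alpha> - 1)\<bar> = \<bar>1 - 1/\<alpha>\<bar>" "pi / \<bar>\<alpha> / (\<alpha> - 1)\<bar> = pi * \<bar>1 - 1/\<alpha>\<bar>"
  proof -
    have "1 - 1/\<alpha> = (\<alpha> - 1) / \<alpha>" using \<alpha> by (simp add: field_simps)
    thus "1 / \<bar>\<alpha> / (\<alpha> - 1)\<bar> = \<bar>1 - 1/\<alpha>\<bar>" "pi / \<bar>\<alpha> / (\<alpha> - 1)\<bar> = pi * \<bar>1 - 1/\<alpha>\<bar>" by (simp_all add: abs_divide)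
  qed
  note b = recovery_bounds[OF \<alpha> eps[unfolded s]]
  \<comment> \<open>The first inequality is the second at t = 0, where the factor becomes pi /
    2.\<close>
  have "cosh (pi * 0) = (1::real)" by simp
  thus ?thesis using b(1)[of 0] b unfolding Let_def s by simp
qed

end
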